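(* Let $0<\alpha<1$ and $\pi\in(0,1)$ with $Q_{\alpha,\pi}:=\frac{(1-\alpha)(1-\pi)}{\alpha\pi}>1$. Consider multiple $F$-tests of $H_i:\boldsymbol\beta_i=0$ in the linear regressions $Y=\boldsymbol\beta_i^T\boldsymbol X+\epsilon_i$ with $p$ covariates, $\epsilon_i\sim N(0,\sigma_i)$, fixed design $\boldsymbol X_1,\boldsymbol X_2,\dots$ and $n+p$ observations per null, under the random effects model, where for all false nulls $$\frac{(\boldsymbol\beta_i^T\boldsymbol X_1)^2+\cdots+(\boldsymbol\beta_i^T\boldsymbol X_k)^2}{k\sigma_i^2}\le\delta^2,\qquad k=1,2,\dots,$$ with $\delta>0$. Let $n_*=n_*(p,\delta)$ be the infimum of $n$ for which $\mathrm{pFDR}\le\alpha$ can be attained under this constraint. Then: a) If $\delta\to0$ while $p$ is fixed, then $$n_*\sim\frac1\delta\,M_p^{-1}(Q_{\alpha,\pi}),\qquad M_p(t):=\sum_{k=0}^\infty\frac{\Gamma(p/2)\,(t^2/4)^k}{k!\,\Gamma(k+p/2)} .$$ b) If $\delta\to0$ and $p\to\infty$, then $$n_*\sim\begin{cases}\dfrac1\delta\sqrt{2p\ln Q_{\alpha,\pi}} & \text{if }\delta^2p\to0,\\[2mm] \dfrac{2}{\delta^2}\ln Q_{\alpha,\pi} & \text{if }\delta^2p\to\infty,\\[2mm] \dfrac{(4/\delta^2)\ln Q_{\alpha,\pi}}{1+\sqrt{1+8\ln Q_{\alpha,\pi}/L}} & \text{if }\delta^2p\to L>0.\end{cases}$$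 c) If $\delta>0$ is fixed while $p\to\infty$, then $$n_*\to\left\lceil\frac{2\ln Q_{\alpha,\pi}}{\ln(1+\delta^2)}\right\rceil .$$
   Context: $N(0,\sigma)$ is the centered normal distribution with standard deviation $\sigma$. For each $i$ the sample is $(Y_{i1},\boldsymbol X_1),\dots,(Y_{i,n+p},\boldsymbol X_{n+p})$ with $Y_{ik}=\boldsymbol\beta_i^T\boldsymbol X_k+\epsilon_{ik}$, $\epsilon_{ik}$ iid $\sim N(0,\sigma_i)$, $\boldsymbol\beta_i,\boldsymbol X_k\in\mathbb R^p$, the $\boldsymbol X_k$ being fixed; samples for different $i$ are independent; $H_i$ is tested using only the $F$ statistic of its sample. $n\ge1$ and $p\ge1$ are integers; $n$ is the difference between the sample size per null and the number of covariates. If $\boldsymbol\beta_i=0$ the $F$ statistic has the $F$ distribution with $(p,n)$ degrees of freedom, with density $f_{p,n}$; otherwise it has the noncentral $F$ distribution with $(p,n)$ degrees of freedom and noncentrality parameter $\Delta=\sigma_i^{-2}\sum_{k=1}^{n+p}(\boldsymbol\beta_i^T\boldsymbol X_k)^2$, with density $f_{p,n,\Delta}$ (the law of $(\chi^2_p(\Delta)/p)/(\chi^2_n/n)$ with independent noncentral and central chi-squares). Random effects model: each $H_i$ is independently false with probability $\pi$ and true with probability $1-\pi$; conditionally on this status the $F$ statistics are independent with density $p_1^{(n)}$ (false) or $p_0^{(n)}=f_{p,n}$ (true). With $R$ the number of rejected nulls and $V$ the number of rejected true nulls, $\mathrm{pFDR}=E[V/R\mid R>0]$; its minimum attainable value is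 $\frac{1-\pi}{1-\pi+\pi\rho}$ with $\rho=\sup_{x}p_1^{(n)}(x)/p_0^{(n)}(x)$. Under the constraint on the regression effects one has $\Delta\le(n+p)\delta^2$, and $n_*$ is attained when equality holds in the constraint for all the false nulls (so $\Delta=(n+p)\delta^2$). Thus $$n_*=\inf\Big\{n\ge1:\ \frac{1-\pi}{1-\pi+\pi K(p,n,\delta)}\le\alpha\Big\},\qquad K(p,n,\delta)=\sup_{x>0}\frac{f_{p,n,(n+p)\delta^2}(x)}{f_{p,n}(x)} .$$ $M_p^{-1}$ is the inverse of the strictly increasing function $M_p:[0,\infty)\to[1,\infty)$. $\lceil\cdot\rceil$ is the ceiling function. *)

theory Defs
  imports "HOL-Probability.Probability" "HOL-Library.Landau_Symbols"
begin

text \<open>The law of the sum of the squares of \<open>p\<close> independent normals with variance 1 depends on their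
  means only through the sum \<open>\<Delta>\<close> of the squared means; the mean vector \<open>(sqrt \<Delta>, 0, \<dots>, 0)\<close> is used.
  For \<open>\<Delta> = 0\<close> this is the central chi-square law.\<close>

definition noncentral_chi_square :: "nat \<Rightarrow> real \<Rightarrow> real measure" where
  "noncentral_chi_square p \<Delta> =
     distr (PiM {..<p} (\<lambda>_. density lborel std_normal_density)) borel
       (\<lambda>z. \<Sum>i<p. (z i + (if i = 0 then sqrt \<Delta> else 0))\<^sup>2)"

definition noncentral_F :: "nat \<Rightarrow> nat \<Rightarrow> real \<Rightarrow> real measure" where
  "noncentral_F p n \<Delta> =
     distr (noncentral_chi_square p \<Delta> \<Otimes>\<^sub>M noncentral_chi_square n 0) borel
       (\<lambda>(u, v). (u / real p) / (v / real n))"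

text \<open>Joint law of the status of one null (\<open>True\<close> means that the null hypothesis is false) and
  its test statistic, which has law \<open>P0\<close> under a true and \<open>P1\<close> under a false null.\<close>

definition status_stat_law :: "real \<Rightarrow> real measure \<Rightarrow> real measure \<Rightarrow> (bool \<times> real) measure" where
  "status_stat_law \<pi> P0 P1 =
     measure_pmf (bernoulli_pmf \<pi>) \<bind>
       (\<lambda>h. distr (if h then P1 else P0) (count_space UNIV \<Otimes>\<^sub>M borel) (Pair h))"

definition random_effects_model ::
    "nat \<Rightarrow> real \<Rightarrow> real measure \<Rightarrow> (nat \<Rightarrow> real measure) \<Rightarrow> (nat \<Rightarrow> bool \<times> real) measure" where
  "random_effects_model N \<pi> P0 P1 = PiM {..<N} (\<lambda>i. status_stat_law \<pi> P0 (P1 i))"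

text \<open>A multiple testing procedure \<open>d\<close> sees only the test statistics of the \<open>N\<close> nulls;
  \<open>d x i\<close> means that the \<open>i\<close>th null is rejected when these statistics are \<open>x\<close>.\<close>

definition testing_procedure :: "nat \<Rightarrow> ((nat \<Rightarrow> real) \<Rightarrow> nat \<Rightarrow> bool) \<Rightarrow> bool" where
  "testing_procedure N d \<longleftrightarrow>
     (\<forall>i<N. Measurable.pred (PiM {..<N} (\<lambda>_. borel)) (\<lambda>x. d x i))"

definition rejected ::
    "nat \<Rightarrow> ((nat \<Rightarrow> real) \<Rightarrow> nat \<Rightarrow> bool) \<Rightarrow> (nat \<Rightarrow> bool \<times> real) \<Rightarrow> nat set" where
  "rejected N d \<omega> = {i. i < N \<and> d (\<lambda>j\<in>{..<N}. snd (\<omega> j)) i}"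

definition num_rejected ::
    "nat \<Rightarrow> ((nat \<Rightarrow> real) \<Rightarrow> nat \<Rightarrow> bool) \<Rightarrow> (nat \<Rightarrow> bool \<times> real) \<Rightarrow> nat" where
  "num_rejected N d \<omega> = card (rejected N d \<omega>)"

definition num_false_rejected ::
    "nat \<Rightarrow> ((nat \<Rightarrow> real) \<Rightarrow> nat \<Rightarrow> bool) \<Rightarrow> (nat \<Rightarrow> bool \<times> real) \<Rightarrow> nat" where
  "num_false_rejected N d \<omega> = card {i \<in> rejected N d \<omega>. \<not> fst (\<omega> i)}"

definition some_rejection ::
    "nat \<Rightarrow> (nat \<Rightarrow> bool \<times> real) measure \<Rightarrow> ((nat \<Rightarrow> real) \<Rightarrow> nat \<Rightarrow> bool)
      \<Rightarrow> (nat \<Rightarrow> bool \<times> real) set" where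
  "some_rejection N M d = {\<omega> \<in> space M. num_rejected N d \<omega> > 0}"

text \<open>\<open>uniform_measure M A\<close> is \<open>M\<close> conditioned on the event \<open>A\<close>.\<close>

definition pFDR ::
    "nat \<Rightarrow> (nat \<Rightarrow> bool \<times> real) measure \<Rightarrow> ((nat \<Rightarrow> real) \<Rightarrow> nat \<Rightarrow> bool) \<Rightarrow> real" where
  "pFDR N M d =
     (\<integral>\<omega>. real (num_false_rejected N d \<omega>) / real (num_rejected N d \<omega>)
        \<partial>uniform_measure M (some_rejection N M d))"

text \<open>The likelihood ratio of the \<open>F\<close> laws does not attain its supremum, so the minimum
  attainable pFDR has to be read as an infimum.\<close>

definition min_pFDR :: "nat \<Rightarrow> (nat \<Rightarrow> bool \<times> real) measure \<Rightarrow> real" where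
  "min_pFDR N M =
     Inf {pFDR N M d | d. testing_procedure N d \<and> measure M (some_rejection N M d) > 0}"

text \<open>Vectors in \<open>p\<close>-dimensional space are functions on the indices \<open>0, \<dots>, p - 1\<close>, and the
  design points are \<open>X 1, X 2, \<dots>\<close>.\<close>

definition inner_upto :: "nat \<Rightarrow> (nat \<Rightarrow> real) \<Rightarrow> (nat \<Rightarrow> real) \<Rightarrow> real" where
  "inner_upto p u v = (\<Sum>j<p. u j * v j)"

definition full_rank_design :: "nat \<Rightarrow> nat \<Rightarrow> (nat \<Rightarrow> nat \<Rightarrow> real) \<Rightarrow> bool" where
  "full_rank_design p m X \<longleftrightarrow>
     (\<forall>v. (\<forall>k\<in>{1..m}. inner_upto p v (X k) = 0) \<longrightarrow> (\<forall>j<p. v j = 0))"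

definition noncentrality ::
    "nat \<Rightarrow> nat \<Rightarrow> (nat \<Rightarrow> nat \<Rightarrow> real) \<Rightarrow> (nat \<Rightarrow> real) \<Rightarrow> real \<Rightarrow> real" where
  "noncentrality p n X \<beta> \<sigma> = (\<Sum>k=1..n + p. (inner_upto p \<beta> (X k))\<^sup>2) / \<sigma>\<^sup>2"

definition effect_constraint ::
    "nat \<Rightarrow> real \<Rightarrow> (nat \<Rightarrow> nat \<Rightarrow> real) \<Rightarrow> (nat \<Rightarrow> real) \<Rightarrow> real \<Rightarrow> bool" where
  "effect_constraint p \<delta> X \<beta> \<sigma> \<longleftrightarrow>
     (\<forall>k\<ge>1. (\<Sum>l=1..k. (inner_upto p \<beta> (X l))\<^sup>2) / (real k * \<sigma>\<^sup>2) \<le> \<delta>\<^sup>2)"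

text \<open>\<open>\<beta> i\<close> is the coefficient vector of the \<open>i\<close>th regression in case the \<open>i\<close>th null is false.
  Full rank of the first \<open>n + p\<close> design points makes the \<open>F\<close> statistic with \<open>(p, n)\<close> degrees of
  freedom well defined.\<close>

definition admissible ::
    "nat \<Rightarrow> nat \<Rightarrow> nat \<Rightarrow> real \<Rightarrow> (nat \<Rightarrow> nat \<Rightarrow> real) \<Rightarrow> (nat \<Rightarrow> nat \<Rightarrow> real) \<Rightarrow> (nat \<Rightarrow> real) \<Rightarrow> bool"
  where
  "admissible N p n \<delta> X \<beta> \<sigma> \<longleftrightarrow>
     full_rank_design p (n + p) X \<and>
     (\<forall>i<N. \<sigma> i > 0 \<and> (\<exists>j<p. \<beta> i j \<noteq> 0) \<and> effect_constraint p \<delta> X (\<beta> i) (\<sigma> i))"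

definition F_test_model ::
    "nat \<Rightarrow> real \<Rightarrow> nat \<Rightarrow> nat \<Rightarrow> (nat \<Rightarrow> nat \<Rightarrow> real) \<Rightarrow> (nat \<Rightarrow> nat \<Rightarrow> real) \<Rightarrow> (nat \<Rightarrow> real)
      \<Rightarrow> (nat \<Rightarrow> bool \<times> real) measure" where
  "F_test_model N \<pi> p n X \<beta> \<sigma> =
     random_effects_model N \<pi> (noncentral_F p n 0)
       (\<lambda>i. noncentral_F p n (noncentrality p n X (\<beta> i) (\<sigma> i)))"

definition n_star :: "nat \<Rightarrow> real \<Rightarrow> real \<Rightarrow> nat \<Rightarrow> real \<Rightarrow> nat" where
  "n_star N \<alpha> \<pi> p \<delta> =
     Inf {n. n \<ge> 1 \<and> (\<exists>X \<beta> \<sigma>. admissible N p n \<delta> X \<beta> \<sigma> \<and>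
                              min_pFDR N (F_test_model N \<pi> p n X \<beta> \<sigma>) \<le> \<alpha>)}"

definition Q_ratio :: "real \<Rightarrow> real \<Rightarrow> real" where
  "Q_ratio \<alpha> \<pi> = (1 - \<alpha>) * (1 - \<pi>) / (\<alpha> * \<pi>)"

definition M_fun :: "nat \<Rightarrow> real \<Rightarrow> real" where
  "M_fun p t = (\<Sum>k. Gamma (real p / 2) * (t\<^sup>2 / 4) ^ k / (fact k * Gamma (real k + real p / 2)))"

definition M_inv :: "nat \<Rightarrow> real \<Rightarrow> real" where
  "M_inv p = the_inv_into {0..} (M_fun p)"

end

theory Submission
  imports Defs "HOL-Real_Asymp.Real_Asymp"
begin

text \<open>Put \<open>a = n / 2\<close>, \<open>b = p / 2\<close>, \<open>z = \<Delta> / 2\<close>. Since the noncentral chi-square law is a Poisson mixture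
  of central ones, the likelihood ratio of the \<open>F\<close> statistic \<open>x\<close> is
  \<open>exp (- z) * 1F1(a + b; b; z * y)\<close> with \<open>y = p x / (n + p x)\<close>. It increases to
  \<open>K = exp (- z) * 1F1(a + b; b; z)\<close> as \<open>x\<close> tends to infinity. No procedure has pFDR below
  \<open>(1 - \<pi>) / (1 - \<pi> + \<pi> K)\<close>, and rejecting a single null for large \<open>x\<close> comes arbitrarily close, so
  \<open>n_star\<close> is the least \<open>n\<close> with \<open>K \<ge> Q\<close>, where \<open>z = (n + p) \<delta>\<^sup>2 / 2\<close>. The asymptotics follow from
  explicit inequalities for \<open>K\<close>:
  \<open>exp (- z) * 0F1(; b; (a + b) z) \<le> K \<le> 0F1(; b; a z) \<le> exp (a z / b)\<close> (parts a and b),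
  \<open>K \<ge> exp l\<close> whenever \<open>l (b + z + l) \<le> a z\<close> (part b), and
  \<open>(1 + z / (a + b)) powr a \<le> K \<le> (1 + z / B) powr a\<close> with \<open>B = b - 1 / 2\<close> (part c).\<close>

subsection \<open>Bounds for the confluent hypergeometric function\<close>

text \<open>\<open>K\<close> has no convenient closed form, and its dependence on \<open>n\<close>
  is never studied. The \<open>n\<close> with \<open>K \<ge> Q\<close> form a nonempty set of
  naturals, so an upper bound for \<open>K\<close> at \<open>n_star\<close> itself bounds
  \<open>n_star\<close> from below, and a lower bound for \<open>K\<close> at one chosen
  \<open>n\<close> bounds it from above. The power bounds and the bound by \<open>exp l\<close> come
  from the logarithmic derivative of \<open>K\<close> in \<open>z\<close>, a ratio of two power
  series with nonnegative coefficients; the comparisons with 0F1 are made coefficient by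
  coefficient. Each regime makes one pair of bounds sharp. If \<open>p\<close> is fixed and
  \<open>n * \<delta>\<close> tends to \<open>t\<close>, then \<open>z\<close> tends to 0 and both
  0F1 arguments tend to t^2 / 4. If \<open>p\<close> tends to infinity and \<delta> to 0, both
  exponential bounds have nearly the exponent n (n + p) \<delta>^2 / (2 p); equating it with ln Q
  gives a quadratic equation in \<open>n\<close>, and the three cases of b are three regimes of its
  positive root. If \<delta> and \<open>n\<close> are fixed, both powers tend to (1 + \<delta>^2)^(n
  / 2).\<close>

text \<open>\<open>hyp11 a b z\<close> is \<open>1F1(a + b; b; z)\<close>, not \<open>1F1(a; b; z)\<close>, and \<open>hyp01 b x\<close> is \<open>0F1(; b; x)\<close>.\<close>

definition poch_ratio :: "real \<Rightarrow> real \<Rightarrow> nat \<Rightarrow> real" where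
  "poch_ratio a b k = pochhammer (a + b) k / pochhammer b k"

definition hyp11 :: "real \<Rightarrow> real \<Rightarrow> real \<Rightarrow> real" where
  "hyp11 a b z = (\<Sum>k. poch_ratio a b k / fact k * z ^ k)"

definition hyp01 :: "real \<Rightarrow> real \<Rightarrow> real" where
  "hyp01 b x = (\<Sum>k. 1 / (fact k * pochhammer b k) * x ^ k)"

definition max_lr :: "real \<Rightarrow> real \<Rightarrow> real \<Rightarrow> real" where
  "max_lr a b z = exp (- z) * hyp11 a b z"

lemma poch_ratio_Suc: "b > 0 \<Longrightarrow> poch_ratio a b (Suc k) = poch_ratio a b k * ((a + b + k) / (b + k))"
  by (simp add: poch_ratio_def pochhammer_Suc)

lemma poch_ratio_0 [simp]: "poch_ratio a b 0 = 1"
  by (simp add: poch_ratio_def)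

lemma poch_ratio_pos: "a \<ge> 0 \<Longrightarrow> b > 0 \<Longrightarrow> poch_ratio a b k > 0"
  by (simp add: poch_ratio_def pochhammer_pos)

lemma poch_ratio_le_power:
  assumes "a \<ge> 0" "b > 0"
  shows "poch_ratio a b k \<le> ((a + b) / b) ^ k"
proof (induction k)
  case (Suc k)
  have "(a + b + k) / (b + k) \<le> (a + b) / b"
    using assms by (simp add: divide_simps) (simp add: algebra_simps)
  moreover have "poch_ratio a b k \<ge> 0"
    using poch_ratio_pos[OF assms] less_imp_le by blast
  ultimately have "poch_ratio a b (Suc k) \<le> ((a + b) / b) ^ k * ((a + b) / b)"
    unfolding poch_ratio_Suc[OF assms(2)] using Suc assms by (intro mult_mono) auto
  then show ?case by (simp add: mult.commute)
qed simp

lemma summable_hyp: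
  fixes h :: "nat \<Rightarrow> real"
  assumes "\<And>k. \<bar>h k\<bar> \<le> C * B ^ k"
  shows "summable (\<lambda>k. h k / fact k * z ^ k)"
proof (rule summable_comparison_test')
  show "summable (\<lambda>k. C * (inverse (fact k) * (B * \<bar>z\<bar>) ^ k))"
    by (intro summable_mult summable_exp)
  show "norm (h k / fact k * z ^ k) \<le> C * (inverse (fact k) * (B * \<bar>z\<bar>) ^ k)" for k
  proof -
    have "\<bar>h k\<bar> * (\<bar>z\<bar> ^ k / fact k) \<le> (C * B ^ k) * (\<bar>z\<bar> ^ k / fact k)"
      using assms by (intro mult_right_mono) auto
    then show ?thesis by (simp add: abs_mult power_abs power_mult_distrib field_simps)
  qed
qed

lemma hyp11_sums:
  assumes "a \<ge> 0" "b > 0"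
  shows "(\<lambda>k. poch_ratio a b k / fact k * z ^ k) sums hyp11 a b z"
  unfolding hyp11_def
proof (intro summable_sums summable_hyp[where C=1 and B="(a + b) / b"])
  show "\<bar>poch_ratio a b k\<bar> \<le> 1 * ((a + b) / b) ^ k" for k
    using poch_ratio_le_power[OF assms, of k] poch_ratio_pos[OF assms, of k] by simp
qed

lemma hyp11_ge_1: "a \<ge> 0 \<Longrightarrow> b > 0 \<Longrightarrow> z \<ge> 0 \<Longrightarrow> hyp11 a b z \<ge> 1"
  using sum_le_suminf[of "\<lambda>k. poch_ratio a b k / fact k * z ^ k" "{0}"] hyp11_sums[of a b z]
    poch_ratio_pos[of a b] by (auto simp: hyp11_def sums_iff less_imp_le)

lemma max_lr_pos: "a \<ge> 0 \<Longrightarrow> b > 0 \<Longrightarrow> z \<ge> 0 \<Longrightarrow> max_lr a b z > 0"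
  using hyp11_ge_1[of a b z] by (simp add: max_lr_def)

text \<open>The derivative of \<open>hyp11 a b\<close> minus \<open>hyp11 a b\<close> itself.\<close>

definition hyp11_slope :: "real \<Rightarrow> real \<Rightarrow> real \<Rightarrow> real" where
  "hyp11_slope a b z = (\<Sum>k. a * poch_ratio a b k / (b + k) / fact k * z ^ k)"

lemma hyp11_slope_sums:
  assumes "a \<ge> 0" "b > 0"
  shows "(\<lambda>k. a * poch_ratio a b k / (b + k) / fact k * z ^ k) sums hyp11_slope a b z"
  unfolding hyp11_slope_def
proof (intro summable_sums summable_hyp[where C="a / b" and B="(a + b) / b"])
  fix k
  have "(a * poch_ratio a b k) / (b + k) \<le> (a * ((a + b) / b) ^ k) / b"
    using assms poch_ratio_le_power[OF assms, of k] poch_ratio_pos[OF assms, of k]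
    by (intro frac_le mult_left_mono) auto
  then show "\<bar>a * poch_ratio a b k / (b + k)\<bar> \<le> a / b * ((a + b) / b) ^ k"
    using assms poch_ratio_pos[OF assms, of k] by simp
qed

text \<open>Differentiation shifts the coefficients by one index, which multiplies them by
  \<open>(a + b + k) / (b + k) = 1 + a / (b + k)\<close>. The summand 1 reproduces
  \<open>hyp11\<close> and is what \<open>exp (- z)\<close> cancels in \<open>max_lr\<close>; a
  series with nonnegative coefficients remains.\<close>

lemma hyp11_deriv:
  assumes "a \<ge> 0" "b > 0"
  shows "(hyp11 a b has_real_derivative hyp11 a b z + hyp11_slope a b z) (at z)"
proof -
  define c where "c k = poch_ratio a b k / fact k" for k
  have "hyp11 a b = (\<lambda>z. \<Sum>k. c k * z ^ k)"
    by (simp add: hyp11_def c_def fun_eq_iff)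
  moreover have "((\<lambda>z. \<Sum>k. c k * z ^ k) has_real_derivative (\<Sum>k. diffs c k * z ^ k)) (at z)"
    using hyp11_sums[OF assms] by (intro termdiffs_strong_converges_everywhere) (auto simp: c_def sums_iff)
  moreover have "(\<lambda>k. diffs c k * z ^ k) sums (hyp11 a b z + hyp11_slope a b z)"
  proof (rule sums_cong[THEN iffD1, OF _ sums_add[OF hyp11_sums[OF assms] hyp11_slope_sums[OF assms]]])
    fix k
    have "diffs c k = poch_ratio a b (Suc k) / fact k"
      by (simp add: diffs_def c_def divide_simps)
    also have "\<dots> = poch_ratio a b k / fact k + a * poch_ratio a b k / (b + k) / fact k"
    proof -
      have "(a + b + k) / (b + k) = 1 + a / (b + k)"
        using assms by (simp add: field_simps)
      then show ?thesis using assms by (simp add: poch_ratio_Suc algebra_simps add_divide_distrib)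
    qed
    finally show "poch_ratio a b k / fact k * z ^ k + a * poch_ratio a b k / (b + k) / fact k * z ^ k
        = diffs c k * z ^ k"
      by (simp add: algebra_simps)
  qed
  ultimately show ?thesis by (simp add: sums_iff)
qed

lemma max_lr_deriv:
  assumes "a \<ge> 0" "b > 0"
  shows "(max_lr a b has_real_derivative exp (- z) * hyp11_slope a b z) (at z)"
  unfolding max_lr_def
  by (rule derivative_eq_intros hyp11_deriv[OF assms] refl)+ (simp add: algebra_simps)

lemma hyp11_slope_nonneg:
  assumes "a \<ge> 0" "b > 0" "z \<ge> 0"
  shows "hyp11_slope a b z \<ge> 0"
  unfolding hyp11_slope_def using assms hyp11_slope_sums[OF assms(1,2), of z]
    poch_ratio_pos[OF assms(1,2)]
  by (intro suminf_nonneg) (auto simp: sums_iff less_imp_le)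

lemma max_lr_mono:
  assumes "a \<ge> 0" "b > 0" "0 \<le> x" "x \<le> y"
  shows "max_lr a b x \<le> max_lr a b y"
  by (rule DERIV_nonneg_imp_nondecreasing[OF assms(4)])
     (use assms max_lr_deriv hyp11_slope_nonneg in \<open>force intro!: exI mult_nonneg_nonneg\<close>)

lemma hyp11_mono:
  assumes "a \<ge> 0" "b > 0" "0 \<le> x" "x \<le> y"
  shows "hyp11 a b x \<le> hyp11 a b y"
  unfolding hyp11_def using assms hyp11_sums[OF assms(1,2)] poch_ratio_pos[OF assms(1,2)]
  by (intro suminf_le mult_left_mono power_mono) (auto simp: sums_iff less_imp_le)

lemma max_lr_0 [simp]: "max_lr a b 0 = 1"
  using powser_zero[of "\<lambda>k. poch_ratio a b k / fact k"] by (simp add: max_lr_def hyp11_def)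

section \<open>Bounds by integrating the logarithmic derivative\<close>

lemma ln_max_lr_deriv:
  assumes "a \<ge> 0" "b > 0" "z \<ge> 0"
  shows "((\<lambda>z. ln (max_lr a b z)) has_real_derivative hyp11_slope a b z / hyp11 a b z) (at z)"
  by (rule derivative_eq_intros max_lr_deriv refl assms max_lr_pos)+
     (simp add: max_lr_def)

text \<open>A Gronwall-type comparison: a lower bound \<open>r\<close> for the logarithmic
  derivative \<open>hyp11_slope / hyp11\<close> is integrated from 0, where \<open>max_lr\<close> is
  1. Clearing the denominator in \<open>le\<close> makes it an inequality between power
  series.\<close>

lemma max_lr_lower:
  assumes "a \<ge> 0" "b > 0" "z \<ge> 0"
    and R: "\<And>x. 0 \<le> x \<Longrightarrow> x \<le> z \<Longrightarrow> (R has_real_derivative r x) (at x)"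
    and le: "\<And>x. 0 \<le> x \<Longrightarrow> x \<le> z \<Longrightarrow> r x * hyp11 a b x \<le> hyp11_slope a b x"
  shows "max_lr a b z \<ge> exp (R z - R 0)"
proof -
  have "ln (max_lr a b 0) - R 0 \<le> ln (max_lr a b z) - R z"
  proof (rule DERIV_nonneg_imp_nondecreasing[OF assms(3)])
    fix x assume x: "0 \<le> x" "x \<le> z"
    have "((\<lambda>x. ln (max_lr a b x) - R x) has_real_derivative
        hyp11_slope a b x / hyp11 a b x - r x) (at x)"
      using x by (intro DERIV_diff ln_max_lr_deriv R assms)
    moreover have "hyp11_slope a b x / hyp11 a b x - r x \<ge> 0"
      using le[OF x] hyp11_ge_1[OF assms(1,2) x(1)] by (simp add: field_simps)
    ultimately show "\<exists>y. ((\<lambda>x. ln (max_lr a b x) - R x) has_real_derivative y) (at x) \<and> 0 \<le> y"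
      by blast
  qed
  then have "R z - R 0 \<le> ln (max_lr a b z)" by simp
  then show ?thesis
    using max_lr_pos[OF assms(1-3)] by (metis exp_le_cancel_iff exp_ln)
qed

lemma max_lr_upper:
  assumes "a \<ge> 0" "b > 0" "z \<ge> 0"
    and R: "\<And>x. 0 \<le> x \<Longrightarrow> x \<le> z \<Longrightarrow> (R has_real_derivative r x) (at x)"
    and le: "\<And>x. 0 \<le> x \<Longrightarrow> x \<le> z \<Longrightarrow> hyp11_slope a b x \<le> r x * hyp11 a b x"
  shows "max_lr a b z \<le> exp (R z - R 0)"
proof -
  have "R 0 - ln (max_lr a b 0) \<le> R z - ln (max_lr a b z)"
  proof (rule DERIV_nonneg_imp_nondecreasing[OF assms(3)])
    fix x assume x: "0 \<le> x" "x \<le> z"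
    have "((\<lambda>x. R x - ln (max_lr a b x)) has_real_derivative
        r x - hyp11_slope a b x / hyp11 a b x) (at x)"
      using x by (intro DERIV_diff ln_max_lr_deriv R assms)
    moreover have "r x - hyp11_slope a b x / hyp11 a b x \<ge> 0"
      using le[OF x] hyp11_ge_1[OF assms(1,2) x(1)] by (simp add: field_simps)
    ultimately show "\<exists>y. ((\<lambda>x. R x - ln (max_lr a b x)) has_real_derivative y) (at x) \<and> 0 \<le> y"
      by blast
  qed
  then have "ln (max_lr a b z) \<le> R z - R 0" by simp
  then show ?thesis
    using max_lr_pos[OF assms(1-3)] by (metis exp_le_cancel_iff exp_ln)
qed

text \<open>Whether \<open>a / (C + z)\<close> bounds the logarithmic derivative from below or above
  is the sign of \<open>(C + z) * hyp11_slope - a * hyp11\<close>. Absorbing the factor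
  \<open>z\<close> by an index shift expresses this difference in the terms of \<open>hyp11\<close>,
  so its sign can be read off term by term.\<close>

lemma slope_shift_sums:
  fixes a b C z :: real
  assumes "a \<ge> 0" "b > 0" "a + b \<ge> 1"
  shows "(\<lambda>k. (C * a / (b + k) + a * k / (a + b + k - 1) - a) * (poch_ratio a b k / fact k * z ^ k)) sums
    ((C + z) * hyp11_slope a b z - a * hyp11 a b z)"
proof -
  have 1: "(\<lambda>k. a * k / (a + b + k - 1) * (poch_ratio a b k / fact k * z ^ k)) sums (z * hyp11_slope a b z)"
  proof -
    have "(\<lambda>k. a * Suc k / (a + b + Suc k - 1) * (poch_ratio a b (Suc k) / fact (Suc k) * z ^ Suc k)) sums
        (z * hyp11_slope a b z)"
    proof (rule sums_cong[THEN iffD1, OF _ sums_mult[OF hyp11_slope_sums[OF assms(1,2)], of z]])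
      fix k :: nat
      have *: "poch_ratio a b (Suc k) / (a + b + Suc k - 1) = poch_ratio a b k / (b + k)"
      proof -
        have "a + b + k > 0" "b + k > 0" using assms by auto
        then show ?thesis using assms
          by (simp add: poch_ratio_Suc add.assoc nonzero_divide_eq_eq)
      qed
      have "a * Suc k / (a + b + Suc k - 1) * (poch_ratio a b (Suc k) / fact (Suc k) * z ^ Suc k)
          = a * (Suc k / fact (Suc k)) * z ^ Suc k * (poch_ratio a b (Suc k) / (a + b + Suc k - 1))"
        by (simp add: divide_inverse)
      also have "\<dots> = z * (a * poch_ratio a b k / (b + k) / fact k * z ^ k)"
        unfolding * by (simp add: divide_simps del: of_nat_Suc)
      finally show "z * (a * poch_ratio a b k / (b + k) / fact k * z ^ k) =
          a * Suc k / (a + b + Suc k - 1) * (poch_ratio a b (Suc k) / fact (Suc k) * z ^ Suc k)" ..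
    qed
    \<comment> \<open>The term for index 0 added here contains the factor \<open>k = 0\<close> and
      vanishes, also when its denominator \<open>a + b - 1\<close> is 0.\<close>
    from sums_Suc[OF this] show ?thesis by simp
  qed
  have 2: "(\<lambda>k. C * a / (b + k) * (poch_ratio a b k / fact k * z ^ k)) sums (C * hyp11_slope a b z)"
    using sums_mult[OF hyp11_slope_sums[OF assms(1,2), of z], of C] by (simp add: mult.assoc)
  have 3: "(\<lambda>k. a * (poch_ratio a b k / fact k * z ^ k)) sums (a * hyp11 a b z)"
    by (intro sums_mult hyp11_sums assms)
  show ?thesis
    using sums_diff[OF sums_add[OF 2 1] 3] by (simp add: algebra_simps)
qed

text \<open>The choice \<open>C = a + b\<close> makes every coefficient of the shifted series
  nonnegative, and integrating \<open>a / (a + b + x)\<close> gives the power.\<close>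

lemma max_lr_ge_powr:
  assumes "a \<ge> 0" "b > 0" "a + b \<ge> 1" "z \<ge> 0"
  shows "max_lr a b z \<ge> (1 + z / (a + b)) powr a"
proof -
  have "exp ((a * ln (a + b + z)) - a * ln (a + b + 0)) \<le> max_lr a b z"
  proof (rule max_lr_lower[where R="\<lambda>x. a * ln (a + b + x)" and r="\<lambda>x. a / (a + b + x)"])
    fix x assume x: "0 \<le> x" "x \<le> z"
    show "((\<lambda>x. a * ln (a + b + x)) has_real_derivative a / (a + b + x)) (at x)"
      by (auto intro!: derivative_eq_intros simp: x) (use x assms in auto)
    have "0 \<le> (a + b + x) * hyp11_slope a b x - a * hyp11 a b x"
    proof (rule sums_le[OF _ sums_zero slope_shift_sums])
      fix k :: nat
      show "0 \<le> ((a + b) * a / (b + k) + a * k / (a + b + k - 1) - a) * (poch_ratio a b k / fact k * x ^ k)"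
      proof (cases "k = 0")
        \<comment> \<open>Treated separately because \<open>a + b + k - 1\<close> may be 0 here; the
          coefficient is then \<open>(a + b) * a / b - a\<close>.\<close>
        case True
        then show ?thesis using assms by (simp add: field_simps)
      next
        case False
        have pos: "b + k > 0" "a + b + k - 1 > 0" using False assms by auto
        have "(a + b) * a / (b + k) + a * k / (a + b + k - 1) - a
            = a * ((a + b - 1) * a + k) / ((b + k) * (a + b + k - 1))"
          using pos by (simp add: divide_simps) (simp add: algebra_simps)
        also have "\<dots> \<ge> 0" using pos assms by auto
        finally show ?thesis
          using x poch_ratio_pos[OF assms(1,2), of k] by (intro mult_nonneg_nonneg) auto
      qed
    qed (use assms in auto)
    then show "a / (a + b + x) * hyp11 a b x \<le> hyp11_slope a b x"
      using x assms by (simp add: field_simps)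
  qed (use assms in auto)
  also have "exp ((a * ln (a + b + z)) - a * ln (a + b + 0)) = (1 + z / (a + b)) powr a"
  proof -
    have "1 + z / (a + b) = (a + b + z) / (a + b)" using assms by (simp add: field_simps)
    then show ?thesis using assms by (simp add: powr_def ln_div right_diff_distrib)
  qed
  finally show ?thesis .
qed

text \<open>The numerator of the coefficient for \<open>C = B\<close> is affine in \<open>k\<close>:
  \<open>B \<le> b\<close> makes its constant part nonpositive, and \<open>B \<le> a + b - 1\<close>
  makes its slope nonpositive.\<close>

lemma max_lr_le_powr:
  fixes a b z B :: real
  assumes "a \<ge> 0" "b > 0" "a + b > 1" "z \<ge> 0" "0 < B" "B \<le> b" "B \<le> a + b - 1"
  shows "max_lr a b z \<le> (1 + z / B) powr a"
proof -
  have "max_lr a b z \<le> exp ((a * ln (B + z)) - a * ln (B + 0))"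
  proof (rule max_lr_upper[where R="\<lambda>x. a * ln (B + x)" and r="\<lambda>x. a / (B + x)"])
    fix x assume x: "0 \<le> x" "x \<le> z"
    show "((\<lambda>x. a * ln (B + x)) has_real_derivative a / (B + x)) (at x)"
      by (auto intro!: derivative_eq_intros simp: x) (use x assms in auto)
    have "(B + x) * hyp11_slope a b x - a * hyp11 a b x \<le> 0"
    proof (rule sums_le[OF _ slope_shift_sums sums_zero])
      fix k :: nat
      have pos: "b + k > 0" "a + b + k - 1 > 0" using assms by auto
      have "B * a / (b + k) + a * k / (a + b + k - 1) - a
          = a * (B * (a + b - 1) - (a + b - 1) * b - (a + b - 1 - B) * k) / ((b + k) * (a + b + k - 1))"
        using pos by (simp add: divide_simps) (simp add: algebra_simps)
      also have "\<dots> \<le> 0"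
      proof -
        have "B * (a + b - 1) \<le> b * (a + b - 1)" using assms by (intro mult_right_mono) auto
        moreover have "(a + b - 1 - B) * k \<ge> 0" using assms by auto
        ultimately have "B * (a + b - 1) - (a + b - 1) * b - (a + b - 1 - B) * k \<le> 0"
          by (simp add: algebra_simps)
        then show ?thesis using pos assms
          by (intro divide_nonpos_pos mult_nonneg_nonpos) auto
      qed
      finally show "(B * a / (b + k) + a * k / (a + b + k - 1) - a) * (poch_ratio a b k / fact k * x ^ k) \<le> 0"
        using x poch_ratio_pos[OF assms(1,2), of k] by (intro mult_nonpos_nonneg) auto
    qed (use assms in auto)
    then show "hyp11_slope a b x \<le> a / (B + x) * hyp11 a b x"
      using x assms by (simp add: field_simps)
  qed (use assms in auto)
  also have "exp ((a * ln (B + z)) - a * ln (B + 0)) = (1 + z / B) powr a"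
  proof -
    have "1 + z / B = (B + z) / B" using assms by (simp add: field_simps)
    then show ?thesis using assms by (simp add: powr_def ln_div right_diff_distrib)
  qed
  finally show ?thesis .
qed

text \<open>With weights proportional to \<open>poch_ratio a b k * x ^ k / fact k\<close>, the logarithmic derivative
  of \<open>max_lr a b\<close> is the mean of \<open>a / (b + k)\<close>. It is bounded from below by the tangent of \<open>1 / (b + k)\<close>
  at \<open>b + k = m\<close>.\<close>

lemma max_lr_ge_exp:
  assumes "a \<ge> 0" "b > 0" "z > 0" "l > 0" and l: "l * (b + z + l) \<le> a * z"
  shows "max_lr a b z \<ge> exp l"
proof -
  \<comment> \<open>The aim is a logarithmic derivative of at least \<open>c\<close> on the whole
    interval, which integrates to \<open>c * z = l\<close>. The tangent point \<open>m\<close> is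
    the value that the mean of \<open>b + k\<close> would have at \<open>z\<close> if the
    logarithmic derivative there were exactly \<open>c\<close>. The hypothesis \<open>l\<close> then
    reads \<open>c * m \<le> a\<close>.\<close>
  define c m where "c = l / z" and "m = b + z + l"
  have cm: "c > 0" "m > 0" "c * z = l" using assms by (auto simp: c_def m_def)
  have am: "c * m \<le> a" using l assms by (simp add: c_def m_def field_simps)
  have "exp (c * z - c * 0) \<le> max_lr a b z"
  proof (rule max_lr_lower[where R="\<lambda>x. c * x" and r="\<lambda>x. c"])
    fix x assume x: "0 \<le> x" "x \<le> z"
    show "((\<lambda>x. c * x) has_real_derivative c) (at x)"
      by (rule derivative_eq_intros refl)+ auto
    \<comment> \<open>The unnormalized first moment of \<open>k\<close>. It involves
      \<open>hyp11_slope\<close> again, so the tangent bound becomes a linear inequality with the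
      slope on both sides.\<close>
    have 1: "(\<lambda>k. k * (poch_ratio a b k / fact k * x ^ k)) sums (x * (hyp11 a b x + hyp11_slope a b x))"
    proof -
      have "(\<lambda>k. Suc k * (poch_ratio a b (Suc k) / fact (Suc k) * x ^ Suc k)) sums
          (x * (hyp11 a b x + hyp11_slope a b x))"
      proof (rule sums_cong[THEN iffD1, OF _ sums_mult[OF sums_add[OF hyp11_sums[OF assms(1,2)] hyp11_slope_sums[OF assms(1,2)]]]])
        fix k
        have "Suc k * (poch_ratio a b (Suc k) / fact (Suc k) * x ^ Suc k)
            = x * (poch_ratio a b (Suc k) / fact k * x ^ k)"
          by (simp add: divide_simps del: of_nat_Suc)
        moreover have "poch_ratio a b (Suc k) = poch_ratio a b k + a * poch_ratio a b k / (b + k)"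
          using assms by (simp add: poch_ratio_Suc field_simps)
        ultimately show "x * (poch_ratio a b k / fact k * x ^ k + a * poch_ratio a b k / (b + k) / fact k * x ^ k)
            = Suc k * (poch_ratio a b (Suc k) / fact (Suc k) * x ^ Suc k)"
          by (simp only: distrib_left distrib_right add_divide_distrib)
      qed
      from sums_Suc[OF this] show ?thesis by simp
    qed
    have "a * ((2 / m - b / m\<^sup>2) * hyp11 a b x - 1 / m\<^sup>2 * (x * (hyp11 a b x + hyp11_slope a b x)))
        \<le> hyp11_slope a b x"
    proof (rule sums_le[OF _ sums_mult[OF sums_diff[OF sums_mult[OF hyp11_sums[OF assms(1,2)]] sums_mult[OF 1]]]
          hyp11_slope_sums[OF assms(1,2)]])
      fix k :: nat
      \<comment> \<open>The gap between \<open>1 / (b + k)\<close> and its tangent at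
        \<open>m\<close> is this square.\<close>
      have "0 \<le> (b + k - m)\<^sup>2 / (m\<^sup>2 * (b + k))" using assms by auto
      also have "\<dots> = 1 / (b + k) - (2 / m - b / m\<^sup>2 - 1 / m\<^sup>2 * k)"
        using assms cm by (simp add: divide_simps) (simp add: algebra_simps power2_eq_square)
      finally have "2 / m - b / m\<^sup>2 - 1 / m\<^sup>2 * k \<le> 1 / (b + k)" by simp
      then have "(2 / m - b / m\<^sup>2 - 1 / m\<^sup>2 * k) * (a * (poch_ratio a b k / fact k * x ^ k))
          \<le> 1 / (b + k) * (a * (poch_ratio a b k / fact k * x ^ k))"
        using assms x poch_ratio_pos[OF assms(1,2), of k] by (intro mult_right_mono) auto
      then show "a * ((2 / m - b / m\<^sup>2) * (poch_ratio a b k / fact k * x ^ k)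
            - 1 / m\<^sup>2 * (k * (poch_ratio a b k / fact k * x ^ k)))
          \<le> a * poch_ratio a b k / (b + k) / fact k * x ^ k"
        by (simp add: algebra_simps)
    qed
    then have "m\<^sup>2 * (a * ((2 / m - b / m\<^sup>2) * hyp11 a b x - 1 / m\<^sup>2 * (x * (hyp11 a b x + hyp11_slope a b x))))
        \<le> m\<^sup>2 * hyp11_slope a b x"
      by (intro mult_left_mono) auto
    also have "m\<^sup>2 * (a * ((2 / m - b / m\<^sup>2) * hyp11 a b x - 1 / m\<^sup>2 * (x * (hyp11 a b x + hyp11_slope a b x))))
        = a * ((2 * m - b - x) * hyp11 a b x - x * hyp11_slope a b x)"
    proof -
      have "m\<^sup>2 * (2 / m - b / m\<^sup>2) = 2 * m - b"
        using cm(2) by (simp add: right_diff_distrib power2_eq_square)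
      moreover have "m\<^sup>2 * (1 / m\<^sup>2) = 1" using cm(2) by simp
      moreover have "m\<^sup>2 * (a * (P * u - Q * v)) = a * ((m\<^sup>2 * P) * u - (m\<^sup>2 * Q) * v)" for P Q u v
        by (simp add: algebra_simps)
      ultimately have E: "m\<^sup>2 * (a * ((2 / m - b / m\<^sup>2) * u - 1 / m\<^sup>2 * v)) = a * ((2 * m - b) * u - 1 * v)" for u v
        by metis
      show ?thesis unfolding E by (simp add: algebra_simps)
    qed
    finally have "a * ((2 * m - b - x) * hyp11 a b x - x * hyp11_slope a b x) \<le> m\<^sup>2 * hyp11_slope a b x" .
    \<comment> \<open>Both occurrences of the slope are collected on the right; it remains to see
      that the resulting quotient is at least \<open>c\<close>.\<close>
    then have "a * (2 * m - b - x) * hyp11 a b x \<le> (m\<^sup>2 + a * x) * hyp11_slope a b x"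
      by (simp add: algebra_simps)
    \<comment> \<open>Three estimates are added: \<open>m * (c * m) \<le> m * a\<close>,
      \<open>c * x \<le> l\<close>, and \<open>m + l \<le> 2 * m - b - x\<close>, the last because
      \<open>m - b - x = l + (z - x)\<close>.\<close>
    moreover have "(m\<^sup>2 + a * x) * c \<le> a * (2 * m - b - x)"
    proof -
      have "c * x \<le> c * z" using x cm(1) by (intro mult_left_mono) auto
      then have "a * (c * x) \<le> a * l" unfolding cm(3) by (intro mult_left_mono assms)
      moreover have "m * (c * m) \<le> m * a" using am cm by (intro mult_left_mono) auto
      moreover have "a * (m + l) \<le> a * (2 * m - b - x)"
        using x assms by (intro mult_left_mono) (auto simp: m_def)
      ultimately show ?thesis by (simp add: algebra_simps power2_eq_square)
    qed
    then have "((m\<^sup>2 + a * x) * c) * hyp11 a b x \<le> (a * (2 * m - b - x)) * hyp11 a b x"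
      using hyp11_ge_1[OF assms(1,2) x(1)] by (intro mult_right_mono) auto
    ultimately have "(m\<^sup>2 + a * x) * (c * hyp11 a b x) \<le> (m\<^sup>2 + a * x) * hyp11_slope a b x"
      by (simp add: mult.assoc)
    moreover have "m\<^sup>2 + a * x > 0" using cm x assms by (intro add_pos_nonneg) auto
    ultimately show "c * hyp11 a b x \<le> hyp11_slope a b x"
      using mult_le_cancel_left_pos by blast
  qed (use assms in auto)
  then show ?thesis using cm by simp
qed

section \<open>Comparison with the series 0F1\<close>

lemma power_le_pochhammer:
  fixes b :: real assumes "b > 0" shows "b ^ k \<le> pochhammer b k"
proof (induction k)
  case (Suc k)
  have "b ^ k * b \<le> pochhammer b k * (b + k)"
    using assms Suc by (intro mult_mono) (auto simp: pochhammer_nonneg)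
  then show ?case by (simp add: pochhammer_Suc mult.commute)
qed simp

lemma hyp01_sums:
  assumes "b > 0"
  shows "(\<lambda>k. 1 / (fact k * pochhammer b k) * x ^ k) sums hyp01 b x"
proof -
  have "summable (\<lambda>k. (1 / pochhammer b k) / fact k * x ^ k)"
  proof (rule summable_hyp[where C=1 and B="1 / b"])
    show "\<bar>1 / pochhammer b k\<bar> \<le> 1 * (1 / b) ^ k" for k
      using power_le_pochhammer[OF assms, of k] assms pochhammer_pos[OF assms, of k]
      by (simp add: power_one_over frac_le)
  qed
  then show ?thesis by (simp add: hyp01_def summable_sums divide_simps mult.commute)
qed

lemma hyp01_le_exp:
  assumes "b > 0" "x \<ge> 0"
  shows "hyp01 b x \<le> exp (x / b)"
proof (rule sums_le[OF _ hyp01_sums[OF assms(1)] exp_converges])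
  fix k
  have "1 / (fact k * pochhammer b k) \<le> (1 / (fact k * b ^ k))"
    using power_le_pochhammer[OF assms(1), of k] assms by (intro frac_le) auto
  then have "1 / (fact k * pochhammer b k) * x ^ k \<le> (1 / (fact k * b ^ k)) * x ^ k"
    using assms by (intro mult_right_mono) auto
  then show "1 / (fact k * pochhammer b k) * x ^ k \<le> (x / b) ^ k /\<^sub>R fact k"
    by (simp add: power_divide field_simps)
qed

text \<open>Up to the factor \<open>k!\<close>, the right side is the coefficient of z^k, for
  \<open>a\<close> and \<open>b\<close> fixed, in the Cauchy product of
  \<open>hyp01 b (a * z)\<close> and \<open>exp z\<close>. In the induction the new factor is
  \<open>1 + a / (b + k)\<close>; for \<open>j \<le> k\<close> the summand
  \<open>a / (b + k)\<close> is at most \<open>a / (b + j)\<close>, which raises the index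
  \<open>j\<close> by one, and Pascal's rule collects the two sums.\<close>

lemma poch_ratio_le_binomial_sum:
  assumes "a \<ge> 0" "b > 0"
  shows "poch_ratio a b k \<le> (\<Sum>j\<le>k. (k choose j) * (a ^ j / pochhammer b j))"
proof (induction k)
  case (Suc k)
  define u where "u j = a ^ j / pochhammer b j" for j
  have u: "u j \<ge> 0" for j using assms by (simp add: u_def pochhammer_nonneg)
  have split: "(\<Sum>j\<le>Suc k. (Suc k choose j) * u j) =
      (\<Sum>j\<le>k. (k choose j) * u j) + (\<Sum>j\<le>k. (k choose j) * u (Suc j))"
  proof -
    have "(\<Sum>j\<le>Suc k. (Suc k choose j) * u j) = u 0 + (\<Sum>j\<le>k. (Suc k choose Suc j) * u (Suc j))"
      by (subst sum.atMost_Suc_shift) simp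
    also have "\<dots> = (u 0 + (\<Sum>j\<le>k. (k choose Suc j) * u (Suc j))) + (\<Sum>j\<le>k. (k choose j) * u (Suc j))"
      by (simp add: algebra_simps sum.distrib)
    also have "u 0 + (\<Sum>j\<le>k. (k choose Suc j) * u (Suc j)) = (\<Sum>j\<le>Suc k. (k choose j) * u j)"
      by (subst sum.atMost_Suc_shift) simp
    finally show ?thesis by simp
  qed
  have "poch_ratio a b (Suc k) = poch_ratio a b k * (1 + a / (b + k))"
    using assms by (simp add: poch_ratio_Suc field_simps)
  also have "\<dots> \<le> (\<Sum>j\<le>k. (k choose j) * u j) * (1 + a / (b + k))"
    using assms Suc by (intro mult_right_mono) (auto simp: u_def)
  also have "\<dots> = (\<Sum>j\<le>k. (k choose j) * u j) + (\<Sum>j\<le>k. (k choose j) * u j * (a / (b + k)))"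
    by (simp only: distrib_left sum_distrib_right mult_1_right)
  also have "\<dots> \<le> (\<Sum>j\<le>k. (k choose j) * u j) + (\<Sum>j\<le>k. (k choose j) * u (Suc j))"
  proof (intro add_left_mono sum_mono)
    fix j assume j: "j \<in> {..k}"
    have "u (Suc j) = u j * (a / (b + j))" by (simp add: u_def pochhammer_Suc)
    also have "\<dots> \<ge> u j * (a / (b + k))"
      using j assms u by (intro mult_left_mono frac_le) auto
    finally show "(k choose j) * u j * (a / (b + k)) \<le> (k choose j) * u (Suc j)"
      unfolding mult.assoc by (rule mult_left_mono) simp
  qed
  finally show ?case using split by (simp add: u_def)
qed simp

lemma max_lr_le_hyp01:
  assumes "a \<ge> 0" "b > 0" "z \<ge> 0"
  shows "max_lr a b z \<le> hyp01 b (a * z)"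
proof -
  define f where "f k = 1 / (fact k * pochhammer b k) * (a * z) ^ k" for k
  define e where "e k = z ^ k /\<^sub>R fact k" for k
  have f: "f sums hyp01 b (a * z)" unfolding f_def by (rule hyp01_sums[OF assms(2)])
  have e: "e sums exp z" unfolding e_def by (rule exp_converges)
  have fn: "f k \<ge> 0" and en: "e k \<ge> 0" for k
    using assms by (auto simp: f_def e_def pochhammer_nonneg)
  have "(\<lambda>k. \<Sum>i\<le>k. f i * e (k - i)) sums ((\<Sum>k. f k) * (\<Sum>k. e k))"
    using f e fn en by (intro Cauchy_product_sums) (auto simp: sums_iff)
  then have prod: "(\<lambda>k. \<Sum>i\<le>k. f i * e (k - i)) sums (hyp01 b (a * z) * exp z)"
    using f e by (simp add: sums_iff)
  have "hyp11 a b z \<le> hyp01 b (a * z) * exp z"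
  proof (rule sums_le[OF _ hyp11_sums[OF assms(1,2)] prod])
    fix k
    have "poch_ratio a b k / fact k * z ^ k
        \<le> (\<Sum>j\<le>k. (k choose j) * (a ^ j / pochhammer b j)) / fact k * z ^ k"
      using assms poch_ratio_le_binomial_sum[OF assms(1,2), of k]
      by (intro mult_right_mono divide_right_mono) auto
    also have "\<dots> = (\<Sum>i\<le>k. f i * e (k - i))"
      unfolding sum_divide_distrib sum_distrib_right
    proof (rule sum.cong[OF refl])
      fix j assume j: "j \<in> {..k}"
      have "z ^ k = z ^ j * z ^ (k - j)" using j by (simp flip: power_add)
      then show "(k choose j) * (a ^ j / pochhammer b j) / fact k * z ^ k = f j * e (k - j)"
        using j by (simp add: f_def e_def binomial_fact field_simps power_mult_distrib)
    qed
    finally show "poch_ratio a b k / fact k * z ^ k \<le> (\<Sum>i\<le>k. f i * e (k - i))" .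
  qed
  then have "exp (-z) * hyp11 a b z \<le> exp (-z) * (hyp01 b (a * z) * exp z)"
    by (intro mult_left_mono) auto
  then show ?thesis by (simp add: max_lr_def exp_minus field_simps)
qed

text \<open>Replacing the rising factorial of \<open>a + b\<close> by a power turns 1F1 into 0F1
  termwise. The factor \<open>exp (- z)\<close> is kept; it is harmless in the regime where
  \<open>z\<close> tends to 0.\<close>

lemma max_lr_ge_hyp01:
  assumes "a \<ge> 0" "b > 0" "z \<ge> 0"
  shows "max_lr a b z \<ge> exp (- z) * hyp01 b ((a + b) * z)"
  unfolding max_lr_def
proof (intro mult_left_mono sums_le[OF _ hyp01_sums[OF assms(2)] hyp11_sums[OF assms(1,2)]])
  fix k
  have "(a + b) ^ k \<le> pochhammer (a + b) k" using assms by (intro power_le_pochhammer) auto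
  then have "(a + b) ^ k * (z ^ k / (fact k * pochhammer b k))
      \<le> pochhammer (a + b) k * (z ^ k / (fact k * pochhammer b k))"
    using assms by (intro mult_right_mono) (auto simp: pochhammer_nonneg)
  then show "1 / (fact k * pochhammer b k) * ((a + b) * z) ^ k \<le> poch_ratio a b k / fact k * z ^ k"
    by (simp add: poch_ratio_def power_mult_distrib mult_ac)
qed simp

subsection \<open>Densities of the chi-square and \<open>F\<close> laws\<close>

lemma nn_integral_gamma:
  assumes "s > 0" "r > 0"
  shows "(\<integral>\<^sup>+x. ennreal (indicator {0<..} x * (x powr (s - 1) * exp (- r * x))) \<partial>lborel) = ennreal (Gamma s / r powr s)"
proof -
  have "ennreal (Gamma s) = (\<integral>\<^sup>+t. ennreal (indicator {0..} t * t powr (s - 1) / exp t) \<partial>lborel)"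
    by (rule Gamma_conv_nn_integral_real[OF assms(1)])
  also have "\<dots> = ennreal r * (\<integral>\<^sup>+x. ennreal (indicator {0..} (r * x) * (r * x) powr (s - 1) / exp (r * x)) \<partial>lborel)"
    using assms by (subst nn_integral_real_affine[where c=r and t=0]) auto
  also have "\<dots> = ennreal r * (\<integral>\<^sup>+x. ennreal (r powr (s - 1)) * ennreal (indicator {0<..} x * (x powr (s - 1) * exp (- r * x))) \<partial>lborel)"
    using assms
    by (intro arg_cong2[where f="(*)"] nn_integral_cong refl)
       (auto simp: indicator_def powr_mult exp_minus field_simps zero_le_mult_iff simp flip: ennreal_mult')
  also have "\<dots> = ennreal (r powr s) * (\<integral>\<^sup>+x. ennreal (indicator {0<..} x * (x powr (s - 1) * exp (- r * x))) \<partial>lborel)"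
  proof -
    have "r * r powr (s - 1) = r powr s" using assms by (simp add: powr_diff)
    then have "ennreal r * (ennreal (r powr (s - 1)) * I) = ennreal (r powr s) * I" for I
      using assms by (simp flip: mult.assoc ennreal_mult')
    then show ?thesis by (subst nn_integral_cmult) auto
  qed
  finally have *: "ennreal (Gamma s) = ennreal (r powr s) * (\<integral>\<^sup>+x. ennreal (indicator {0<..} x * (x powr (s - 1) * exp (- r * x))) \<partial>lborel)" .
  have "ennreal (Gamma s / r powr s) = ennreal (1 / r powr s) * ennreal (Gamma s)"
    using assms by (subst ennreal_mult'[symmetric]) auto
  also have "\<dots> = (\<integral>\<^sup>+x. ennreal (indicator {0<..} x * (x powr (s - 1) * exp (- r * x))) \<partial>lborel)"
    unfolding * using assms by (simp flip: mult.assoc ennreal_mult')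
  finally show ?thesis ..
qed

lemma nn_integral_beta:
  assumes "\<alpha> > 0" "\<beta> > 0" "u > (0::real)"
  shows "(\<integral>\<^sup>+y. ennreal (indicator {0<..<u} y * ((u - y) powr (\<alpha> - 1) * y powr (\<beta> - 1))) \<partial>lborel)
    = ennreal (u powr (\<alpha> + \<beta> - 1) * Beta \<alpha> \<beta>)"
proof -
  have B: "((\<lambda>t. t powr (\<beta> - 1) * (1 - t) powr (\<alpha> - 1)) has_integral Beta \<beta> \<alpha>) {0<..<1}"
    using has_integral_Beta_real[of \<beta> \<alpha>] assms by (simp add: has_integral_Icc_iff_Ioo)
  have "(\<integral>\<^sup>+y. ennreal (indicator {0<..<u} y * ((u - y) powr (\<alpha> - 1) * y powr (\<beta> - 1))) \<partial>lborel)
    = ennreal u * (\<integral>\<^sup>+y. ennreal (indicator {0<..<u} (u * y) * ((u - u * y) powr (\<alpha> - 1) * (u * y) powr (\<beta> - 1))) \<partial>lborel)"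
    using assms by (subst nn_integral_real_affine[where c=u and t=0]) auto
  also have "\<dots> = ennreal u * (\<integral>\<^sup>+y. ennreal (u powr (\<alpha> - 1) * u powr (\<beta> - 1)) * ennreal (indicator {0<..<1} y * (y powr (\<beta> - 1) * (1 - y) powr (\<alpha> - 1))) \<partial>lborel)"
  proof (intro arg_cong2[where f="(*)"] nn_integral_cong refl)
    fix y
    show "ennreal (indicator {0<..<u} (u * y) * ((u - u * y) powr (\<alpha> - 1) * (u * y) powr (\<beta> - 1))) =
      ennreal (u powr (\<alpha> - 1) * u powr (\<beta> - 1)) * ennreal (indicator {0<..<1} y * (y powr (\<beta> - 1) * (1 - y) powr (\<alpha> - 1)))"
    proof (cases "0 < y \<and> y < 1")
      case True
      have "(u - u * y) = u * (1 - y)" by (simp add: algebra_simps)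
      then show ?thesis using True assms by (simp add: powr_mult mult_ac flip: ennreal_mult')
    next
      case False
      then show ?thesis using assms by (auto simp: indicator_def zero_less_mult_iff)
    qed
  qed
  also have "\<dots> = ennreal (u * (u powr (\<alpha> - 1) * u powr (\<beta> - 1))) *
      (\<integral>\<^sup>+y. ennreal (indicator {0<..<1} y * (y powr (\<beta> - 1) * (1 - y) powr (\<alpha> - 1))) \<partial>lborel)"
    using assms by (simp add: nn_integral_cmult mult.assoc ennreal_mult)
  also have "(\<integral>\<^sup>+y. ennreal (indicator {0<..<1} y * (y powr (\<beta> - 1) * (1 - y) powr (\<alpha> - 1))) \<partial>lborel) = Beta \<beta> \<alpha>"
    by (rule nn_integral_has_integral_lebesgue[OF _ B]) auto
  also have "u * (u powr (\<alpha> - 1) * u powr (\<beta> - 1)) = u powr (\<alpha> + \<beta> - 1)"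
    using assms by (simp add: powr_diff powr_add field_simps)
  finally show ?thesis using assms by (simp add: Beta_commute flip: ennreal_mult')
qed

text \<open>The central chi-square density with \<open>2 * s\<close> degrees of freedom.\<close>

definition chi2_density :: "real \<Rightarrow> real \<Rightarrow> real" where
  "chi2_density s x = (if x > 0 then x powr (s - 1) * exp (- x / 2) / (2 powr s * Gamma s) else 0)"

lemma chi2_density_nonneg: "s > 0 \<Longrightarrow> chi2_density s x \<ge> 0"
  by (auto simp: chi2_density_def Gamma_real_pos less_imp_le)

lemma chi2_density_measurable [measurable]: "chi2_density s \<in> borel_measurable borel"
  unfolding chi2_density_def by measurable

lemma nn_integral_chi2_density:
  assumes "s > 0"
  shows "(\<integral>\<^sup>+x. ennreal (chi2_density s x) \<partial>lborel) = 1"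
proof -
  have "(\<integral>\<^sup>+x. ennreal (chi2_density s x) \<partial>lborel) =
      (\<integral>\<^sup>+x. ennreal (1 / (2 powr s * Gamma s)) * ennreal (indicator {0<..} x * (x powr (s - 1) * exp (- (1/2) * x))) \<partial>lborel)"
    using assms by (intro nn_integral_cong) (auto simp: chi2_density_def Gamma_real_pos less_imp_le simp flip: ennreal_mult')
  also have "\<dots> = ennreal (1 / (2 powr s * Gamma s)) * ennreal (Gamma s / (1/2) powr s)"
    using assms by (subst nn_integral_cmult, simp, subst nn_integral_gamma) auto
  also have "\<dots> = ennreal 1"
    using Gamma_real_pos[OF assms]
    by (subst ennreal_mult'[symmetric]) (auto simp: powr_divide)
  finally show ?thesis by simp
qed

text \<open>The exponentials combine to \<open>exp (- x / 2)\<close>, independent of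
  \<open>y\<close>, and a Beta integral over the interval from 0 to \<open>x\<close>
  remains.\<close>

lemma chi2_density_convolution:
  assumes "\<alpha> > 0" "\<beta> > 0"
  shows "(\<integral>\<^sup>+y. ennreal (chi2_density \<alpha> (x - y)) * ennreal (chi2_density \<beta> y) \<partial>lborel)
    = ennreal (chi2_density (\<alpha> + \<beta>) x)"
proof (cases "x > 0")
  case True
  define C where "C = exp (- x / 2) / (2 powr (\<alpha> + \<beta>) * Gamma \<alpha> * Gamma \<beta>)"
  have C: "C \<ge> 0" using assms by (simp add: C_def Gamma_real_pos less_imp_le)
  have "(\<integral>\<^sup>+y. ennreal (chi2_density \<alpha> (x - y)) * ennreal (chi2_density \<beta> y) \<partial>lborel)
    = (\<integral>\<^sup>+y. ennreal C * ennreal (indicator {0<..<x} y * ((x - y) powr (\<alpha> - 1) * y powr (\<beta> - 1))) \<partial>lborel)"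
  proof (intro nn_integral_cong)
    fix y
    have "chi2_density \<alpha> (x - y) * chi2_density \<beta> y =
        C * (indicator {0<..<x} y * ((x - y) powr (\<alpha> - 1) * y powr (\<beta> - 1)))"
    proof (cases "0 < y \<and> y < x")
      case True
      have "exp (- x / 2) = exp (- (x - y) / 2) * exp (- y / 2)"
        by (simp flip: exp_add add: field_simps)
      then show ?thesis using True by (simp add: chi2_density_def C_def powr_add mult_ac)
    qed (auto simp: chi2_density_def)
    then show "ennreal (chi2_density \<alpha> (x - y)) * ennreal (chi2_density \<beta> y) =
        ennreal C * ennreal (indicator {0<..<x} y * ((x - y) powr (\<alpha> - 1) * y powr (\<beta> - 1)))"
      using C assms by (simp add: chi2_density_nonneg flip: ennreal_mult')
  qed
  also have "\<dots> = ennreal (C * (x powr (\<alpha> + \<beta> - 1) * Beta \<alpha> \<beta>))"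
    using C by (subst nn_integral_cmult, simp, subst nn_integral_beta[OF assms True]) (simp flip: ennreal_mult')
  also have "C * (x powr (\<alpha> + \<beta> - 1) * Beta \<alpha> \<beta>) = chi2_density (\<alpha> + \<beta>) x"
    using True Gamma_real_pos[OF assms(1)] Gamma_real_pos[OF assms(2)]
    by (simp add: C_def chi2_density_def Beta_def)
  finally show ?thesis .
next
  case False
  then have "chi2_density \<alpha> (x - y) * chi2_density \<beta> y = 0" for y
    by (auto simp: chi2_density_def)
  then have zero: "ennreal (chi2_density \<alpha> (x - y)) * ennreal (chi2_density \<beta> y) = 0" for y
    using assms by (simp add: chi2_density_nonneg flip: ennreal_mult')
  show ?thesis unfolding zero using False by (simp add: chi2_density_def)
qed

text \<open>The substitution rule is applied on compact intervals. The half-line is exhausted by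
  [0, n] in \<open>x\<close>, which corresponds to [0, n^2] in \<open>u\<close>, and monotone
  convergence passes to the limit on both sides.\<close>

lemma nn_integral_square_substitution:
  fixes f :: "real \<Rightarrow> real"
  assumes [measurable]: "f \<in> borel_measurable borel" and f: "\<And>u. u \<ge> 0 \<Longrightarrow> f u \<ge> 0"
  shows "(\<integral>\<^sup>+u. ennreal (f u * indicator {0..} u) \<partial>lborel) =
    (\<integral>\<^sup>+x. ennreal (f (x\<^sup>2) * (2 * x) * indicator {0..} x) \<partial>lborel)"
proof -
  have eq: "(\<integral>\<^sup>+u. ennreal (f u * indicator {0..(real n)\<^sup>2} u) \<partial>lborel) =
      (\<integral>\<^sup>+x. ennreal (f (x\<^sup>2) * (2 * x) * indicator {0..real n} x) \<partial>lborel)" for n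
  proof -
    have "((\<lambda>x. x\<^sup>2) has_real_derivative 2 * x) (at x)" for x :: real
      by (rule derivative_eq_intros refl)+ simp
    then show ?thesis
      using nn_integral_substitution[of "\<lambda>x. x\<^sup>2" 0 "real n" f "\<lambda>x. 2 * x"]
      by (simp add: set_borel_measurable_def continuous_intros)
  qed
  have sup: "(\<integral>\<^sup>+u. ennreal (g u * indicator {0..} u) \<partial>lborel) =
      (SUP n. \<integral>\<^sup>+u. ennreal (g u * indicator {0..h n} u) \<partial>lborel)"
    if [measurable]: "g \<in> borel_measurable borel" and g: "\<And>u. u \<ge> 0 \<Longrightarrow> g u \<ge> 0" and h: "mono h" "filterlim h at_top sequentially"
    for g :: "real \<Rightarrow> real" and h
  proof (subst nn_integral_monotone_convergence_SUP[symmetric])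
    show "incseq (\<lambda>n u. ennreal (g u * indicator {0..h n} u))"
    proof (intro incseq_SucI le_funI)
      fix n u
      have "h n \<le> h (Suc n)" using h by (simp add: monoD)
      then show "ennreal (g u * indicator {0..h n} u) \<le> ennreal (g u * indicator {0..h (Suc n)} u)"
        using g[of u] by (auto simp: indicator_def)
    qed
    show "(\<integral>\<^sup>+u. ennreal (g u * indicator {0..} u) \<partial>lborel) =
        (\<integral>\<^sup>+u. (SUP n. ennreal (g u * indicator {0..h n} u)) \<partial>lborel)"
    proof (intro nn_integral_cong antisym)
      fix u
      obtain n where n: "u \<le> h n"
        using h(2) by (metis eventually_sequentially filterlim_at_top order_refl)
      show "ennreal (g u * indicator {0..} u) \<le> (SUP n. ennreal (g u * indicator {0..h n} u))"
        by (rule SUP_upper2[of n]) (use n in \<open>auto simp: indicator_def\<close>)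
      show "(SUP n. ennreal (g u * indicator {0..h n} u)) \<le> ennreal (g u * indicator {0..} u)"
        by (rule SUP_least) (use g[of u] in \<open>auto simp: indicator_def\<close>)
    qed
  qed auto
  have "mono real" "mono (\<lambda>n. (real n)\<^sup>2)" by (auto simp: mono_def power_mono)
  moreover have "filterlim real at_top sequentially" by (rule filterlim_real_sequentially)
  moreover from this have "filterlim (\<lambda>n. (real n)\<^sup>2) at_top sequentially"
    by (intro filterlim_pow_at_top) auto
  ultimately show ?thesis
    using f by (subst sup[of f "\<lambda>n. (real n)\<^sup>2"], simp_all add: eq)
      (subst sup[of "\<lambda>x. f (x\<^sup>2) * (2 * x)" real], simp_all)
qed

section \<open>Noncentral chi-square laws as Poisson mixtures\<close>

definition poisson_weight :: "real \<Rightarrow> nat \<Rightarrow> real" where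
  "poisson_weight z k = exp (- z) * (z ^ k / fact k)"

lemma poisson_weight_nonneg: "z \<ge> 0 \<Longrightarrow> poisson_weight z k \<ge> 0"
  by (simp add: poisson_weight_def)

lemma poisson_weight_sums: "poisson_weight z sums 1"
proof -
  have "(\<lambda>k. exp (- z) * (z ^ k /\<^sub>R fact k)) sums (exp (- z) * exp z)"
    by (intro sums_mult exp_converges)
  moreover have "poisson_weight z = (\<lambda>k. exp (- z) * (z ^ k /\<^sub>R fact k))"
    by (simp add: poisson_weight_def fun_eq_iff field_simps)
  moreover have "exp (- z) * exp z = 1" by (simp flip: exp_add)
  ultimately show ?thesis by simp
qed

text \<open>The noncentral chi-square density with \<open>2 * b\<close> degrees of freedom and
  noncentrality \<open>2 * z\<close>. Values in \<open>ennreal\<close> allow sums and integrals to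
  be exchanged without convergence conditions.\<close>

definition chi2_mixture :: "real \<Rightarrow> real \<Rightarrow> real \<Rightarrow> ennreal" where
  "chi2_mixture z b x = (\<Sum>k. ennreal (poisson_weight z k) * ennreal (chi2_density (b + k) x))"

lemma chi2_mixture_measurable [measurable]: "chi2_mixture z b \<in> borel_measurable borel"
  unfolding chi2_mixture_def by measurable

lemma nn_integral_chi2_mixture:
  assumes "z \<ge> 0" "b > 0"
  shows "(\<integral>\<^sup>+x. chi2_mixture z b x \<partial>lborel) = 1"
proof -
  have "(\<integral>\<^sup>+x. chi2_mixture z b x \<partial>lborel) = (\<Sum>k. ennreal (poisson_weight z k))"
    unfolding chi2_mixture_def using assms
    by (subst nn_integral_suminf) (auto simp: nn_integral_cmult nn_integral_chi2_density)
  also have "\<dots> = ennreal 1"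
    using poisson_weight_sums assms by (intro suminf_ennreal_eq) (auto simp: poisson_weight_nonneg)
  finally show ?thesis by simp
qed

text \<open>Converts the factor (2k)! of the cosh series into the Gamma factor of a chi-square
  density with 2k + 1 degrees of freedom.\<close>

lemma Gamma_nat_plus_half:
  "Gamma (1/2 + real k) = fact (2 * k) * sqrt pi / (4 ^ k * fact k)"
proof (induction k)
  case (Suc k)
  have "Gamma (1/2 + real (Suc k)) = (1/2 + k) * Gamma (1/2 + real k)"
  proof -
    have "1/2 + real k \<notin> \<int>\<^sub>\<le>\<^sub>0" using nonpos_Ints_nonpos[of "1/2 + real k"] by force
    from Gamma_plus1[OF this] show ?thesis by (simp add: add_ac)
  qed
  also have "\<dots> = fact (2 * Suc k) * sqrt pi / (4 ^ Suc k * fact (Suc k))"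
    unfolding Suc by (simp add: divide_simps) (simp add: algebra_simps)
  finally show ?case .
qed (simp add: Gamma_one_half_real)

lemma cosh_sums: "(\<lambda>k. (x::real) ^ (2 * k) / fact (2 * k)) sums cosh x"
proof -
  have "(\<lambda>n. if even n then x ^ n /\<^sub>R fact n else 0) sums cosh x" by (rule cosh_converges)
  then have "(\<lambda>k. (if even (2 * k) then x ^ (2 * k) /\<^sub>R fact (2 * k) else 0)) sums cosh x"
    by (subst sums_mono_reindex) (auto simp: strict_mono_def elim!: evenE)
  then show ?thesis by (simp add: field_simps)
qed

text \<open>The left side is the density of a squared normal with mean \<open>m\<close>, from the
  two preimages of \<open>u\<close>. Expanding the squares leaves \<open>cosh (m * sqrt u)\<close>
  times a factor even in \<open>m\<close>, and the k-th term of the cosh series is the k-th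
  component of the Poisson mixture.\<close>

lemma shifted_square_density:
  assumes u: "u > 0"
  shows "ennreal ((std_normal_density (sqrt u - m) + std_normal_density (- sqrt u - m)) / (2 * sqrt u))
    = chi2_mixture (m\<^sup>2 / 2) (1/2) u"
proof -
  define C where "C = exp (- m\<^sup>2 / 2) * exp (- u / 2) / (sqrt (2 * pi) * sqrt u)"
  have 1: "(\<lambda>k. C * ((m * sqrt u) ^ (2 * k) / fact (2 * k))) sums (C * cosh (m * sqrt u))"
    by (intro sums_mult cosh_sums)
  have 2: "C * cosh (m * sqrt u) =
      (std_normal_density (sqrt u - m) + std_normal_density (- sqrt u - m)) / (2 * sqrt u)"
  proof -
    have e1: "exp (- (sqrt u - m)\<^sup>2 / 2) = exp (- m\<^sup>2 / 2) * exp (- u / 2) * exp (m * sqrt u)"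
      using u by (simp flip: exp_add add: power2_eq_square field_simps)
    have e2: "exp (- (- sqrt u - m)\<^sup>2 / 2) = exp (- m\<^sup>2 / 2) * exp (- u / 2) * exp (- (m * sqrt u))"
      using u by (simp flip: exp_add add: power2_eq_square field_simps)
    show ?thesis
      unfolding std_normal_density_def e1 e2 C_def cosh_def by (simp add: field_simps)
  qed
  have 3: "C * ((m * sqrt u) ^ (2 * k) / fact (2 * k)) =
      poisson_weight (m\<^sup>2 / 2) k * chi2_density (1/2 + k) u" for k
  proof -
    have "(m * sqrt u) ^ (2 * k) = (m\<^sup>2) ^ k * u ^ k"
      using u by (simp add: power_mult power_mult_distrib)
    moreover have "u powr (1/2 + real k - 1) = u ^ k / sqrt u"
    proof -
      have "1/2 + real k - 1 = real k - 1/2" by simp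
      then show ?thesis using u by (simp only: powr_diff powr_half_sqrt powr_realpow)
    qed
    moreover have "2 powr (1/2 + real k) = sqrt 2 * 2 ^ k"
      by (simp add: powr_add powr_half_sqrt powr_realpow)
    moreover have "(4::real) ^ k = 2 ^ k * 2 ^ k" by (simp flip: power_mult_distrib)
    ultimately show ?thesis
      using u by (simp add: C_def poisson_weight_def chi2_density_def Gamma_nat_plus_half
          real_sqrt_mult power_divide mult_ac)
  qed
  have "(\<lambda>k. poisson_weight (m\<^sup>2 / 2) k * chi2_density (1/2 + k) u) sums
    ((std_normal_density (sqrt u - m) + std_normal_density (- sqrt u - m)) / (2 * sqrt u))"
    using 1 unfolding 2 3 .
  then have "(\<Sum>k. ennreal (poisson_weight (m\<^sup>2 / 2) k * chi2_density (1/2 + k) u)) =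
    ennreal ((std_normal_density (sqrt u - m) + std_normal_density (- sqrt u - m)) / (2 * sqrt u))"
    by (intro suminf_ennreal_eq) (auto simp: poisson_weight_nonneg chi2_density_nonneg)
  then show ?thesis
    by (simp add: chi2_mixture_def ennreal_mult poisson_weight_nonneg chi2_density_nonneg)
qed

lemma chi2_mixture_nonpos: "x \<le> 0 \<Longrightarrow> chi2_mixture z b x = 0"
  by (simp add: chi2_mixture_def chi2_density_def)

lemma distr_shifted_square:
  "distr (density lborel std_normal_density) borel (\<lambda>x. (x + m)\<^sup>2) =
    density lborel (chi2_mixture (m\<^sup>2 / 2) (1/2))"
proof (rule measure_eqI)
  fix A assume "A \<in> sets (distr (density lborel std_normal_density) borel (\<lambda>x. (x + m)\<^sup>2))"
  then have A [measurable]: "A \<in> sets borel" by simp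
  define f where "f x = std_normal_density (x - m) * indicator A (x\<^sup>2)" for x
  have [measurable]: "f \<in> borel_measurable borel" unfolding f_def by measurable
  have f: "f x \<ge> 0" for x by (simp add: f_def)
  have "emeasure (distr (density lborel std_normal_density) borel (\<lambda>x. (x + m)\<^sup>2)) A
      = (\<integral>\<^sup>+x. indicator A x \<partial>distr (density lborel std_normal_density) borel (\<lambda>x. (x + m)\<^sup>2))"
    by simp
  also have "\<dots> = (\<integral>\<^sup>+x. indicator A ((x + m)\<^sup>2) \<partial>density lborel std_normal_density)"
    by (rule nn_integral_distr) auto
  also have "\<dots> = (\<integral>\<^sup>+x. ennreal (f (m + x)) \<partial>lborel)"
    by (subst nn_integral_density)
       (auto simp: f_def indicator_def add.commute intro!: nn_integral_cong)
  also have "\<dots> = (\<integral>\<^sup>+x. ennreal (f x) \<partial>lborel)"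
    using nn_integral_real_affine[of "\<lambda>x. ennreal (f x)" 1 m] by simp
  also have "\<dots> = (\<integral>\<^sup>+x. ennreal (f x) * indicator {0..} x + ennreal (f x) * indicator {..<0} x \<partial>lborel)"
    by (intro nn_integral_cong) (auto simp: indicator_def)
  also have "\<dots> = (\<integral>\<^sup>+x. ennreal (f x) * indicator {0..} x \<partial>lborel) + (\<integral>\<^sup>+x. ennreal (f x) * indicator {..<0} x \<partial>lborel)"
    by (intro nn_integral_add) auto
  also have "(\<integral>\<^sup>+x. ennreal (f x) * indicator {..<0} x \<partial>lborel) = (\<integral>\<^sup>+x. ennreal (f (- x)) * indicator {..<0} (- x) \<partial>lborel)"
    using nn_integral_real_affine[of "\<lambda>x. ennreal (f x) * indicator {..<0} x" "-1" 0] by simp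
  also have "\<dots> = (\<integral>\<^sup>+x. ennreal (f (- x)) * indicator {0..} x \<partial>lborel)"
  proof (intro nn_integral_cong_AE AE_mp[OF AE_lborel_singleton[of 0] AE_I2] impI)
    fix x :: real assume "x \<noteq> 0"
    then show "ennreal (f (- x)) * indicator {..<0} (- x) = ennreal (f (- x)) * indicator {0..} x"
      by (simp add: indicator_def)
  qed
  also have "(\<integral>\<^sup>+x. ennreal (f x) * indicator {0..} x \<partial>lborel) + \<dots> =
      (\<integral>\<^sup>+x. ennreal (f x) * indicator {0..} x + ennreal (f (- x)) * indicator {0..} x \<partial>lborel)"
    by (rule nn_integral_add[symmetric]) auto
  \<comment> \<open>Writing \<open>x\<close> as the root of its square and inserting the factor
    \<open>2 * x\<close> brings the integrand into the form needed for the substitution. The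
    identity can fail only at \<open>x = 0\<close>, a null set.\<close>
  also have "\<dots> = (\<integral>\<^sup>+x. ennreal ((f (sqrt (x\<^sup>2)) + f (- sqrt (x\<^sup>2))) / (2 * sqrt (x\<^sup>2)) * (2 * x) * indicator {0..} x) \<partial>lborel)"
  proof (intro nn_integral_cong_AE AE_mp[OF AE_lborel_singleton[of 0] AE_I2] impI)
    fix x :: real assume "x \<noteq> 0"
    then consider "x > 0" | "x < 0" by linarith
    then show "ennreal (f x) * indicator {0..} x + ennreal (f (- x)) * indicator {0..} x =
        ennreal ((f (sqrt (x\<^sup>2)) + f (- sqrt (x\<^sup>2))) / (2 * sqrt (x\<^sup>2)) * (2 * x) * indicator {0..} x)"
      using f[of x] f[of "-x"] by cases simp_all
  qed
  also have "\<dots> = (\<integral>\<^sup>+u. ennreal ((f (sqrt u) + f (- sqrt u)) / (2 * sqrt u) * indicator {0..} u) \<partial>lborel)"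
    by (rule nn_integral_square_substitution[symmetric]) (use f in auto)
  also have "\<dots> = (\<integral>\<^sup>+u. chi2_mixture (m\<^sup>2 / 2) (1/2) u * indicator A u \<partial>lborel)"
  proof (intro nn_integral_cong)
    fix u :: real
    show "ennreal ((f (sqrt u) + f (- sqrt u)) / (2 * sqrt u) * indicator {0..} u) =
        chi2_mixture (m\<^sup>2 / 2) (1/2) u * indicator A u"
    proof (cases "u > 0")
      case True
      then show ?thesis
        by (auto simp: f_def indicator_def shifted_square_density[symmetric])
    next
      case False
      then show ?thesis by (cases "u = 0") (auto simp: chi2_mixture_nonpos)
    qed
  qed
  also have "\<dots> = emeasure (density lborel (chi2_mixture (m\<^sup>2 / 2) (1/2))) A"
    by (simp add: emeasure_density)
  finally show "emeasure (distr (density lborel std_normal_density) borel (\<lambda>x. (x + m)\<^sup>2)) A =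
      emeasure (density lborel (chi2_mixture (m\<^sup>2 / 2) (1/2))) A" .
qed simp

lemma chi2_mixture_convolution:
  assumes "z \<ge> 0" "b > 0" "\<beta> > 0"
  shows "(\<integral>\<^sup>+y. chi2_mixture z b (x - y) * ennreal (chi2_density \<beta> y) \<partial>lborel) = chi2_mixture z (b + \<beta>) x"
proof -
  have "(\<integral>\<^sup>+y. chi2_mixture z b (x - y) * ennreal (chi2_density \<beta> y) \<partial>lborel) =
    (\<integral>\<^sup>+y. (\<Sum>k. ennreal (poisson_weight z k) * (ennreal (chi2_density (b + k) (x - y)) * ennreal (chi2_density \<beta> y))) \<partial>lborel)"
    by (simp add: chi2_mixture_def mult.assoc flip: ennreal_suminf_multc)
  also have "\<dots> = (\<Sum>k. ennreal (poisson_weight z k) * ennreal (chi2_density (b + k + \<beta>) x))"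
    using assms by (subst nn_integral_suminf)
      (auto simp: nn_integral_cmult chi2_density_convolution)
  finally show ?thesis by (simp add: chi2_mixture_def add_ac)
qed

lemma chi2_mixture_0: "chi2_mixture 0 b x = ennreal (chi2_density b x)"
proof -
  have "chi2_mixture 0 b x = (\<Sum>k\<in>{0}. ennreal (poisson_weight 0 k) * ennreal (chi2_density (b + real k) x))"
    unfolding chi2_mixture_def by (intro suminf_finite) (auto simp: poisson_weight_def power_0_left)
  then show ?thesis by (simp add: poisson_weight_def)
qed


text \<open>Coordinate 0 carries the whole mean, so the base case is one shifted square. Every
  further coordinate adds an independent central chi-square variable with one degree of freedom: the
  law is convolved with \<open>Y\<close>, which raises the degrees of freedom of each mixture
  component and keeps the Poisson weights.\<close>

lemma noncentral_chi_square_density: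
  assumes "p \<ge> 1" "\<Delta> \<ge> 0"
  shows "noncentral_chi_square p \<Delta> = density lborel (chi2_mixture (\<Delta> / 2) (p / 2))"
  using assms(1)
proof (induction p rule: nat_induct_at_least)
  case base
  interpret N: prob_space "density lborel std_normal_density"
    by (rule prob_space_normal_density) simp
  interpret P: product_sigma_finite "\<lambda>_::nat. density lborel std_normal_density" ..
  have "noncentral_chi_square 1 \<Delta> = distr (PiM {0} (\<lambda>_. density lborel std_normal_density)) borel
      ((\<lambda>y. (y + sqrt \<Delta>)\<^sup>2) \<circ> (\<lambda>z. z (0::nat)))"
    by (simp add: noncentral_chi_square_def lessThan_Suc comp_def)
  also have "\<dots> = distr (distr (PiM {0} (\<lambda>_. density lborel std_normal_density)) (density lborel std_normal_density) (\<lambda>z. z (0::nat)))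
      borel (\<lambda>y. (y + sqrt \<Delta>)\<^sup>2)"
    by (rule distr_distr[symmetric]) auto
  also have "distr (PiM {0} (\<lambda>_. density lborel std_normal_density)) (density lborel std_normal_density) (\<lambda>z. z (0::nat))
      = density lborel std_normal_density"
    by (rule distr_PiM_component) (auto simp: N.prob_space_axioms)
  also have "distr (density lborel std_normal_density) borel (\<lambda>y. (y + sqrt \<Delta>)\<^sup>2) =
      density lborel (chi2_mixture (\<Delta> / 2) (1 / 2))"
    using assms(2) by (simp add: distr_shifted_square)
  finally show ?case by simp
next
  case (Suc p)
  let ?N = "density lborel std_normal_density"
  interpret N: prob_space ?N
    by (rule prob_space_normal_density) simp
  interpret P: product_prob_space "\<lambda>_::nat. ?N" ..
  define S where "S z = (\<Sum>i<p. (z i + (if i = 0 then sqrt \<Delta> else 0))\<^sup>2)" for z :: "nat \<Rightarrow> real"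
  have [measurable]: "S \<in> borel_measurable (PiM {..<p} (\<lambda>_. ?N))"
    "S \<in> borel_measurable (PiM (insert p {..<p}) (\<lambda>_. ?N))"
    unfolding S_def by measurable
  have "prob_space (PiM {..<p} (\<lambda>_. ?N))" by (intro prob_space_PiM N.prob_space_axioms)
  then interpret X: prob_space "noncentral_chi_square p \<Delta>"
    unfolding noncentral_chi_square_def S_def[symmetric] by (rule prob_space.prob_space_distr) measurable
  define Y where "Y = density lborel (chi2_mixture 0 (1/2))"
  have Y: "Y = distr ?N borel (\<lambda>x. x\<^sup>2)"
    using distr_shifted_square[of 0] by (simp add: Y_def)
  interpret Y: prob_space Y
    unfolding Y by (rule N.prob_space_distr) simp
  have "noncentral_chi_square (Suc p) \<Delta> = convolution (noncentral_chi_square p \<Delta>) Y"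
  proof (rule measure_eqI)
    fix A assume "A \<in> sets (noncentral_chi_square (Suc p) \<Delta>)"
    then have [measurable]: "A \<in> sets borel" by (simp add: noncentral_chi_square_def)
    have eq: "noncentral_chi_square (Suc p) \<Delta> = distr (PiM (insert p {..<p}) (\<lambda>_. ?N)) borel (\<lambda>z. S z + (z p)\<^sup>2)"
      using Suc.hyps by (simp add: noncentral_chi_square_def S_def lessThan_Suc add.commute)
    have "emeasure (noncentral_chi_square (Suc p) \<Delta>) A =
        (\<integral>\<^sup>+x. indicator A x \<partial>distr (PiM (insert p {..<p}) (\<lambda>_. ?N)) borel (\<lambda>z. S z + (z p)\<^sup>2))"
      unfolding eq by simp
    also have "\<dots> = (\<integral>\<^sup>+z. indicator A (S z + (z p)\<^sup>2) \<partial>PiM (insert p {..<p}) (\<lambda>_. ?N))"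
      by (rule nn_integral_distr) auto
    also have "\<dots> = (\<integral>\<^sup>+z. \<integral>\<^sup>+y. indicator A (S (z(p := y)) + ((z(p := y)) p)\<^sup>2) \<partial>?N \<partial>PiM {..<p} (\<lambda>_. ?N))"
      by (rule P.product_nn_integral_insert) auto
    also have "\<dots> = (\<integral>\<^sup>+z. \<integral>\<^sup>+y. indicator A (S z + y\<^sup>2) \<partial>?N \<partial>PiM {..<p} (\<lambda>_. ?N))"
    proof -
      have "S (z(p := y)) = S z" for z y
        unfolding S_def by (intro sum.cong) auto
      then show ?thesis by simp
    qed
    also have "\<dots> = (\<integral>\<^sup>+z. \<integral>\<^sup>+y. indicator A (S z + y) \<partial>Y \<partial>PiM {..<p} (\<lambda>_. ?N))"
      unfolding Y by (subst nn_integral_distr) auto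
    also have "\<dots> = (\<integral>\<^sup>+x. \<integral>\<^sup>+y. indicator A (x + y) \<partial>Y \<partial>noncentral_chi_square p \<Delta>)"
    proof -
      have "(\<lambda>x. \<integral>\<^sup>+y. indicator A (x + y) \<partial>Y) \<in> borel_measurable borel"
        by (rule Y.borel_measurable_nn_integral) (simp add: Y_def)
      then show ?thesis
        unfolding noncentral_chi_square_def S_def[symmetric] by (subst nn_integral_distr) auto
    qed
    also have "\<dots> = emeasure (convolution (noncentral_chi_square p \<Delta>) Y) A"
      by (rule convolution_emeasure'[symmetric])
         (simp_all add: X.finite_measure_axioms Y.finite_measure_axioms, simp_all add: Y_def noncentral_chi_square_def)
    finally show "emeasure (noncentral_chi_square (Suc p) \<Delta>) A = emeasure (convolution (noncentral_chi_square p \<Delta>) Y) A" .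
  qed (simp add: noncentral_chi_square_def)
  also have "\<dots> = density lborel (\<lambda>x. \<integral>\<^sup>+y. chi2_mixture (\<Delta> / 2) (p / 2) (x - y) * chi2_mixture 0 (1/2) y \<partial>lborel)"
    unfolding Suc.IH Y_def
    using X.finite_measure_axioms Y.finite_measure_axioms unfolding Suc.IH Y_def
    by (intro convolution_density) simp_all
  also have "\<dots> = density lborel (chi2_mixture (\<Delta> / 2) (Suc p / 2))"
    using assms Suc.hyps
    by (intro arg_cong[where f="density lborel"] ext)
       (simp add: chi2_mixture_0 chi2_mixture_convolution add_divide_distrib add.commute)
  finally show ?case .
qed

section \<open>Densities of the central and noncentral F laws\<close>

text \<open>\<open>F_ratio_arg\<close> maps the value of the \<open>F\<close> statistic to that of the ratio of the explained to the
  total sum of squares.\<close>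

definition F_ratio_arg :: "real \<Rightarrow> real \<Rightarrow> real" where
  "F_ratio_arg c x = c * x / (1 + c * x)"

text \<open>For \<open>a = n / 2\<close>, \<open>b = p / 2\<close> and \<open>c = p / n\<close> this
  is the central F density: \<open>c * x\<close> is the ratio of the two chi-square variables, which
  has a beta prime law, and the leading \<open>c\<close> is the Jacobian.\<close>

definition F_density :: "real \<Rightarrow> real \<Rightarrow> real \<Rightarrow> real \<Rightarrow> real" where
  "F_density a b c x = (if x > 0 then c * (c * x) powr (b - 1) * (1 + c * x) powr (- (a + b)) / Beta a b else 0)"

lemma F_density_measurable [measurable]: "F_density a b c \<in> borel_measurable borel"
  unfolding F_density_def by measurable

lemma F_ratio_arg_measurable [measurable]: "F_ratio_arg c \<in> borel_measurable borel"
  unfolding F_ratio_arg_def by measurable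

lemma hyp11_measurable [measurable]: "hyp11 a b \<in> borel_measurable borel"
  unfolding hyp11_def by measurable

text \<open>The integrand is the joint density at numerator \<open>c * v * x\<close> and denominator
  \<open>v\<close>, with Jacobian \<open>c * v\<close>. In \<open>v\<close> it is a Gamma integral
  with shape \<open>a + b + k\<close>. Compared with \<open>k = 0\<close>, the Gamma functions
  contribute \<open>poch_ratio a b k\<close> and the powers of \<open>c * x\<close> and
  \<open>1 + c * x\<close> contribute \<open>F_ratio_arg c x ^ k\<close>.\<close>

lemma nn_integral_F_kernel:
  assumes "a > 0" "b > 0" "c > 0" "x > 0"
  shows "(\<integral>\<^sup>+v. ennreal (chi2_density (b + k) (c * v * x)) * ennreal (c * v) * ennreal (chi2_density a v) \<partial>lborel)
    = ennreal (F_density a b c x * (poch_ratio a b k * F_ratio_arg c x ^ k))"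
proof -
  define C where "C = c * (c * x) powr (b + k - 1) / (2 powr (b + k) * Gamma (b + k) * 2 powr a * Gamma a)"
  have C: "C \<ge> 0" using assms by (simp add: C_def Gamma_real_pos less_imp_le)
  have cx: "1 + c * x > 0" using assms by (simp add: add_pos_pos)
  have "(\<integral>\<^sup>+v. ennreal (chi2_density (b + k) (c * v * x)) * ennreal (c * v) * ennreal (chi2_density a v) \<partial>lborel)
      = (\<integral>\<^sup>+v. ennreal C * ennreal (indicator {0<..} v * (v powr ((a + b + k) - 1) * exp (- ((1 + c * x) / 2) * v))) \<partial>lborel)"
  proof (intro nn_integral_cong)
    fix v
    show "ennreal (chi2_density (b + k) (c * v * x)) * ennreal (c * v) * ennreal (chi2_density a v) =
      ennreal C * ennreal (indicator {0<..} v * (v powr ((a + b + k) - 1) * exp (- ((1 + c * x) / 2) * v)))"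
    proof (cases "v > 0")
      case True
      have "(c * v * x) powr (b + k - 1) = (c * x) powr (b + k - 1) * v powr (b + k - 1)"
        using assms True by (simp add: mult_ac flip: powr_mult)
      moreover have "v powr (a + b + k - 1) = v powr (b + k - 1) * v * v powr (a - 1)"
      proof -
        have "v powr (a + b + k - 1) = v powr ((b + k - 1) + 1 + (a - 1))" by (simp add: algebra_simps)
        then show ?thesis using True by (simp only: powr_add) simp
      qed
      moreover have "exp (- ((1 + c * x) / 2) * v) = exp (- (c * v * x) / 2) * exp (- v / 2)"
        by (simp flip: exp_add add: field_simps)
      ultimately have "chi2_density (b + k) (c * v * x) * (c * v) * chi2_density a v =
          C * (v powr ((a + b + k) - 1) * exp (- ((1 + c * x) / 2) * v))"
        using True assms by (simp add: chi2_density_def C_def mult_ac)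
      then show ?thesis
        using True assms C by (simp add: chi2_density_nonneg flip: ennreal_mult')
    qed (simp add: chi2_density_def)
  qed
  also have "\<dots> = ennreal (C * (Gamma (a + b + k) / ((1 + c * x) / 2) powr (a + b + k)))"
    using assms C cx by (subst nn_integral_cmult, simp, subst nn_integral_gamma) (auto simp flip: ennreal_mult')
  also have "C * (Gamma (a + b + k) / ((1 + c * x) / 2) powr (a + b + k)) =
      F_density a b c x * (poch_ratio a b k * F_ratio_arg c x ^ k)"
  proof -
    have nz: "b \<notin> \<int>\<^sub>\<le>\<^sub>0" "a + b \<notin> \<int>\<^sub>\<le>\<^sub>0"
      using nonpos_Ints_nonpos[of b] nonpos_Ints_nonpos[of "a + b"] assms by force+
    have pos: "Gamma (a + b) \<noteq> 0" "Gamma (b + k) \<noteq> 0" "Gamma b \<noteq> 0" "Gamma a \<noteq> 0"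
      using assms by (auto intro!: Gamma_real_pos less_imp_neq[THEN not_sym])
    have 1: "poch_ratio a b k = Gamma (a + b + k) / Gamma (a + b) * (Gamma b / Gamma (b + k))"
      using nz pos by (simp add: poch_ratio_def pochhammer_Gamma)
    have 2: "(c * x) powr (b + k - 1) = (c * x) powr (b - 1) * (c * x) ^ k"
    proof -
      have "(c * x) powr (b + k - 1) = (c * x) powr ((b - 1) + real k)" by (simp add: algebra_simps)
      then show ?thesis using assms by (simp only: powr_add) (simp add: powr_realpow)
    qed
    have 3: "((1 + c * x) / 2) powr (a + b + k) =
        (1 + c * x) powr (a + b) * (1 + c * x) ^ k / (2 powr (b + k) * 2 powr a)"
      using cx by (simp add: powr_divide powr_add powr_realpow mult_ac)
    show ?thesis
      unfolding C_def 1 2 3 F_density_def powr_minus[of _ "a + b"] using pos cx assms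
      by (simp add: F_ratio_arg_def Beta_def power_divide power_mult_distrib divide_simps add_ac)
  qed
  finally show ?thesis .
qed

lemma nn_integral_scale_density:
  fixes q h :: "real \<Rightarrow> ennreal"
  assumes [measurable]: "q \<in> borel_measurable borel" "h \<in> borel_measurable borel" and d: "d > 0"
  shows "(\<integral>\<^sup>+u. h (u / d) * q u \<partial>lborel) = (\<integral>\<^sup>+x. h x * (q (d * x) * ennreal d) \<partial>lborel)"
proof -
  have "(\<integral>\<^sup>+u. h (u / d) * q u \<partial>lborel) = ennreal d * (\<integral>\<^sup>+x. h x * q (d * x) \<partial>lborel)"
    using d by (subst nn_integral_real_affine[where c=d and t=0]) auto
  also have "\<dots> = (\<integral>\<^sup>+x. h x * (q (d * x) * ennreal d) \<partial>lborel)"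
    by (subst nn_integral_cmult[symmetric]) (auto simp: mult_ac)
  finally show ?thesis .
qed

text \<open>For a fixed denominator \<open>v > 0\<close> the numerator is rescaled to
  \<open>u = c * v * x\<close>; after exchanging the integrals, the integral over \<open>v\<close>
  is the density at \<open>x\<close>. Summing the kernels with Poisson weights produces the series
  of \<open>hyp11\<close>.\<close>

lemma noncentral_F_density:
  assumes "p \<ge> 1" "n \<ge> 1" "\<Delta> \<ge> 0"
  shows "noncentral_F p n \<Delta> = density lborel (\<lambda>x. ennreal (F_density (n / 2) (p / 2) (p / n) x *
    (exp (- \<Delta> / 2) * hyp11 (n / 2) (p / 2) (\<Delta> / 2 * F_ratio_arg (p / n) x))))"
proof -
  define a b c z where "a = n / 2" and "b = p / 2" and "c = real p / real n" and "z = \<Delta> / 2"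
  have pos: "a > 0" "b > 0" "c > 0" "z \<ge> 0" using assms by (auto simp: a_def b_def c_def z_def)
  define X Y where "X = density lborel (chi2_mixture z b)" and "Y = density lborel (\<lambda>v. ennreal (chi2_density a v))"
  have X: "noncentral_chi_square p \<Delta> = X"
    using assms by (simp add: noncentral_chi_square_density X_def z_def b_def)
  have Y: "noncentral_chi_square n 0 = Y"
    using assms by (simp add: noncentral_chi_square_density Y_def a_def chi2_mixture_0[abs_def])
  have sets [measurable_cong]: "sets X = sets borel" "sets Y = sets borel" by (simp_all add: X_def Y_def)
  interpret X: prob_space X
    using nn_integral_chi2_mixture[OF pos(4,2)] by (intro prob_spaceI) (simp add: X_def emeasure_density)
  interpret Y: prob_space Y
    using nn_integral_chi2_density[OF pos(1)] by (intro prob_spaceI) (simp add: Y_def emeasure_density)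
  interpret XY: pair_prob_space X Y ..
  have kernel: "(\<integral>\<^sup>+v. (chi2_mixture z b (c * v * x) * ennreal (c * v)) * ennreal (chi2_density a v) \<partial>lborel) =
      ennreal (F_density a b c x * (exp (- z) * hyp11 a b (z * F_ratio_arg c x)))" for x
  proof (cases "x > 0")
    case True
    have y: "F_ratio_arg c x \<ge> 0" using True pos by (simp add: F_ratio_arg_def)
    have Fn: "F_density a b c x \<ge> 0"
      using pos by (simp add: F_density_def Beta_def Gamma_real_pos less_imp_le)
    have "(\<integral>\<^sup>+v. (chi2_mixture z b (c * v * x) * ennreal (c * v)) * ennreal (chi2_density a v) \<partial>lborel) =
      (\<integral>\<^sup>+v. (\<Sum>k. ennreal (poisson_weight z k) * (ennreal (chi2_density (b + k) (c * v * x)) * ennreal (c * v) * ennreal (chi2_density a v))) \<partial>lborel)"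
      by (simp add: chi2_mixture_def mult.assoc flip: ennreal_suminf_multc)
    also have "\<dots> = (\<Sum>k. ennreal (poisson_weight z k) * ennreal (F_density a b c x * (poch_ratio a b k * F_ratio_arg c x ^ k)))"
      using pos True by (subst nn_integral_suminf) (auto simp: nn_integral_cmult nn_integral_F_kernel)
    also have "\<dots> = (\<Sum>k. ennreal (F_density a b c x * exp (- z) * (poch_ratio a b k / fact k * (z * F_ratio_arg c x) ^ k)))"
      using pos by (simp add: poisson_weight_def power_mult_distrib mult_ac flip: ennreal_mult')
    also have "\<dots> = ennreal (F_density a b c x * exp (- z) * hyp11 a b (z * F_ratio_arg c x))"
      using pos Fn y poch_ratio_pos[of a b]
      by (intro suminf_ennreal_eq sums_mult hyp11_sums) (auto simp: less_imp_le)
    finally show ?thesis by (simp add: mult.assoc)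
  next
    case False
    then have zero: "(chi2_mixture z b (c * v * x) * ennreal (c * v)) * ennreal (chi2_density a v) = 0" for v
      using pos by (cases "v > 0") (auto simp: chi2_density_def chi2_mixture_nonpos mult_nonneg_nonpos)
    show ?thesis unfolding zero using False by (simp add: F_density_def)
  qed
  show ?thesis
  proof (rule measure_eqI)
    fix A assume "A \<in> sets (noncentral_F p n \<Delta>)"
    then have [measurable]: "A \<in> sets borel" by (simp add: noncentral_F_def)
    have "emeasure (noncentral_F p n \<Delta>) A =
        (\<integral>\<^sup>+x. indicator A x \<partial>distr (X \<Otimes>\<^sub>M Y) borel (\<lambda>(u, v). (u / real p) / (v / real n)))"
      by (simp add: noncentral_F_def X Y)
    also have "\<dots> = (\<integral>\<^sup>+w. indicator A (fst w / real p / (snd w / real n)) \<partial>(X \<Otimes>\<^sub>M Y))"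
      by (subst nn_integral_distr) (auto simp: case_prod_beta)
    also have "\<dots> = (\<integral>\<^sup>+v. \<integral>\<^sup>+u. indicator A (u / real p / (v / real n)) \<partial>X \<partial>Y)"
      by (subst XY.nn_integral_snd[symmetric]) auto
    also have "\<dots> = (\<integral>\<^sup>+v. ennreal (chi2_density a v) * (\<integral>\<^sup>+u. chi2_mixture z b u * indicator A (u / real p / (v / real n)) \<partial>lborel) \<partial>lborel)"
      unfolding X_def Y_def by (simp add: nn_integral_density)
    also have "\<dots> = (\<integral>\<^sup>+v. ennreal (chi2_density a v) * (\<integral>\<^sup>+x. indicator A x * (chi2_mixture z b (c * v * x) * ennreal (c * v)) \<partial>lborel) \<partial>lborel)"
    proof (intro nn_integral_cong)
      fix v :: real
      show "ennreal (chi2_density a v) * (\<integral>\<^sup>+u. chi2_mixture z b u * indicator A (u / real p / (v / real n)) \<partial>lborel) =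
        ennreal (chi2_density a v) * (\<integral>\<^sup>+x. indicator A x * (chi2_mixture z b (c * v * x) * ennreal (c * v)) \<partial>lborel)"
      proof (cases "v > 0")
        case True
        have "(\<integral>\<^sup>+u. chi2_mixture z b u * indicator A (u / real p / (v / real n)) \<partial>lborel)
            = (\<integral>\<^sup>+u. indicator A (u / (c * v)) * chi2_mixture z b u \<partial>lborel)"
          by (simp add: c_def mult_ac)
        also have "\<dots> = (\<integral>\<^sup>+x. indicator A x * (chi2_mixture z b (c * v * x) * ennreal (c * v)) \<partial>lborel)"
          using True pos by (intro nn_integral_scale_density) auto
        finally show ?thesis by simp
      qed (simp add: chi2_density_def)
    qed
    also have "\<dots> = (\<integral>\<^sup>+v. \<integral>\<^sup>+x. indicator A x * ((chi2_mixture z b (c * v * x) * ennreal (c * v)) * ennreal (chi2_density a v)) \<partial>lborel \<partial>lborel)"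
      by (subst nn_integral_cmult[symmetric]) (auto simp: mult_ac)
    also have "\<dots> = (\<integral>\<^sup>+x. \<integral>\<^sup>+v. indicator A x * ((chi2_mixture z b (c * v * x) * ennreal (c * v)) * ennreal (chi2_density a v)) \<partial>lborel \<partial>lborel)"
      by (rule lborel_pair.Fubini') measurable
    also have "\<dots> = (\<integral>\<^sup>+x. indicator A x * (\<integral>\<^sup>+v. (chi2_mixture z b (c * v * x) * ennreal (c * v)) * ennreal (chi2_density a v) \<partial>lborel) \<partial>lborel)"
      by (intro nn_integral_cong nn_integral_cmult) measurable
    also have "\<dots> = emeasure (density lborel (\<lambda>x. ennreal (F_density a b c x * (exp (- z) * hyp11 a b (z * F_ratio_arg c x))))) A"
      unfolding kernel by (subst emeasure_density) (auto simp: mult.commute)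
    finally show "emeasure (noncentral_F p n \<Delta>) A =
       emeasure (density lborel (\<lambda>x. ennreal (F_density (n / 2) (p / 2) (p / n) x *
         (exp (- \<Delta> / 2) * hyp11 (n / 2) (p / 2) (\<Delta> / 2 * F_ratio_arg (p / n) x))))) A"
      by (simp add: a_def b_def c_def z_def)
  qed (simp add: noncentral_F_def)
qed

subsection \<open>The positive false discovery rate\<close>

abbreviation status_space :: "(bool \<times> real) measure" where
  "status_space \<equiv> count_space UNIV \<Otimes>\<^sub>M borel"

lemma Pair_measurable_status:
  assumes "sets P = sets borel"
  shows "Pair h \<in> measurable P status_space"
proof -
  have "Pair h \<in> measurable borel status_space" by (rule measurable_Pair1') simp
  then show ?thesis by (simp only: measurable_cong_sets[OF assms refl])
qed

lemma status_kernel_measurable: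
  assumes "prob_space P0" "prob_space P1" "sets P0 = sets borel" "sets P1 = sets borel"
  shows "(\<lambda>h. distr (if h then P1 else P0) status_space (Pair h)) \<in>
    measurable (measure_pmf (bernoulli_pmf \<pi>)) (prob_algebra status_space)"
proof -
  have "prob_space (distr (if h then P1 else P0) status_space (Pair h))" for h
    using assms by (intro prob_space.prob_space_distr Pair_measurable_status) auto
  then show ?thesis by (simp add: space_prob_algebra measurable_pmf_measure1)
qed

lemma
  assumes "prob_space P0" "prob_space P1" "sets P0 = sets borel" "sets P1 = sets borel"
  shows sets_status_stat_law: "sets (status_stat_law \<pi> P0 P1) = sets status_space"
    and prob_space_status_stat_law: "prob_space (status_stat_law \<pi> P0 P1)"
proof -
  have K: "(\<lambda>h. distr (if h then P1 else P0) status_space (Pair h)) \<in>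
      measurable (measure_pmf (bernoulli_pmf \<pi>)) (prob_algebra status_space)"
    by (rule status_kernel_measurable[OF assms])
  show "sets (status_stat_law \<pi> P0 P1) = sets status_space"
    unfolding status_stat_law_def by (rule sets_bind) simp_all
  show "prob_space (status_stat_law \<pi> P0 P1)"
    unfolding status_stat_law_def
    by (rule prob_space_bind'[OF _ K]) (simp add: space_prob_algebra prob_space_measure_pmf)
qed

lemma nn_integral_status_stat_law:
  assumes "prob_space P0" "prob_space P1" "sets P0 = sets borel" "sets P1 = sets borel"
    and "0 \<le> \<pi>" "\<pi> \<le> 1" and [measurable]: "f \<in> borel_measurable status_space"
  shows "(\<integral>\<^sup>+y. f y \<partial>status_stat_law \<pi> P0 P1) =
    ennreal \<pi> * (\<integral>\<^sup>+x. f (True, x) \<partial>P1) + ennreal (1 - \<pi>) * (\<integral>\<^sup>+x. f (False, x) \<partial>P0)"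
proof -
  have distr: "(\<integral>\<^sup>+y. f y \<partial>distr P status_space (Pair h)) = (\<integral>\<^sup>+x. f (h, x) \<partial>P)"
    if "sets P = sets borel" for P h
    using assms(7) Pair_measurable_status[OF that] by (subst nn_integral_distr) simp_all
  have "(\<integral>\<^sup>+y. f y \<partial>status_stat_law \<pi> P0 P1) =
      (\<integral>\<^sup>+h. \<integral>\<^sup>+y. f y \<partial>distr (if h then P1 else P0) status_space (Pair h) \<partial>measure_pmf (bernoulli_pmf \<pi>))"
    unfolding status_stat_law_def
    by (rule nn_integral_bind[OF assms(7) measurable_prob_algebraD[OF status_kernel_measurable[OF assms(1-4)]]])
  also have "\<dots> = (\<integral>\<^sup>+y. f y \<partial>distr P1 status_space (Pair True)) * ennreal \<pi> +
      (\<integral>\<^sup>+y. f y \<partial>distr P0 status_space (Pair False)) * ennreal (1 - \<pi>)"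
    using assms(5,6) by (subst nn_integral_bernoulli_pmf) simp_all
  also have "\<dots> = ennreal \<pi> * (\<integral>\<^sup>+x. f (True, x) \<partial>P1) + ennreal (1 - \<pi>) * (\<integral>\<^sup>+x. f (False, x) \<partial>P0)"
    unfolding distr[OF assms(3)] distr[OF assms(4)]
    by (simp only: mult.commute)
  finally show ?thesis .
qed

section \<open>Bounds for the pFDR of arbitrary procedures in a random effects model\<close>

locale random_effects =
  fixes N :: nat and \<pi> :: real and P0 :: "real measure" and P1 :: "nat \<Rightarrow> real measure"
  assumes pi: "0 < \<pi>" "\<pi> < 1"
    and P0: "prob_space P0" "sets P0 = sets borel"
    and P1: "\<And>i. i < N \<Longrightarrow> prob_space (P1 i)" "\<And>i. i < N \<Longrightarrow> sets (P1 i) = sets borel"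
begin

text \<open>The locale constrains \<open>P1 i\<close> only for \<open>i < N\<close>, whereas a
  product of probability spaces needs one at every index; \<open>P0\<close> fills the remaining
  places.\<close>

definition \<mu> :: "nat \<Rightarrow> (bool \<times> real) measure" where
  "\<mu> i = status_stat_law \<pi> P0 (if i < N then P1 i else P0)"

lemma prob_space_\<mu>: "prob_space (\<mu> i)"
  unfolding \<mu>_def using P0 P1 by (intro prob_space_status_stat_law) auto

lemma sets_\<mu> [measurable_cong]: "sets (\<mu> i) = sets status_space"
  unfolding \<mu>_def using P0 P1 by (intro sets_status_stat_law) auto

sublocale product_prob_space \<mu>
  by (simp add: product_prob_space_def product_prob_space_axioms_def product_sigma_finite_def
      prob_space_\<mu> prob_space_imp_sigma_finite)

abbreviation model where "model \<equiv> random_effects_model N \<pi> P0 P1"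

lemma model_eq: "model = PiM {..<N} \<mu>"
  unfolding random_effects_model_def by (intro PiM_cong) (auto simp: \<mu>_def)

lemma prob_space_model: "prob_space model"
  unfolding model_eq by (rule prob_space_PiM) (rule prob_space_\<mu>)

definition stats :: "(nat \<Rightarrow> bool \<times> real) \<Rightarrow> nat \<Rightarrow> real" where
  "stats \<omega> = (\<lambda>j\<in>{..<N}. snd (\<omega> j))"

lemma stats_measurable [measurable]: "stats \<in> measurable (PiM {..<N} \<mu>) (PiM {..<N} (\<lambda>_. borel))"
  unfolding stats_def by measurable

text \<open>Coordinate \<open>i\<close> is integrated out first; the weight does not depend on the status of null \<open>i\<close>.\<close>

lemma nn_integral_null_part:
  assumes [measurable]: "w \<in> borel_measurable (PiM {..<N} (\<lambda>_. borel))" and i: "i < N" and K: "K \<ge> 0"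
    and dom: "\<And>g. g \<in> borel_measurable borel \<Longrightarrow> (\<integral>\<^sup>+x. g x \<partial>P1 i) \<le> ennreal K * (\<integral>\<^sup>+x. g x \<partial>P0)"
  shows "ennreal ((1 - \<pi>) / (1 - \<pi> + \<pi> * K)) * (\<integral>\<^sup>+\<tau>. w (stats \<tau>) \<partial>PiM {..<N} \<mu>)
    \<le> (\<integral>\<^sup>+\<tau>. w (stats \<tau>) * of_bool (\<not> fst (\<tau> i)) \<partial>PiM {..<N} \<mu>)"
proof -
  define I where "I = {..<N} - {i}"
  have I: "finite I" "i \<notin> I" "{..<N} = insert i I" using i by (auto simp: I_def)
  \<comment> \<open>Over coordinate \<open>i\<close>, the domination bounds the whole mass by
    \<open>(1 - \<pi> + \<pi> * K)\<close> times the integral under \<open>P0\<close>, while the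
    part with a true null is \<open>(1 - \<pi>)\<close> times that integral. \<open>\<kappa>\<close>
    is the quotient of the two factors.\<close>
  define \<kappa> where "\<kappa> = (1 - \<pi>) / (1 - \<pi> + \<pi> * K)"
  have den: "1 - \<pi> + \<pi> * K > 0" using pi K by (intro add_pos_nonneg) auto
  have \<kappa>: "\<kappa> \<ge> 0" "\<kappa> * (1 - \<pi> + \<pi> * K) = 1 - \<pi>" using den pi by (simp_all add: \<kappa>_def)
  have [measurable]: "stats \<in> measurable (PiM (insert i I) \<mu>) (PiM {..<N} (\<lambda>_. borel))"
    using stats_measurable I by simp
  have "ennreal \<kappa> * (\<integral>\<^sup>+\<tau>. w (stats \<tau>) \<partial>PiM {..<N} \<mu>) =
      (\<integral>\<^sup>+\<tau>. ennreal \<kappa> * w (stats \<tau>) \<partial>PiM (insert i I) \<mu>)"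
    unfolding I(3) by (subst nn_integral_cmult) (auto simp flip: I(3))
  also have "\<dots> = (\<integral>\<^sup>+\<tau>. \<integral>\<^sup>+y. ennreal \<kappa> * w (stats (\<tau>(i := y))) \<partial>\<mu> i \<partial>PiM I \<mu>)"
    using I by (intro product_nn_integral_insert) auto
  also have "\<dots> \<le> (\<integral>\<^sup>+\<tau>. \<integral>\<^sup>+y. w (stats (\<tau>(i := y))) * of_bool (\<not> fst ((\<tau>(i := y)) i)) \<partial>\<mu> i \<partial>PiM I \<mu>)"
  proof (rule nn_integral_mono)
    fix \<tau> assume \<tau>: "\<tau> \<in> space (PiM I \<mu>)"
    define g where "g x = w (stats (\<tau>(i := (True, x))))" for x
    \<comment> \<open>\<open>stats\<close> forgets the status, so one function \<open>g\<close>
      serves for both values of it.\<close>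
    have g_eq: "w (stats (\<tau>(i := (b, x)))) = g x" for b x
      unfolding g_def stats_def by (intro arg_cong[where f=w] restrict_ext) auto
    have [measurable]: "(\<lambda>y. \<tau>(i := y)) \<in> measurable status_space (PiM (insert i I) \<mu>)"
      using measurable_component_update[OF \<tau> I(2)] by (simp add: measurable_cong_sets[OF sets_\<mu> refl])
    have mw [measurable]: "(\<lambda>y. w (stats (\<tau>(i := y)))) \<in> borel_measurable status_space"
      by measurable
    have [measurable]: "g \<in> borel_measurable borel"
      unfolding g_def by measurable
    have split: "(\<integral>\<^sup>+y. f y \<partial>\<mu> i) =
        ennreal \<pi> * (\<integral>\<^sup>+x. f (True, x) \<partial>P1 i) + ennreal (1 - \<pi>) * (\<integral>\<^sup>+x. f (False, x) \<partial>P0)"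
      if "f \<in> borel_measurable status_space" for f
      unfolding \<mu>_def using nn_integral_status_stat_law[OF P0(1) P1(1)[OF i] P0(2) P1(2)[OF i] _ _ that] pi i by simp
    have mix: "k * (p * (C * G) + q * G) = k * (q + p * C) * G" for k p q C G :: ennreal
      by (simp add: distrib_left distrib_right mult.assoc add.commute)
    have "(\<integral>\<^sup>+y. ennreal \<kappa> * w (stats (\<tau>(i := y))) \<partial>\<mu> i) = ennreal \<kappa> * (\<integral>\<^sup>+y. w (stats (\<tau>(i := y))) \<partial>\<mu> i)"
      by (intro nn_integral_cmult) measurable
    also have "\<dots> = ennreal \<kappa> * (ennreal \<pi> * (\<integral>\<^sup>+x. g x \<partial>P1 i) + ennreal (1 - \<pi>) * (\<integral>\<^sup>+x. g x \<partial>P0))"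
      using split[OF mw] by (simp add: g_eq)
    also have "\<dots> \<le> ennreal \<kappa> * (ennreal \<pi> * (ennreal K * (\<integral>\<^sup>+x. g x \<partial>P0)) + ennreal (1 - \<pi>) * (\<integral>\<^sup>+x. g x \<partial>P0))"
      by (intro mult_left_mono add_right_mono dom) auto
    also have "\<dots> = ennreal (\<kappa> * (1 - \<pi> + \<pi> * K)) * (\<integral>\<^sup>+x. g x \<partial>P0)"
    proof -
      have "ennreal (\<kappa> * (1 - \<pi> + \<pi> * K)) = ennreal \<kappa> * ennreal (1 - \<pi> + \<pi> * K)"
        using \<kappa>(1) den by (intro ennreal_mult) auto
      also have "ennreal (1 - \<pi> + \<pi> * K) = ennreal (1 - \<pi>) + ennreal (\<pi> * K)"
        using pi K by (intro ennreal_plus) auto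
      also have "ennreal (\<pi> * K) = ennreal \<pi> * ennreal K"
        using pi K by (intro ennreal_mult) auto
      finally show ?thesis by (simp only: mix)
    qed
    also have "\<dots> = ennreal (1 - \<pi>) * (\<integral>\<^sup>+x. g x \<partial>P0)"
      by (simp only: \<kappa>)
    also have "\<dots> = (\<integral>\<^sup>+y. w (stats (\<tau>(i := y))) * of_bool (\<not> fst y) \<partial>\<mu> i)"
    proof -
      have "(\<lambda>y. w (stats (\<tau>(i := y))) * of_bool (\<not> fst y)) \<in> borel_measurable status_space"
        by measurable
      from split[OF this] show ?thesis by (simp add: g_eq)
    qed
    finally show "(\<integral>\<^sup>+y. ennreal \<kappa> * w (stats (\<tau>(i := y))) \<partial>\<mu> i) \<le>
        (\<integral>\<^sup>+y. w (stats (\<tau>(i := y))) * of_bool (\<not> fst ((\<tau>(i := y)) i)) \<partial>\<mu> i)" by simp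
  qed
  also have "\<dots> = (\<integral>\<^sup>+\<tau>. w (stats \<tau>) * of_bool (\<not> fst (\<tau> i)) \<partial>PiM (insert i I) \<mu>)"
    using I by (intro product_nn_integral_insert[symmetric]) auto
  finally show ?thesis by (simp add: \<kappa>_def I(3))
qed

context
  fixes d assumes d: "testing_procedure N d"
begin

lemma decision_measurable [measurable]:
  "i < N \<Longrightarrow> Measurable.pred (PiM {..<N} (\<lambda>_. borel)) (\<lambda>x. d x i)"
  using d by (simp add: testing_procedure_def)

lemma num_rejected_eq: "num_rejected N d \<omega> = (\<Sum>i<N. of_bool (d (stats \<omega>) i))"
  by (simp add: num_rejected_def rejected_def stats_def sum_of_bool_eq Int_def lessThan_def)

lemma num_false_rejected_eq:
  "num_false_rejected N d \<omega> = (\<Sum>i<N. of_bool (d (stats \<omega>) i) * of_bool (\<not> fst (\<omega> i)))"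
  by (simp add: num_false_rejected_def rejected_def stats_def sum_of_bool_eq Int_def lessThan_def
      conj_ac flip: of_bool_conj)

lemma num_rejected_measurable [measurable]: "(\<lambda>\<omega>. num_rejected N d \<omega>) \<in> measurable (PiM {..<N} \<mu>) (count_space UNIV)"
  unfolding num_rejected_eq by measurable

lemma num_false_rejected_measurable [measurable]:
  "(\<lambda>\<omega>. num_false_rejected N d \<omega>) \<in> measurable (PiM {..<N} \<mu>) (count_space UNIV)"
  unfolding num_false_rejected_eq by measurable

lemma some_rejection_sets [measurable]: "some_rejection N model d \<in> sets (PiM {..<N} \<mu>)"
  unfolding some_rejection_def model_eq by measurable

text \<open>Off the conditioning event the quotient is 0 / 0, which is 0 here, so conditioning
  amounts to dividing by the probability of the event. The quotient is at most 1, hence integrable,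
  which permits the change to the nonnegative integral.\<close>

lemma ennreal_pFDR:
  assumes "measure model (some_rejection N model d) > 0"
  shows "ennreal (pFDR N model d) =
    (\<integral>\<^sup>+\<omega>. ennreal (real (num_false_rejected N d \<omega>) / real (num_rejected N d \<omega>)) \<partial>PiM {..<N} \<mu>)
      / emeasure model (some_rejection N model d)"
proof -
  interpret RM: prob_space model by (rule prob_space_model)
  let ?A = "some_rejection N model d"
  let ?U = "uniform_measure model ?A"
  let ?f = "\<lambda>\<omega>. real (num_false_rejected N d \<omega>) / real (num_rejected N d \<omega>)"
  have [measurable]: "?f \<in> borel_measurable (PiM {..<N} \<mu>)" by measurable
  have f1: "?f \<omega> \<le> 1" for \<omega>
  proof -
    have "num_false_rejected N d \<omega> \<le> num_rejected N d \<omega>"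
      unfolding num_false_rejected_eq num_rejected_eq by (intro sum_mono) auto
    then show ?thesis by (cases "num_rejected N d \<omega> = 0") (simp_all add: divide_le_eq_1)
  qed
  interpret U: prob_space ?U
    using assms by (intro prob_space_uniform_measure) (auto simp: RM.emeasure_eq_measure)
  have "integrable ?U ?f"
    using f1 by (intro U.integrable_const_bound[where B=1]) (auto simp: model_eq)
  then have "ennreal (pFDR N model d) = (\<integral>\<^sup>+\<omega>. ennreal (?f \<omega>) \<partial>?U)"
    unfolding pFDR_def by (subst nn_integral_eq_integral) auto
  also have "\<dots> = (\<integral>\<^sup>+\<omega>. ennreal (?f \<omega>) * indicator ?A \<omega> \<partial>model) / emeasure model ?A"
    by (intro nn_integral_uniform_measure) (auto simp: model_eq some_rejection_sets[unfolded model_eq])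
  also have "(\<integral>\<^sup>+\<omega>. ennreal (?f \<omega>) * indicator ?A \<omega> \<partial>model) = (\<integral>\<^sup>+\<omega>. ennreal (?f \<omega>) \<partial>model)"
    by (intro nn_integral_cong) (auto simp: some_rejection_def indicator_def)
  finally show ?thesis by (simp add: model_eq)
qed

text \<open>Each rejected null gets the weight 1 / R. The weights depend on the statistics alone,
  sum to the indicator of R > 0, and sum over the true nulls to V / R. The one-coordinate estimate
  therefore applies to every summand, whatever the dependence of the procedure on the other
  statistics.\<close>

lemma pFDR_ge:
  assumes A: "measure model (some_rejection N model d) > 0" and K: "K \<ge> 0"
    and dom: "\<And>i g. i < N \<Longrightarrow> g \<in> borel_measurable borel \<Longrightarrow>
      (\<integral>\<^sup>+x. g x \<partial>P1 i) \<le> ennreal K * (\<integral>\<^sup>+x. g x \<partial>P0)"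
  shows "pFDR N model d \<ge> (1 - \<pi>) / (1 - \<pi> + \<pi> * K)"
proof -
  interpret RM: prob_space model by (rule prob_space_model)
  define \<kappa> where "\<kappa> = (1 - \<pi>) / (1 - \<pi> + \<pi> * K)"
  define w where "w i x = ennreal (of_bool (d x i) / (\<Sum>j<N. of_bool (d x j)))" for i x
  have [measurable]: "w i \<in> borel_measurable (PiM {..<N} (\<lambda>_. borel))" if "i < N" for i
    using that unfolding w_def by measurable
  let ?A = "some_rejection N model d"
  let ?f = "\<lambda>\<omega>. real (num_false_rejected N d \<omega>) / real (num_rejected N d \<omega>)"
  have f: "ennreal (?f \<omega>) = (\<Sum>i<N. w i (stats \<omega>) * of_bool (\<not> fst (\<omega> i)))" for \<omega>
  proof -
    have "?f \<omega> = (\<Sum>i<N. of_bool (d (stats \<omega>) i) / (\<Sum>j<N. of_bool (d (stats \<omega>) j)) * of_bool (\<not> fst (\<omega> i)))"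
      by (simp only: num_false_rejected_eq num_rejected_eq of_nat_sum of_nat_mult of_nat_of_bool
          sum_divide_distrib times_divide_eq_left)
    then have "ennreal (?f \<omega>) = (\<Sum>i<N. ennreal (of_bool (d (stats \<omega>) i) / (\<Sum>j<N. of_bool (d (stats \<omega>) j)) * of_bool (\<not> fst (\<omega> i))))"
      by (simp add: sum_nonneg)
    also have "\<dots> = (\<Sum>i<N. w i (stats \<omega>) * of_bool (\<not> fst (\<omega> i)))"
      by (intro sum.cong refl) (auto simp: w_def)
    finally show ?thesis .
  qed
  have ind: "(\<Sum>i<N. w i (stats \<omega>)) = indicator ?A \<omega>" if "\<omega> \<in> space model" for \<omega>
  proof -
    have "(\<Sum>i<N. w i (stats \<omega>)) = ennreal (\<Sum>i<N. of_bool (d (stats \<omega>) i) / (\<Sum>j<N. of_bool (d (stats \<omega>) j)))"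
      unfolding w_def by (intro sum_ennreal) (auto simp: sum_nonneg)
    also have "\<dots> = ennreal (real (num_rejected N d \<omega>) / real (num_rejected N d \<omega>))"
      by (simp only: num_rejected_eq of_nat_sum of_nat_of_bool sum_divide_distrib)
    also have "\<dots> = indicator ?A \<omega>"
      using that by (auto simp: some_rejection_def indicator_def)
    finally show ?thesis .
  qed
  have "ennreal \<kappa> * emeasure model ?A = ennreal \<kappa> * (\<integral>\<^sup>+\<omega>. (\<Sum>i<N. w i (stats \<omega>)) \<partial>model)"
    using some_rejection_sets by (subst nn_integral_cong[OF ind]) (simp_all add: model_eq)
  also have "\<dots> = (\<Sum>i<N. ennreal \<kappa> * (\<integral>\<^sup>+\<omega>. w i (stats \<omega>) \<partial>PiM {..<N} \<mu>))"
    unfolding model_eq by (subst nn_integral_sum) (auto simp: sum_distrib_left)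
  also have "\<dots> \<le> (\<Sum>i<N. (\<integral>\<^sup>+\<omega>. w i (stats \<omega>) * of_bool (\<not> fst (\<omega> i)) \<partial>PiM {..<N} \<mu>))"
  proof (rule sum_mono)
    fix i assume "i \<in> {..<N}"
    then have i: "i < N" by simp
    show "ennreal \<kappa> * (\<integral>\<^sup>+\<omega>. w i (stats \<omega>) \<partial>PiM {..<N} \<mu>) \<le>
        (\<integral>\<^sup>+\<omega>. w i (stats \<omega>) * of_bool (\<not> fst (\<omega> i)) \<partial>PiM {..<N} \<mu>)"
      unfolding \<kappa>_def by (rule nn_integral_null_part[OF _ i K dom[OF i]]) (use i in measurable)
  qed
  also have "\<dots> = (\<integral>\<^sup>+\<omega>. ennreal (?f \<omega>) \<partial>PiM {..<N} \<mu>)"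
    unfolding f by (subst nn_integral_sum) auto
  finally have le: "ennreal \<kappa> * emeasure model ?A / emeasure model ?A \<le> ennreal (pFDR N model d)"
    unfolding ennreal_pFDR[OF A] by (intro divide_right_mono_ennreal)
  have "\<kappa> \<ge> 0" using pi K by (simp add: \<kappa>_def)
  then have "ennreal \<kappa> * emeasure model ?A / emeasure model ?A = ennreal \<kappa>"
    using A by (simp add: RM.emeasure_eq_measure divide_ennreal flip: ennreal_mult)
  with le have "ennreal \<kappa> \<le> ennreal (pFDR N model d)" by simp
  moreover have "pFDR N model d \<ge> 0" unfolding pFDR_def by (intro Bochner_Integration.integral_nonneg) auto
  ultimately show ?thesis by (simp add: \<kappa>_def)
qed

end

text \<open>Only null 0 can be rejected, so R is 0 or 1 and the pFDR is the conditional probability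
  that null 0 is true given that its statistic exceeds \<open>c\<close>. Bayes' formula evaluates it
  from the two tail probabilities.\<close>

lemma pFDR_threshold:
  assumes N: "N \<ge> 1" and t: "measure P0 {c<..} > 0" and h: "h \<ge> 0"
    and ratio: "measure (P1 0) {c<..} \<ge> h * measure P0 {c<..}"
  shows "\<exists>d. testing_procedure N d \<and> measure model (some_rejection N model d) > 0 \<and>
    pFDR N model d \<le> (1 - \<pi>) / (1 - \<pi> + \<pi> * h)"
proof -
  interpret RM: prob_space model by (rule prob_space_model)
  interpret P0: prob_space P0 by (rule P0)
  interpret P1: prob_space "P1 0" using N by (intro P1) auto
  define d where "d x i \<longleftrightarrow> i = 0 \<and> x 0 > c" for x :: "nat \<Rightarrow> real" and i :: nat
  have d: "testing_procedure N d"
    unfolding testing_procedure_def d_def using N by auto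
  let ?A = "some_rejection N model d"
  define p0 p1 where "p0 = measure P0 {c<..}" and "p1 = measure (P1 0) {c<..}"
  have comp: "(\<integral>\<^sup>+\<omega>. f (\<omega> 0) \<partial>PiM {..<N} \<mu>) =
      ennreal \<pi> * (\<integral>\<^sup>+x. f (True, x) \<partial>P1 0) + ennreal (1 - \<pi>) * (\<integral>\<^sup>+x. f (False, x) \<partial>P0)"
    if [measurable]: "f \<in> borel_measurable status_space" for f
  proof -
    have "(\<integral>\<^sup>+\<omega>. f (\<omega> 0) \<partial>PiM {..<N} \<mu>) = (\<integral>\<^sup>+y. f y \<partial>distr (PiM {..<N} \<mu>) (\<mu> 0) (\<lambda>\<omega>. \<omega> 0))"
      using N by (subst nn_integral_distr) auto
    also have "distr (PiM {..<N} \<mu>) (\<mu> 0) (\<lambda>\<omega>. \<omega> 0) = \<mu> 0"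
      using N by (intro distr_PiM_component prob_space_\<mu>) auto
    also have "(\<integral>\<^sup>+y. f y \<partial>\<mu> 0) =
        ennreal \<pi> * (\<integral>\<^sup>+x. f (True, x) \<partial>P1 0) + ennreal (1 - \<pi>) * (\<integral>\<^sup>+x. f (False, x) \<partial>P0)"
      unfolding \<mu>_def using nn_integral_status_stat_law[OF P0(1) P1(1) P0(2) P1(2) _ _ that, of 0] pi N by simp
    finally show ?thesis .
  qed
  have stats0: "stats \<omega> 0 = snd (\<omega> 0)" for \<omega> using N by (simp add: stats_def)
  have sum0: "(\<Sum>i<N. F i) = F 0" if "\<And>i. i \<noteq> 0 \<Longrightarrow> F i = 0" for F :: "nat \<Rightarrow> nat"
    using N that by (subst sum.mono_neutral_right[of _ "{0}"]) auto
  have R: "num_rejected N d \<omega> = of_bool (snd (\<omega> 0) > c)" for \<omega>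
    unfolding num_rejected_eq[OF d] by (subst sum0) (auto simp: d_def stats0)
  have V: "num_false_rejected N d \<omega> = of_bool (snd (\<omega> 0) > c) * of_bool (\<not> fst (\<omega> 0))" for \<omega>
    unfolding num_false_rejected_eq[OF d] by (subst sum0) (auto simp: d_def stats0)
  have [measurable]: "{c<..} \<in> sets P0" "{c<..} \<in> sets (P1 0)" using P0 P1 N by auto
  have tail: "(\<integral>\<^sup>+x. of_bool (x > c) \<partial>P) = emeasure P {c<..}" if "{c<..} \<in> sets P" for P :: "real measure"
  proof -
    have "(\<integral>\<^sup>+x. of_bool (x > c) \<partial>P) = (\<integral>\<^sup>+x. indicator {c<..} x \<partial>P)"
      by (intro nn_integral_cong) (simp add: indicator_def)
    then show ?thesis using that by simp
  qed
  have "emeasure model ?A = (\<integral>\<^sup>+\<omega>. indicator ?A \<omega> \<partial>model)"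
    using some_rejection_sets[OF d] by (simp add: model_eq)
  also have "\<dots> = (\<integral>\<^sup>+\<omega>. of_bool (snd (\<omega> 0) > c) \<partial>PiM {..<N} \<mu>)"
    unfolding model_eq[symmetric] by (intro nn_integral_cong) (auto simp: some_rejection_def R indicator_def)
  also have "\<dots> = ennreal \<pi> * emeasure (P1 0) {c<..} + ennreal (1 - \<pi>) * emeasure P0 {c<..}"
    by (subst comp[of "\<lambda>y. of_bool (snd y > c)"]) (simp_all add: tail)
  also have "\<dots> = ennreal (\<pi> * p1 + (1 - \<pi>) * p0)"
    using pi by (simp add: P0.emeasure_eq_measure P1.emeasure_eq_measure p0_def p1_def ennreal_mult ennreal_plus)
  finally have A: "emeasure model ?A = ennreal (\<pi> * p1 + (1 - \<pi>) * p0)" .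
  have "(\<integral>\<^sup>+\<omega>. ennreal (real (num_false_rejected N d \<omega>) / real (num_rejected N d \<omega>)) \<partial>PiM {..<N} \<mu>) =
      (\<integral>\<^sup>+\<omega>. of_bool (snd (\<omega> 0) > c) * of_bool (\<not> fst (\<omega> 0)) \<partial>PiM {..<N} \<mu>)"
    by (intro nn_integral_cong) (simp add: R V)
  also have "\<dots> = ennreal (1 - \<pi>) * emeasure P0 {c<..}"
    by (subst comp[of "\<lambda>y. of_bool (snd y > c) * of_bool (\<not> fst y)"]) (simp_all add: tail)
  also have "\<dots> = ennreal ((1 - \<pi>) * p0)"
    using pi by (simp add: P0.emeasure_eq_measure p0_def ennreal_mult)
  finally have int: "(\<integral>\<^sup>+\<omega>. ennreal (real (num_false_rejected N d \<omega>) / real (num_rejected N d \<omega>)) \<partial>PiM {..<N} \<mu>) =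
      ennreal ((1 - \<pi>) * p0)" .
  have p: "p0 > 0" "p1 \<ge> h * p0" "p1 \<ge> 0" using t ratio by (auto simp: p0_def p1_def)
  have den: "\<pi> * p1 + (1 - \<pi>) * p0 > 0" using p pi by (intro add_nonneg_pos) auto
  have pos: "measure model ?A > 0"
    using A den by (simp add: RM.emeasure_eq_measure)
  have "ennreal (pFDR N model d) = ennreal ((1 - \<pi>) * p0 / (\<pi> * p1 + (1 - \<pi>) * p0))"
    unfolding ennreal_pFDR[OF d pos] A int using den p pi by (intro divide_ennreal) auto
  also have "\<dots> \<le> ennreal ((1 - \<pi>) / (1 - \<pi> + \<pi> * h))"
  proof (rule ennreal_leI)
    have "(1 - \<pi>) * p0 / (\<pi> * p1 + (1 - \<pi>) * p0) \<le> (1 - \<pi>) * p0 / ((1 - \<pi> + \<pi> * h) * p0)"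
    proof (rule divide_left_mono)
      have "\<pi> * (h * p0) \<le> \<pi> * p1" using p pi by (intro mult_left_mono) auto
      then show "(1 - \<pi> + \<pi> * h) * p0 \<le> \<pi> * p1 + (1 - \<pi>) * p0" by (simp add: algebra_simps)
      have "1 - \<pi> + \<pi> * h > 0" using pi h by (intro add_pos_nonneg) auto
      then show "0 < (\<pi> * p1 + (1 - \<pi>) * p0) * ((1 - \<pi> + \<pi> * h) * p0)" using den p by simp
    qed (use p pi in auto)
    then show "(1 - \<pi>) * p0 / (\<pi> * p1 + (1 - \<pi>) * p0) \<le> (1 - \<pi>) / (1 - \<pi> + \<pi> * h)"
      using p by simp
  qed
  finally have "pFDR N model d \<le> (1 - \<pi>) / (1 - \<pi> + \<pi> * h)"
    using pi h by (subst (asm) ennreal_le_iff) auto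
  then show ?thesis using d pos by blast
qed

text \<open>Ensures that the infimum in \<open>min_pFDR\<close> is over a nonempty set; without
  this, lower bounds for its members would not carry over to \<open>Inf\<close>.\<close>

lemma some_rejection_possible:
  assumes "N \<ge> 1"
  shows "\<exists>d. testing_procedure N d \<and> measure model (some_rejection N model d) > 0"
proof (intro exI conjI)
  interpret RM: prob_space model by (rule prob_space_model)
  show "testing_procedure N (\<lambda>x i. True)" by (simp add: testing_procedure_def)
  have "some_rejection N model (\<lambda>x i. True) = space model"
    using assms by (auto simp: some_rejection_def num_rejected_def rejected_def)
  then show "measure model (some_rejection N model (\<lambda>x i. True)) > 0" by (simp add: RM.prob_space)
qed

lemma min_pFDR_ge:
  assumes N: "N \<ge> 1" and K: "K \<ge> 0"
    and dom: "\<And>i g. i < N \<Longrightarrow> g \<in> borel_measurable borel \<Longrightarrow>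
      (\<integral>\<^sup>+x. g x \<partial>P1 i) \<le> ennreal K * (\<integral>\<^sup>+x. g x \<partial>P0)"
  shows "min_pFDR N model \<ge> (1 - \<pi>) / (1 - \<pi> + \<pi> * K)"
  unfolding min_pFDR_def
proof (rule cInf_greatest)
  show "{pFDR N model d | d. testing_procedure N d \<and> measure model (some_rejection N model d) > 0} \<noteq> {}"
    using some_rejection_possible[OF N] by auto
next
  fix y assume "y \<in> {pFDR N model d | d. testing_procedure N d \<and> measure model (some_rejection N model d) > 0}"
  then obtain d where "y = pFDR N model d" "testing_procedure N d" "measure model (some_rejection N model d) > 0"
    by blast
  then show "(1 - \<pi>) / (1 - \<pi> + \<pi> * K) \<le> y"
    using pFDR_ge[OF _ _ K dom] by blast
qed

lemma min_pFDR_le: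
  assumes N: "N \<ge> 1" and h: "h \<ge> 0" and t: "measure P0 {c<..} > 0"
    and ratio: "measure (P1 0) {c<..} \<ge> h * measure P0 {c<..}"
  shows "min_pFDR N model \<le> (1 - \<pi>) / (1 - \<pi> + \<pi> * h)"
proof -
  obtain d where d: "testing_procedure N d" "measure model (some_rejection N model d) > 0"
    and le: "pFDR N model d \<le> (1 - \<pi>) / (1 - \<pi> + \<pi> * h)"
    using pFDR_threshold[OF N t h ratio] by blast
  have "bdd_below {pFDR N model d | d. testing_procedure N d \<and> measure model (some_rejection N model d) > 0}"
    by (intro bdd_belowI[of _ 0]) (auto simp: pFDR_def intro!: Bochner_Integration.integral_nonneg)
  then have "min_pFDR N model \<le> pFDR N model d"
    unfolding min_pFDR_def by (rule cInf_lower[rotated]) (use d in auto)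
  with le show ?thesis by simp
qed

end

subsection \<open>Reduction to the supremum of the likelihood ratio\<close>

lemma prob_space_noncentral_chi_square: "prob_space (noncentral_chi_square p \<Delta>)"
  unfolding noncentral_chi_square_def
proof (rule prob_space.prob_space_distr)
  show "prob_space (PiM {..<p} (\<lambda>_. density lborel std_normal_density))"
    by (intro prob_space_PiM prob_space_normal_density) simp
qed measurable

lemma sets_noncentral_chi_square [measurable_cong, simp]: "sets (noncentral_chi_square p \<Delta>) = sets borel"
  by (simp add: noncentral_chi_square_def)

lemma sets_noncentral_F [simp]: "sets (noncentral_F p n \<Delta>) = sets borel"
  by (simp add: noncentral_F_def)

lemma prob_space_noncentral_F: "prob_space (noncentral_F p n \<Delta>)"
proof -
  interpret X: prob_space "noncentral_chi_square p \<Delta>" by (rule prob_space_noncentral_chi_square)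
  interpret Y: prob_space "noncentral_chi_square n 0" by (rule prob_space_noncentral_chi_square)
  interpret XY: pair_prob_space "noncentral_chi_square p \<Delta>" "noncentral_chi_square n 0" ..
  show ?thesis
    unfolding noncentral_F_def by (rule XY.prob_space_distr) measurable
qed

definition F_likelihood_ratio :: "nat \<Rightarrow> nat \<Rightarrow> real \<Rightarrow> real \<Rightarrow> real" where
  "F_likelihood_ratio p n \<Delta> x = exp (- \<Delta> / 2) * hyp11 (n / 2) (p / 2) (\<Delta> / 2 * F_ratio_arg (p / n) x)"

lemma F_likelihood_ratio_measurable [measurable]: "F_likelihood_ratio p n \<Delta> \<in> borel_measurable borel"
  unfolding F_likelihood_ratio_def by measurable

lemma central_F_density:
  assumes "p \<ge> 1" "n \<ge> 1"
  shows "noncentral_F p n 0 = density lborel (\<lambda>x. ennreal (F_density (n / 2) (p / 2) (p / n) x))"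
proof -
  have "hyp11 (n / 2) (p / 2) 0 = 1" using max_lr_0[of "n / 2" "p / 2"] by (simp add: max_lr_def)
  then show ?thesis using noncentral_F_density[OF assms order_refl] by simp
qed

lemma F_density_nonneg: "a > 0 \<Longrightarrow> b > 0 \<Longrightarrow> c > 0 \<Longrightarrow> F_density a b c x \<ge> 0"
  by (simp add: F_density_def Beta_def Gamma_real_pos less_imp_le)

lemma F_density_pos: "a > 0 \<Longrightarrow> b > 0 \<Longrightarrow> c > 0 \<Longrightarrow> x > 0 \<Longrightarrow> F_density a b c x > 0"
  using add_pos_pos[of 1 "c * x"] by (auto simp: F_density_def Beta_def Gamma_real_pos)

lemma F_ratio_arg_bounds:
  assumes "c > 0" "x > 0"
  shows "0 \<le> F_ratio_arg c x" "F_ratio_arg c x \<le> 1"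
  using assms by (auto simp: F_ratio_arg_def divide_le_eq_1 add_pos_pos)

lemma F_ratio_arg_mono:
  assumes "c > 0" "0 < x" "x \<le> y"
  shows "F_ratio_arg c x \<le> F_ratio_arg c y"
proof -
  have "1 + c * x > 0" "1 + c * y > 0" "c * x \<le> c * y"
    using assms by (auto intro!: add_pos_pos)
  then show ?thesis by (simp add: F_ratio_arg_def divide_simps) (simp add: algebra_simps)
qed

lemma noncentral_F_eq_density:
  assumes "p \<ge> 1" "n \<ge> 1" "\<Delta> \<ge> 0"
  shows "noncentral_F p n \<Delta> = density (noncentral_F p n 0) (\<lambda>x. ennreal (F_likelihood_ratio p n \<Delta> x))"
  unfolding noncentral_F_density[OF assms] central_F_density[OF assms(1,2)]
  using assms by (subst density_density_eq)
    (auto simp: F_likelihood_ratio_def F_density_nonneg ennreal_mult' intro!: arg_cong[where f="density lborel"] ext)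

lemma F_likelihood_ratio_le:
  assumes "p \<ge> 1" "n \<ge> 1" "\<Delta> \<ge> 0" "x > 0"
  shows "F_likelihood_ratio p n \<Delta> x \<le> max_lr (n / 2) (p / 2) (\<Delta> / 2)"
proof -
  have y: "0 \<le> F_ratio_arg (p / n) x" "F_ratio_arg (p / n) x \<le> 1"
    using assms by (auto intro!: F_ratio_arg_bounds)
  have "hyp11 (n / 2) (p / 2) (\<Delta> / 2 * F_ratio_arg (p / n) x) \<le> hyp11 (n / 2) (p / 2) (\<Delta> / 2)"
    using assms y by (intro hyp11_mono) (auto intro!: mult_left_le)
  then show ?thesis by (simp add: F_likelihood_ratio_def max_lr_def)
qed

lemma noncentral_F_dominated:
  assumes "p \<ge> 1" "n \<ge> 1" "\<Delta> \<ge> 0" and [measurable]: "g \<in> borel_measurable borel"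
  shows "(\<integral>\<^sup>+x. g x \<partial>noncentral_F p n \<Delta>)
    \<le> ennreal (max_lr (n / 2) (p / 2) (\<Delta> / 2)) * (\<integral>\<^sup>+x. g x \<partial>noncentral_F p n 0)"
proof -
  let ?K = "max_lr (n / 2) (p / 2) (\<Delta> / 2)"
  let ?f = "\<lambda>x. F_density (n / 2) (p / 2) (p / n) x"
  have [measurable_cong]: "sets (noncentral_F p n 0) = sets borel" by simp
  have "(\<integral>\<^sup>+x. g x \<partial>noncentral_F p n \<Delta>) =
      (\<integral>\<^sup>+x. ennreal (F_likelihood_ratio p n \<Delta> x) * g x \<partial>noncentral_F p n 0)"
    unfolding noncentral_F_eq_density[OF assms(1-3)] by (rule nn_integral_density) measurable
  also have "\<dots> = (\<integral>\<^sup>+x. ennreal (?f x) * (ennreal (F_likelihood_ratio p n \<Delta> x) * g x) \<partial>lborel)"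
    unfolding central_F_density[OF assms(1,2)] by (rule nn_integral_density) measurable
  also have "\<dots> \<le> (\<integral>\<^sup>+x. ennreal (?f x) * (ennreal ?K * g x) \<partial>lborel)"
  proof (intro nn_integral_mono)
    fix x
    show "ennreal (?f x) * (ennreal (F_likelihood_ratio p n \<Delta> x) * g x) \<le> ennreal (?f x) * (ennreal ?K * g x)"
    proof (cases "x > 0")
      case True
      then show ?thesis
        using F_likelihood_ratio_le[OF assms(1-3)]
        by (intro mult_left_mono mult_right_mono ennreal_leI) auto
    qed (simp add: F_density_def)
  qed
  also have "\<dots> = (\<integral>\<^sup>+x. ennreal ?K * g x \<partial>noncentral_F p n 0)"
    unfolding central_F_density[OF assms(1,2)] by (rule nn_integral_density[symmetric]) measurable
  also have "\<dots> = ennreal ?K * (\<integral>\<^sup>+x. g x \<partial>noncentral_F p n 0)"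
    by (rule nn_integral_cmult) measurable
  finally show ?thesis .
qed

lemma central_F_tail_pos:
  assumes "p \<ge> 1" "n \<ge> 1" "c > 0"
  shows "measure (noncentral_F p n 0) {c<..} > 0"
proof -
  interpret prob_space "noncentral_F p n 0" by (rule prob_space_noncentral_F)
  let ?f = "\<lambda>x. F_density (n / 2) (p / 2) (p / n) x"
  have "emeasure (noncentral_F p n 0) {c<..} \<noteq> 0"
  proof
    assume "emeasure (noncentral_F p n 0) {c<..} = 0"
    then have "(\<integral>\<^sup>+x. ennreal (?f x) * indicator {c<..} x \<partial>lborel) = 0"
      unfolding central_F_density[OF assms(1,2)] by (simp add: emeasure_density)
    then have "AE x in lborel. ennreal (?f x) * indicator {c<..} x = 0"
      by (subst (asm) nn_integral_0_iff_AE) auto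
    then have "AE x in lborel. x \<notin> {c<..<c+1}"
    proof (rule AE_mp, intro AE_I2 impI notI)
      fix x assume *: "ennreal (?f x) * indicator {c<..} x = 0" "x \<in> {c<..<c+1}"
      then have "?f x > 0" using assms by (intro F_density_pos) auto
      then show False using * by (auto simp: indicator_def)
    qed
    then have "emeasure lborel {c<..<c+1} = 0"
      by (subst (asm) AE_iff_measurable[OF _ refl]) (auto simp: greaterThanLessThan_def greaterThan_def lessThan_def Int_def)
    then show False by simp
  qed
  then show ?thesis by (simp add: emeasure_eq_measure zero_less_measure_iff)
qed

text \<open>The likelihood ratio increases on the positive axis, so on the tail beyond
  \<open>c\<close> it is at least its value at \<open>c\<close>.\<close>

lemma noncentral_F_tail_ratio:
  assumes "p \<ge> 1" "n \<ge> 1" "\<Delta> \<ge> 0" "c > 0"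
  shows "measure (noncentral_F p n \<Delta>) {c<..} \<ge> F_likelihood_ratio p n \<Delta> c * measure (noncentral_F p n 0) {c<..}"
proof -
  interpret P0: prob_space "noncentral_F p n 0" by (rule prob_space_noncentral_F)
  interpret P1: prob_space "noncentral_F p n \<Delta>" by (rule prob_space_noncentral_F)
  have [measurable_cong]: "sets (noncentral_F p n 0) = sets borel" by simp
  let ?h = "F_likelihood_ratio p n \<Delta>"
  have y: "0 \<le> F_ratio_arg (p / n) c" using assms by (auto intro!: F_ratio_arg_bounds)
  have h0: "?h c \<ge> 0"
    using assms y hyp11_ge_1[of "n / 2" "p / 2" "\<Delta> / 2 * F_ratio_arg (p / n) c"]
    by (simp add: F_likelihood_ratio_def)
  have "ennreal (?h c) * emeasure (noncentral_F p n 0) {c<..} =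
      (\<integral>\<^sup>+x. ennreal (?h c) * indicator {c<..} x \<partial>noncentral_F p n 0)"
    by (subst nn_integral_cmult_indicator) auto
  also have "\<dots> \<le> (\<integral>\<^sup>+x. ennreal (?h x) * indicator {c<..} x \<partial>noncentral_F p n 0)"
  proof (intro nn_integral_mono)
    fix x
    show "ennreal (?h c) * indicator {c<..} x \<le> ennreal (?h x) * indicator {c<..} x"
    proof (cases "x > c")
      case True
      have "F_ratio_arg (p / n) c \<le> F_ratio_arg (p / n) x" using assms True by (intro F_ratio_arg_mono) auto
      then have "?h c \<le> ?h x"
        unfolding F_likelihood_ratio_def using assms y by (intro mult_left_mono hyp11_mono) auto
      then show ?thesis by (intro mult_right_mono ennreal_leI) auto
    qed simp
  qed
  also have "\<dots> = emeasure (noncentral_F p n \<Delta>) {c<..}"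
    unfolding noncentral_F_eq_density[OF assms(1-3)] by (rule emeasure_density[symmetric]) auto
  finally show ?thesis
    using h0 by (simp add: P0.emeasure_eq_measure P1.emeasure_eq_measure flip: ennreal_mult)
qed

lemma F_likelihood_ratio_tendsto:
  assumes "p \<ge> 1" "n \<ge> 1"
  shows "(F_likelihood_ratio p n \<Delta> \<longlongrightarrow> max_lr (n / 2) (p / 2) (\<Delta> / 2)) at_top"
proof -
  have "((\<lambda>x. c * x / (1 + c * x)) \<longlongrightarrow> 1) at_top" if "c > 0" for c :: real
    using that by real_asymp
  from this[of "real p / real n"] have "((\<lambda>x. F_ratio_arg (p / n) x) \<longlongrightarrow> 1) at_top"
    unfolding F_ratio_arg_def using assms by simp
  then have "((\<lambda>x. \<Delta> / 2 * F_ratio_arg (p / n) x) \<longlongrightarrow> \<Delta> / 2 * 1) at_top"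
    by (intro tendsto_intros)
  moreover have "isCont (hyp11 (n / 2) (p / 2)) (\<Delta> / 2 * 1)"
    using hyp11_deriv[of "n / 2" "p / 2"] assms by (intro DERIV_isCont) auto
  ultimately have "((\<lambda>x. hyp11 (n / 2) (p / 2) (\<Delta> / 2 * F_ratio_arg (p / n) x)) \<longlongrightarrow> hyp11 (n / 2) (p / 2) (\<Delta> / 2 * 1)) at_top"
    by (rule isCont_tendsto_compose[rotated])
  then have "((\<lambda>x. hyp11 (n / 2) (p / 2) (\<Delta> / 2 * F_ratio_arg (p / n) x)) \<longlongrightarrow> hyp11 (n / 2) (p / 2) (\<Delta> / 2)) at_top"
    by (simp only: mult_1_right)
  from tendsto_mult_left[OF this, of "exp (- \<Delta> / 2)"] show ?thesis
    unfolding F_likelihood_ratio_def[abs_def] max_lr_def by simp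
qed

text \<open>The supremum of the likelihood ratio when the effect constraint holds with equality.\<close>

definition F_max_lr :: "nat \<Rightarrow> nat \<Rightarrow> real \<Rightarrow> real" where
  "F_max_lr p n \<delta> = max_lr (n / 2) (p / 2) (real (n + p) * \<delta>\<^sup>2 / 2)"

lemma noncentrality_bounds:
  assumes "effect_constraint p \<delta> X \<beta> \<sigma>" "\<sigma> > 0" "n \<ge> 1"
  shows "0 \<le> noncentrality p n X \<beta> \<sigma>" "noncentrality p n X \<beta> \<sigma> \<le> real (n + p) * \<delta>\<^sup>2"
proof -
  have "(\<Sum>l=1..n + p. (inner_upto p \<beta> (X l))\<^sup>2) / (real (n + p) * \<sigma>\<^sup>2) \<le> \<delta>\<^sup>2"
    using assms unfolding effect_constraint_def by (elim allE[of _ "n + p"]) simp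
  moreover have "real (n + p) * \<sigma>\<^sup>2 > 0" "\<sigma>\<^sup>2 > 0" using assms by auto
  ultimately show "noncentrality p n X \<beta> \<sigma> \<le> real (n + p) * \<delta>\<^sup>2"
    by (simp only: noncentrality_def pos_divide_le_eq mult_ac)
  show "0 \<le> noncentrality p n X \<beta> \<sigma>"
    by (simp add: noncentrality_def sum_nonneg)
qed

text \<open>The first covariate is the constant 1 and the effects use only this one. Every
  regression mean is then \<delta>, so with unit variance the constraint holds with equality for
  every \<open>k\<close>. Unit vectors in the other coordinates provide full rank.\<close>

lemma extremal_design:
  assumes "p \<ge> 1" "n \<ge> 1" "\<delta> > 0"
  shows "\<exists>X \<beta>. admissible N p n \<delta> X \<beta> (\<lambda>_. 1) \<and> (\<forall>i. noncentrality p n X (\<beta> i) 1 = real (n + p) * \<delta>\<^sup>2)"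
proof -
  define X :: "nat \<Rightarrow> nat \<Rightarrow> real" where "X = (\<lambda>k j. if j = 0 then 1 else of_bool (k = j))"
  define \<beta> :: "nat \<Rightarrow> nat \<Rightarrow> real" where "\<beta> = (\<lambda>_ j. if j = 0 then \<delta> else 0)"
  have inner: "inner_upto p (\<beta> i) (X k) = \<delta>" for i k
  proof -
    have "inner_upto p (\<beta> i) (X k) = (\<Sum>j\<in>{0}. \<beta> i j * X k j)"
      unfolding inner_upto_def using assms(1) by (intro sum.mono_neutral_right) (auto simp: \<beta>_def)
    then show ?thesis by (simp add: \<beta>_def X_def)
  qed
  have "full_rank_design p (n + p) X"
    unfolding full_rank_design_def
  proof (intro allI impI)
    fix v j
    assume v: "\<forall>k\<in>{1..n + p}. inner_upto p v (X k) = 0" and j: "j < p"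
    have eval: "inner_upto p v (X k) = v 0 + (if k < p then v k else 0)" if "k \<ge> 1" for k
    proof -
      have "inner_upto p v (X k) = (\<Sum>j\<in>insert 0 {1..<p}. v j * X k j)"
        unfolding inner_upto_def using assms(1) by (intro sum.cong) auto
      also have "\<dots> = v 0 + (\<Sum>j\<in>{1..<p}. if j = k then v j else 0)"
        by (subst sum.insert) (auto simp: X_def intro!: sum.cong)
      finally show ?thesis using that by (simp add: sum.delta)
    qed
    \<comment> \<open>\<open>X p\<close> has only the constant covariate, which isolates
      \<open>v 0\<close>; each \<open>X j\<close> with \<open>1 \<le> j < p\<close> then isolates
      \<open>v j\<close>.\<close>
    have "inner_upto p v (X p) = 0" using v assms by auto
    then have v0: "v 0 = 0" using eval[of p] assms by simp
    show "v j = 0"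
    proof (cases "j = 0")
      case False
      then have "inner_upto p v (X j) = 0" using v j by auto
      then show ?thesis using eval[of j] v0 j False by simp
    qed (simp add: v0)
  qed
  moreover have "\<exists>j<p. \<beta> i j \<noteq> 0" for i
    using assms(1,3) by (intro exI[of _ 0]) (simp add: \<beta>_def)
  moreover have "effect_constraint p \<delta> X (\<beta> i) 1" for i
    by (simp add: effect_constraint_def inner)
  ultimately have "admissible N p n \<delta> X \<beta> (\<lambda>_. 1)"
    by (simp add: admissible_def)
  moreover have "noncentrality p n X (\<beta> i) 1 = (n + p) * \<delta>\<^sup>2" for i
    by (simp add: noncentrality_def inner)
  ultimately show ?thesis by (intro exI[of _ X] exI[of _ \<beta>]) simp
qed

context
  fixes \<alpha> \<pi> :: real and N :: nat
  assumes \<alpha>: "0 < \<alpha>" "\<alpha> < 1" and \<pi>: "0 < \<pi>" "\<pi> < 1" and N: "N \<ge> 1"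
begin

lemma pFDR_bound_le_iff:
  assumes "K \<ge> 0"
  shows "(1 - \<pi>) / (1 - \<pi> + \<pi> * K) \<le> \<alpha> \<longleftrightarrow> Q_ratio \<alpha> \<pi> \<le> K"
proof -
  have "1 - \<pi> + \<pi> * K > 0" using \<pi> assms by (intro add_pos_nonneg) auto
  then have "(1 - \<pi>) / (1 - \<pi> + \<pi> * K) \<le> \<alpha> \<longleftrightarrow> 1 - \<pi> \<le> \<alpha> * (1 - \<pi> + \<pi> * K)"
    by (simp add: divide_le_eq)
  also have "\<dots> \<longleftrightarrow> (1 - \<alpha>) * (1 - \<pi>) \<le> K * (\<alpha> * \<pi>)" by (simp add: algebra_simps)
  also have "\<dots> \<longleftrightarrow> Q_ratio \<alpha> \<pi> \<le> K"
    using \<alpha> \<pi> by (simp add: Q_ratio_def divide_le_eq)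
  finally show ?thesis .
qed

text \<open>Any admissible noncentrality is at most \<open>(n + p) * \<delta>\<^sup>2\<close>, and
  \<open>max_lr\<close> increases in it, which gives one direction. Conversely, thresholds tending
  to infinity in the extremal design bring the pFDR bound to its limit; since
  \<open>min_pFDR\<close> is an infimum, the boundary case
  \<open>Q_ratio \<alpha> \<pi> = F_max_lr p n \<delta>\<close> is included.\<close>

lemma attainable_iff:
  assumes p: "p \<ge> 1" and n: "n \<ge> 1" and \<delta>: "\<delta> > 0"
  shows "(\<exists>X \<beta> \<sigma>. admissible N p n \<delta> X \<beta> \<sigma> \<and> min_pFDR N (F_test_model N \<pi> p n X \<beta> \<sigma>) \<le> \<alpha>)
    \<longleftrightarrow> Q_ratio \<alpha> \<pi> \<le> F_max_lr p n \<delta>"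
proof
  have K: "F_max_lr p n \<delta> \<ge> 0"
    unfolding F_max_lr_def using p by (intro less_imp_le[OF max_lr_pos]) auto
  {
    assume "\<exists>X \<beta> \<sigma>. admissible N p n \<delta> X \<beta> \<sigma> \<and> min_pFDR N (F_test_model N \<pi> p n X \<beta> \<sigma>) \<le> \<alpha>"
    then obtain X \<beta> \<sigma> where adm: "admissible N p n \<delta> X \<beta> \<sigma>"
      and le: "min_pFDR N (F_test_model N \<pi> p n X \<beta> \<sigma>) \<le> \<alpha>" by blast
    define \<Delta> where "\<Delta> i = noncentrality p n X (\<beta> i) (\<sigma> i)" for i
    interpret R: random_effects N \<pi> "noncentral_F p n 0" "\<lambda>i. noncentral_F p n (\<Delta> i)"
      by (rule random_effects.intro) (simp_all add: \<pi> prob_space_noncentral_F)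
    have "(1 - \<pi>) / (1 - \<pi> + \<pi> * F_max_lr p n \<delta>) \<le>
        min_pFDR N (random_effects_model N \<pi> (noncentral_F p n 0) (\<lambda>i. noncentral_F p n (\<Delta> i)))"
    proof (rule R.min_pFDR_ge[OF N K])
      fix i and g :: "real \<Rightarrow> ennreal" assume i: "i < N" and g: "g \<in> borel_measurable borel"
      have D: "0 \<le> \<Delta> i" "\<Delta> i \<le> real (n + p) * \<delta>\<^sup>2"
        unfolding \<Delta>_def using adm i n noncentrality_bounds[of p \<delta> X "\<beta> i" "\<sigma> i" n]
        by (auto simp: admissible_def)
      have "(\<integral>\<^sup>+x. g x \<partial>noncentral_F p n (\<Delta> i))
          \<le> ennreal (max_lr (n / 2) (p / 2) (\<Delta> i / 2)) * (\<integral>\<^sup>+x. g x \<partial>noncentral_F p n 0)"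
        using p n D g by (intro noncentral_F_dominated) auto
      also have "\<dots> \<le> ennreal (F_max_lr p n \<delta>) * (\<integral>\<^sup>+x. g x \<partial>noncentral_F p n 0)"
        unfolding F_max_lr_def using p D by (intro mult_right_mono ennreal_leI max_lr_mono) auto
      finally show "(\<integral>\<^sup>+x. g x \<partial>noncentral_F p n (\<Delta> i))
          \<le> ennreal (F_max_lr p n \<delta>) * (\<integral>\<^sup>+x. g x \<partial>noncentral_F p n 0)" .
    qed
    also have "\<dots> \<le> \<alpha>" using le by (simp add: F_test_model_def \<Delta>_def)
    finally show "Q_ratio \<alpha> \<pi> \<le> F_max_lr p n \<delta>"
      using pFDR_bound_le_iff[OF K] by simp
  next
    assume Q: "Q_ratio \<alpha> \<pi> \<le> F_max_lr p n \<delta>"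
    define \<Delta> where "\<Delta> = real (n + p) * \<delta>\<^sup>2"
    have \<Delta>: "\<Delta> \<ge> 0" by (simp add: \<Delta>_def)
    obtain X \<beta> where adm: "admissible N p n \<delta> X \<beta> (\<lambda>_. 1)" and nc: "\<And>i. noncentrality p n X (\<beta> i) 1 = \<Delta>"
      using extremal_design[OF p n \<delta>] unfolding \<Delta>_def by blast
    interpret R: random_effects N \<pi> "noncentral_F p n 0" "\<lambda>i. noncentral_F p n \<Delta>"
      by (rule random_effects.intro) (simp_all add: \<pi> prob_space_noncentral_F)
    let ?M = "random_effects_model N \<pi> (noncentral_F p n 0) (\<lambda>i. noncentral_F p n \<Delta>)"
    have "min_pFDR N ?M \<le> (1 - \<pi>) / (1 - \<pi> + \<pi> * F_max_lr p n \<delta>)"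
    proof (rule tendsto_lowerbound)
      have "F_max_lr p n \<delta> = max_lr (n / 2) (p / 2) (\<Delta> / 2)"
        by (simp add: F_max_lr_def \<Delta>_def)
      then have "(F_likelihood_ratio p n \<Delta> \<longlongrightarrow> F_max_lr p n \<delta>) at_top"
        using F_likelihood_ratio_tendsto[OF p n] by simp
      moreover have "1 - \<pi> + \<pi> * F_max_lr p n \<delta> > 0" using \<pi> K by (intro add_pos_nonneg) auto
      ultimately show "((\<lambda>c. (1 - \<pi>) / (1 - \<pi> + \<pi> * F_likelihood_ratio p n \<Delta> c)) \<longlongrightarrow>
          (1 - \<pi>) / (1 - \<pi> + \<pi> * F_max_lr p n \<delta>)) at_top"
        by (intro tendsto_intros) auto
      show "\<forall>\<^sub>F c in at_top. min_pFDR N ?M \<le> (1 - \<pi>) / (1 - \<pi> + \<pi> * F_likelihood_ratio p n \<Delta> c)"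
        using eventually_gt_at_top[of 0]
      proof eventually_elim
        case (elim c)
        have "0 \<le> F_ratio_arg (p / n) c" using p n elim by (auto intro!: F_ratio_arg_bounds)
        then have "F_likelihood_ratio p n \<Delta> c \<ge> 0"
          using p \<Delta> hyp11_ge_1[of "n / 2" "p / 2" "\<Delta> / 2 * F_ratio_arg (p / n) c"]
          by (simp add: F_likelihood_ratio_def)
        then show ?case
          using R.min_pFDR_le[OF N _ central_F_tail_pos[OF p n elim] noncentral_F_tail_ratio[OF p n \<Delta> elim]] by simp
      qed
    qed simp
    also have "\<dots> \<le> \<alpha>" using pFDR_bound_le_iff[OF K] Q by simp
    finally have "min_pFDR N (F_test_model N \<pi> p n X \<beta> (\<lambda>_. 1)) \<le> \<alpha>"
      by (simp add: F_test_model_def nc)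
    with adm show "\<exists>X \<beta> \<sigma>. admissible N p n \<delta> X \<beta> \<sigma> \<and> min_pFDR N (F_test_model N \<pi> p n X \<beta> \<sigma>) \<le> \<alpha>"
      by blast
  }
qed

lemma n_star_eq:
  assumes "p \<ge> 1" "\<delta> > 0"
  shows "n_star N \<alpha> \<pi> p \<delta> = Inf {n. n \<ge> 1 \<and> Q_ratio \<alpha> \<pi> \<le> F_max_lr p n \<delta>}"
  unfolding n_star_def using attainable_iff[OF assms(1) _ assms(2)] by (intro arg_cong[where f=Inf]) auto

end

subsection \<open>Asymptotics\<close>

lemma F_max_lr_ge_powr:
  assumes "p \<ge> 1" "n \<ge> 1"
  shows "F_max_lr p n \<delta> \<ge> (1 + \<delta>\<^sup>2) powr (n / 2)"
proof -
  have "(1 + (real (n + p) * \<delta>\<^sup>2 / 2) / (n / 2 + p / 2)) powr (n / 2) \<le> F_max_lr p n \<delta>"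
    unfolding F_max_lr_def using assms by (intro max_lr_ge_powr) auto
  moreover have "(real (n + p) * \<delta>\<^sup>2 / 2) / (n / 2 + p / 2) = \<delta>\<^sup>2"
    using assms by (simp add: divide_simps)
  ultimately show ?thesis by simp
qed

lemma F_max_lr_le_powr:
  assumes "p \<ge> 2" "n \<ge> 1"
  shows "F_max_lr p n \<delta> \<le> (1 + real (n + p) * \<delta>\<^sup>2 / (real p - 1)) powr (n / 2)"
proof -
  \<comment> \<open>The constant \<open>B = (p - 1) / 2\<close> is \<open>a + b - 1\<close> at
    \<open>n = 1\<close>, hence at most \<open>a + b - 1\<close> for every
    \<open>n \<ge> 1\<close>.\<close>
  have "F_max_lr p n \<delta> \<le> (1 + (real (n + p) * \<delta>\<^sup>2 / 2) / ((real p - 1) / 2)) powr (n / 2)"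
    unfolding F_max_lr_def using assms by (intro max_lr_le_powr) auto
  then show ?thesis by simp
qed

lemma F_max_lr_le_hyp01:
  assumes "p \<ge> 1"
  shows "F_max_lr p n \<delta> \<le> hyp01 (p / 2) (real n * real (n + p) * \<delta>\<^sup>2 / 4)"
proof -
  have "F_max_lr p n \<delta> \<le> hyp01 (p / 2) (n / 2 * (real (n + p) * \<delta>\<^sup>2 / 2))"
    unfolding F_max_lr_def using assms by (intro max_lr_le_hyp01) auto
  then show ?thesis by (simp add: mult_ac)
qed

lemma F_max_lr_le_exp:
  assumes "p \<ge> 1"
  shows "F_max_lr p n \<delta> \<le> exp (real n * real (n + p) * \<delta>\<^sup>2 / (2 * real p))"
proof -
  note F_max_lr_le_hyp01[OF assms]
  also have "hyp01 (p / 2) (real n * real (n + p) * \<delta>\<^sup>2 / 4) \<le>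
      exp ((real n * real (n + p) * \<delta>\<^sup>2 / 4) / (p / 2))"
    using assms by (intro hyp01_le_exp) auto
  also have "(real n * real (n + p) * \<delta>\<^sup>2 / 4) / (p / 2) = real n * real (n + p) * \<delta>\<^sup>2 / (2 * real p)"
    by simp
  finally show ?thesis .
qed

lemma F_max_lr_ge_hyp01:
  assumes "p \<ge> 1"
  shows "F_max_lr p n \<delta> \<ge> exp (- (real (n + p) * \<delta>\<^sup>2 / 2)) * hyp01 (p / 2) ((real (n + p) * \<delta>)\<^sup>2 / 4)"
proof -
  have "F_max_lr p n \<delta> \<ge> exp (- (real (n + p) * \<delta>\<^sup>2 / 2)) *
      hyp01 (p / 2) ((n / 2 + p / 2) * (real (n + p) * \<delta>\<^sup>2 / 2))"
    unfolding F_max_lr_def using assms by (intro max_lr_ge_hyp01) auto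
  also have "(n / 2 + p / 2) * (real (n + p) * \<delta>\<^sup>2 / 2) = (real (n + p) * \<delta>)\<^sup>2 / 4"
    by (simp add: power2_eq_square field_simps)
  finally show ?thesis .
qed

text \<open>The condition of \<open>max_lr_ge_exp\<close>, rearranged to resemble the exponent in
  \<open>F_max_lr_le_exp\<close>: one factor \<open>n\<close> becomes \<open>n - 2 * l\<close>, and
  \<open>l\<close> becomes \<open>l * (1 + 2 * l / p)\<close>. Both corrections are relatively small
  for large \<open>n\<close> and \<open>p\<close>.\<close>

lemma F_max_lr_ge_exp:
  assumes "p \<ge> 1" "n \<ge> 1" "\<delta> > 0" "l > 0"
    and "l * (1 + 2 * l / real p) \<le> real (n + p) * (real n - 2 * l) * \<delta>\<^sup>2 / (2 * real p)"
  shows "F_max_lr p n \<delta> \<ge> exp l"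
  unfolding F_max_lr_def
proof (rule max_lr_ge_exp)
  have "p / 2 * (l * (1 + 2 * l / real p)) \<le> p / 2 * (real (n + p) * (real n - 2 * l) * \<delta>\<^sup>2 / (2 * real p))"
    using assms(5) by (intro mult_left_mono) auto
  moreover have "p / 2 * (l * (1 + 2 * l / real p)) = l * (p / 2 + l)"
    using assms by (simp add: field_simps)
  moreover have "p / 2 * (real (n + p) * (real n - 2 * l) * \<delta>\<^sup>2 / (2 * real p)) =
      n / 2 * (real (n + p) * \<delta>\<^sup>2 / 2) - l * (real (n + p) * \<delta>\<^sup>2 / 2)"
    using assms by (simp add: field_simps)
  ultimately have "l * (p / 2 + l) \<le> n / 2 * (real (n + p) * \<delta>\<^sup>2 / 2) - l * (real (n + p) * \<delta>\<^sup>2 / 2)"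
    by (simp only:)
  then show "l * (p / 2 + real (n + p) * \<delta>\<^sup>2 / 2 + l) \<le> n / 2 * (real (n + p) * \<delta>\<^sup>2 / 2)"
    by (simp only: distrib_left)
qed (use assms in auto)

section \<open>Growth of 0F1, and the inverse of M\<close>

lemma hyp01_diff:
  assumes "b > 0" "0 \<le> x" "x \<le> y"
  shows "hyp01 b y - hyp01 b x \<ge> (y - x) / b"
proof -
  define c where "c k = 1 / (fact k * pochhammer b k)" for k
  have c: "c k \<ge> 0" for k using assms by (simp add: c_def pochhammer_nonneg)
  have sums: "(\<lambda>k. c k * y ^ k - c k * x ^ k) sums (hyp01 b y - hyp01 b x)"
    unfolding c_def by (intro sums_diff hyp01_sums assms)
  \<comment> \<open>All term differences are nonnegative, and the linear term alone, with
    coefficient \<open>1 / b\<close>, gives the bound. This yields both strict monotonicity and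
    unboundedness.\<close>
  have "(\<Sum>k\<in>{1}. c k * y ^ k - c k * x ^ k) \<le> (\<Sum>k. c k * y ^ k - c k * x ^ k)"
    using sums c assms
    by (intro sum_le_suminf) (auto simp: sums_iff intro!: mult_left_mono power_mono)
  then show ?thesis using sums by (simp add: sums_iff c_def diff_divide_distrib)
qed

lemma hyp01_0 [simp]: "hyp01 b 0 = 1"
  using powser_zero[of "\<lambda>k. 1 / (fact k * pochhammer b k)"] by (simp add: hyp01_def)

lemma isCont_hyp01: "b > 0 \<Longrightarrow> isCont (hyp01 b) x"
  unfolding hyp01_def[abs_def] using hyp01_sums[of b]
  by (intro isCont_powser_converges_everywhere) (auto simp: sums_iff)

lemma M_fun_eq_hyp01:
  assumes "p \<ge> 1"
  shows "M_fun p t = hyp01 (p / 2) (t\<^sup>2 / 4)"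
  unfolding M_fun_def hyp01_def
proof (intro suminf_cong)
  fix k
  have nz: "real p / 2 \<notin> \<int>\<^sub>\<le>\<^sub>0"
    using nonpos_Ints_nonpos[of "real p / 2"] assms by force
  have pos: "Gamma (real p / 2) \<noteq> 0" "Gamma (real k + real p / 2) \<noteq> 0"
    using Gamma_real_pos[of "real p / 2"] Gamma_real_pos[of "real k + real p / 2"] assms by force+
  then show "Gamma (real p / 2) * (t\<^sup>2 / 4) ^ k / (fact k * Gamma (real k + real p / 2)) =
      1 / (fact k * pochhammer (real p / 2) k) * (t\<^sup>2 / 4) ^ k"
    by (simp add: pochhammer_Gamma[OF nz] add.commute field_simps)
qed

lemma M_fun_strict_mono:
  assumes "p \<ge> 1" "0 \<le> s" "s < t"
  shows "M_fun p s < M_fun p t"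
proof -
  have "s\<^sup>2 < t\<^sup>2" using assms by (intro power_strict_mono) auto
  then have "0 < (t\<^sup>2 / 4 - s\<^sup>2 / 4) / (p / 2)" using assms by simp
  also have "\<dots> \<le> M_fun p t - M_fun p s"
    unfolding M_fun_eq_hyp01[OF assms(1)] using assms \<open>s\<^sup>2 < t\<^sup>2\<close> by (intro hyp01_diff) auto
  finally show ?thesis by simp
qed

lemma M_inv_props:
  assumes "p \<ge> 1" "q > 1"
  shows "M_inv p q > 0" "M_fun p (M_inv p q) = q"
proof -
  have inj: "inj_on (M_fun p) {0..}"
  proof (rule inj_onI)
    fix s t assume "s \<in> {0..}" "t \<in> {0..}" "M_fun p s = M_fun p t"
    then show "s = t"
      using M_fun_strict_mono[OF assms(1), of s t] M_fun_strict_mono[OF assms(1), of t s]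
      by (cases s t rule: linorder_cases) auto
  qed
  have cont: "isCont (M_fun p) t" for t
  proof -
    have "isCont (\<lambda>t. hyp01 (p / 2) (t\<^sup>2 / 4)) t"
      using assms by (intro isCont_o2[OF _ isCont_hyp01] continuous_intros) auto
    moreover have "M_fun p = (\<lambda>t. hyp01 (p / 2) (t\<^sup>2 / 4))"
      using M_fun_eq_hyp01[OF assms(1)] by (intro ext)
    ultimately show ?thesis by simp
  qed
  \<comment> \<open>At \<open>T\<close> the linear term of the series for \<open>M_fun p\<close>
    equals \<open>q\<close>, so the intermediate value theorem applies between 0 and
    \<open>T\<close>.\<close>
  define T where "T = sqrt (2 * p * q)"
  have T: "T \<ge> 0" using assms by (simp add: T_def)
  have "(T\<^sup>2 / 4 - 0) / (p / 2) \<le> hyp01 (p / 2) (T\<^sup>2 / 4) - hyp01 (p / 2) 0"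
    using assms by (intro hyp01_diff) auto
  moreover have "(T\<^sup>2 / 4 - 0) / (p / 2) = q" using assms by (simp add: T_def)
  ultimately have "M_fun p T \<ge> q" by (simp add: M_fun_eq_hyp01[OF assms(1)])
  moreover have M0: "M_fun p 0 = 1" by (simp add: M_fun_eq_hyp01[OF assms(1)])
  ultimately obtain t where t: "t \<ge> 0" "M_fun p t = q"
    using IVT[of "M_fun p" 0 q T] T cont assms by auto
  then have "q \<in> M_fun p ` {0..}" by auto
  then have *: "M_fun p (M_inv p q) = q" "M_inv p q \<in> {0..}"
    unfolding M_inv_def using f_the_inv_into_f[OF inj] the_inv_into_into[OF inj _ order_refl] by blast+
  then show "M_fun p (M_inv p q) = q" by simp
  have "M_inv p q \<noteq> 0" using * M0 assms by auto
  then show "M_inv p q > 0" using * by simp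
qed

section \<open>From bounds on the likelihood ratio to the size of \<open>n_star\<close>\<close>

context
  fixes \<alpha> \<pi> :: real and N :: nat
  assumes \<alpha>: "0 < \<alpha>" "\<alpha> < 1" and \<pi>: "0 < \<pi>" "\<pi> < 1" and N: "N \<ge> 1" and Q: "Q_ratio \<alpha> \<pi> > 1"
begin

lemma n_star_le:
  "p \<ge> 1 \<Longrightarrow> \<delta> > 0 \<Longrightarrow> n \<ge> 1 \<Longrightarrow> Q_ratio \<alpha> \<pi> \<le> F_max_lr p n \<delta> \<Longrightarrow> n_star N \<alpha> \<pi> p \<delta> \<le> n"
  by (subst n_star_eq[OF \<alpha> \<pi> N]) (auto intro!: cInf_lower)

lemma Q_ratio_le_powr:
  assumes "\<delta> > 0" "real n \<ge> 2 * ln (Q_ratio \<alpha> \<pi>) / ln (1 + \<delta>\<^sup>2)"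
  shows "Q_ratio \<alpha> \<pi> \<le> (1 + \<delta>\<^sup>2) powr (n / 2)"
proof -
  have "ln (1 + \<delta>\<^sup>2) > 0" using assms by (intro ln_gt_zero) auto
  then have "ln (Q_ratio \<alpha> \<pi>) \<le> n / 2 * ln (1 + \<delta>\<^sup>2)" using assms(2) by (simp add: field_simps)
  then have "exp (ln (Q_ratio \<alpha> \<pi>)) \<le> (1 + \<delta>\<^sup>2) powr (n / 2)"
    using add_pos_nonneg[of 1 "\<delta>\<^sup>2"] by (simp add: powr_def)
  then show ?thesis using Q by simp
qed

text \<open>The power lower bound grows without limit in \<open>n\<close>, so some \<open>n\<close>
  qualifies, and an infimum of a nonempty set of naturals is attained.\<close>

lemma n_star_props:
  assumes "p \<ge> 1" "\<delta> > 0"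
  shows "n_star N \<alpha> \<pi> p \<delta> \<ge> 1" "Q_ratio \<alpha> \<pi> \<le> F_max_lr p (n_star N \<alpha> \<pi> p \<delta>) \<delta>"
proof -
  obtain n :: nat where n: "real n \<ge> 2 * ln (Q_ratio \<alpha> \<pi>) / ln (1 + \<delta>\<^sup>2)"
    using real_arch_simple by blast
  have "2 * ln (Q_ratio \<alpha> \<pi>) / ln (1 + \<delta>\<^sup>2) > 0"
    using Q assms by (intro divide_pos_pos mult_pos_pos ln_gt_zero) auto
  then have "n \<ge> 1" using n by (cases n) auto
  moreover have "Q_ratio \<alpha> \<pi> \<le> F_max_lr p n \<delta>"
    using Q_ratio_le_powr[OF assms(2) n] F_max_lr_ge_powr[OF assms(1) \<open>n \<ge> 1\<close>, of \<delta>] by simp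
  ultimately have "n \<in> {n. n \<ge> 1 \<and> Q_ratio \<alpha> \<pi> \<le> F_max_lr p n \<delta>}" by simp
  then have "Inf {n. n \<ge> 1 \<and> Q_ratio \<alpha> \<pi> \<le> F_max_lr p n \<delta>} \<in> {n. n \<ge> 1 \<and> Q_ratio \<alpha> \<pi> \<le> F_max_lr p n \<delta>}"
    by (intro Inf_nat_def1) auto
  then show "n_star N \<alpha> \<pi> p \<delta> \<ge> 1" "Q_ratio \<alpha> \<pi> \<le> F_max_lr p (n_star N \<alpha> \<pi> p \<delta>) \<delta>"
    using n_star_eq[OF \<alpha> \<pi> N assms] by simp_all
qed

text \<open>The power lower bound does not involve \<open>p\<close> and gives
  \<open>n_star \<le> m\<close> for every \<open>p \<ge> 1\<close>. For each of the finitely many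
  \<open>n\<close> from 1 to \<open>m - 1\<close> the upper bound tends, as \<open>p\<close> grows,
  to a power below Q. So \<open>n_star\<close> is eventually equal to \<open>m\<close>.\<close>

lemma n_star_fixed_effect:
  assumes \<delta>: "\<delta> > 0"
  shows "(\<lambda>p. real (n_star N \<alpha> \<pi> p \<delta>)) \<longlonglongrightarrow> real_of_int \<lceil>2 * ln (Q_ratio \<alpha> \<pi>) / ln (1 + \<delta>\<^sup>2)\<rceil>"
proof -
  define y where "y = 2 * ln (Q_ratio \<alpha> \<pi>) / ln (1 + \<delta>\<^sup>2)"
  have L: "ln (1 + \<delta>\<^sup>2) > 0" using \<delta> by (intro ln_gt_zero) auto
  have y: "y > 0" unfolding y_def using Q L by (intro divide_pos_pos mult_pos_pos ln_gt_zero) auto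
  define m where "m = nat \<lceil>y\<rceil>"
  have m: "real m \<ge> y" "m \<ge> 1" "real m = real_of_int \<lceil>y\<rceil>" "real m < y + 1"
    using y unfolding m_def by linarith+
  have upper: "n_star N \<alpha> \<pi> p \<delta> \<le> m" if "p \<ge> 1" for p
    using Q_ratio_le_powr[OF \<delta>, of m] F_max_lr_ge_powr[OF that m(2), of \<delta>] m
    by (intro n_star_le that \<delta>) (auto simp: y_def)
  have lower: "\<forall>\<^sub>F p in sequentially. F_max_lr p n \<delta> < Q_ratio \<alpha> \<pi>" if n: "n \<in> {1..<m}" for n
  proof -
    have "real n < y" using n m by (auto simp: less_eq_Suc_le) 
    then have "n / 2 * ln (1 + \<delta>\<^sup>2) < ln (Q_ratio \<alpha> \<pi>)" using L by (simp add: y_def field_simps)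
    then have "exp (n / 2 * ln (1 + \<delta>\<^sup>2)) < exp (ln (Q_ratio \<alpha> \<pi>))" by (simp only: exp_less_cancel_iff)
    moreover have "1 + \<delta>\<^sup>2 \<noteq> 0" using \<delta> by (intro less_imp_neq[THEN not_sym] add_pos_nonneg) auto
    ultimately have lt: "(1 + \<delta>\<^sup>2) powr (n / 2) < Q_ratio \<alpha> \<pi>" using Q by (simp add: powr_def)
    have "(\<lambda>p. (real n + real p) * d / (real p - 1)) \<longlonglongrightarrow> d" if "d > 0" for d
      using that by real_asymp
    from this[of "\<delta>\<^sup>2"] have "(\<lambda>p. 1 + real (n + p) * \<delta>\<^sup>2 / (real p - 1)) \<longlonglongrightarrow> 1 + \<delta>\<^sup>2"
      using \<delta> by (intro tendsto_add) auto
    then have "(\<lambda>p. (1 + real (n + p) * \<delta>\<^sup>2 / (real p - 1)) powr (n / 2)) \<longlonglongrightarrow> (1 + \<delta>\<^sup>2) powr (n / 2)"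
      using \<open>1 + \<delta>\<^sup>2 \<noteq> 0\<close> by (intro tendsto_powr tendsto_const) auto
    then have "\<forall>\<^sub>F p in sequentially. (1 + real (n + p) * \<delta>\<^sup>2 / (real p - 1)) powr (n / 2) < Q_ratio \<alpha> \<pi>"
      using lt by (rule order_tendstoD)
    then show ?thesis
      using eventually_ge_at_top[of 2]
    proof eventually_elim
      case (elim p)
      then show ?case using F_max_lr_le_powr[of p n \<delta>] n by auto
    qed
  qed
  have "\<forall>\<^sub>F p in sequentially. \<forall>n\<in>{1..<m}. F_max_lr p n \<delta> < Q_ratio \<alpha> \<pi>"
    by (intro eventually_ball_finite ballI lower) auto
  then have "\<forall>\<^sub>F p in sequentially. real (n_star N \<alpha> \<pi> p \<delta>) = real m"
    using eventually_ge_at_top[of 1]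
  proof eventually_elim
    case (elim p)
    have "n_star N \<alpha> \<pi> p \<delta> \<notin> {1..<m}" using elim n_star_props(2)[of p \<delta>] \<delta> by force
    then show ?case using upper[of p] n_star_props(1)[of p \<delta>] elim \<delta> by auto
  qed
  then show ?thesis using m(3) unfolding y_def by (simp add: tendsto_eventually)
qed

text \<open>It is shown that \<open>n_star * \<delta>\<close> tends to \<open>t\<close>. For fixed
  \<open>p\<close> the shift from \<open>n\<close> to \<open>n + p\<close> costs only
  \<open>p * \<delta>\<close>.\<close>

lemma n_star_fixed_dimension:
  assumes p: "p \<ge> 1"
  shows "(\<lambda>\<delta>. real (n_star N \<alpha> \<pi> p \<delta>)) \<sim>[at_right 0] (\<lambda>\<delta>. 1 / \<delta> * M_inv p (Q_ratio \<alpha> \<pi>))"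
proof (rule asymp_equivI')
  define t where "t = M_inv p (Q_ratio \<alpha> \<pi>)"
  have t: "t > 0" "M_fun p t = Q_ratio \<alpha> \<pi>" using M_inv_props[OF p Q] by (auto simp: t_def)
  let ?n = "\<lambda>\<delta>. real (n_star N \<alpha> \<pi> p \<delta>)"
  have pos: "\<forall>\<^sub>F \<delta> in at_right (0::real). \<delta> > 0"
    by (rule eventually_at_right_less)
  have lower: "t - real p * \<delta> \<le> ?n \<delta> * \<delta>" if \<delta>: "\<delta> > 0" for \<delta> :: real
  proof -
    let ?m = "n_star N \<alpha> \<pi> p \<delta>"
    have "hyp01 (p / 2) (t\<^sup>2 / 4) \<le> hyp01 (p / 2) (?n \<delta> * real (?m + p) * \<delta>\<^sup>2 / 4)"
      using n_star_props(2)[OF p \<delta>] F_max_lr_le_hyp01[OF p, of ?m \<delta>] t(2)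
      by (simp add: M_fun_eq_hyp01[OF p])
    then have "t\<^sup>2 / 4 \<le> ?n \<delta> * real (?m + p) * \<delta>\<^sup>2 / 4"
    proof (rule contrapos_pp)
      assume *: "\<not> t\<^sup>2 / 4 \<le> ?n \<delta> * real (?m + p) * \<delta>\<^sup>2 / 4"
      then have "0 < (t\<^sup>2 / 4 - ?n \<delta> * real (?m + p) * \<delta>\<^sup>2 / 4) / (p / 2)"
        using p by (intro divide_pos_pos) auto
      also have "\<dots> \<le> hyp01 (p / 2) (t\<^sup>2 / 4) - hyp01 (p / 2) (?n \<delta> * real (?m + p) * \<delta>\<^sup>2 / 4)"
        using * p by (intro hyp01_diff) auto
      finally show "\<not> hyp01 (p / 2) (t\<^sup>2 / 4) \<le> hyp01 (p / 2) (?n \<delta> * real (?m + p) * \<delta>\<^sup>2 / 4)" by simp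
    qed
    \<comment> \<open>Enlarging the factor \<open>n\<close> to \<open>n + p\<close> completes the
      square, so that \<open>t\<close> can be compared with \<open>(n + p) * \<delta>\<close>
      directly.\<close>
    also have "?n \<delta> * real (?m + p) * \<delta>\<^sup>2 / 4 \<le> ((?n \<delta> + p) * \<delta>)\<^sup>2 / 4"
    proof -
      have "?n \<delta> * real (?m + p) * \<delta>\<^sup>2 \<le> (?n \<delta> + p) * (?n \<delta> + p) * \<delta>\<^sup>2"
        by (intro mult_mono) auto
      then show ?thesis by (simp add: power2_eq_square mult_ac)
    qed
    finally have "t\<^sup>2 \<le> ((?n \<delta> + p) * \<delta>)\<^sup>2" by simp
    then have "t \<le> (?n \<delta> + p) * \<delta>" by (rule power2_le_imp_le) (use \<delta> in auto)
    then show ?thesis by (simp add: algebra_simps)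
  qed
  have upper: "\<forall>\<^sub>F \<delta> in at_right 0. ?n \<delta> * \<delta> < x" if x: "x > t" for x
  proof -
    \<comment> \<open>A point strictly between \<open>t\<close> and \<open>x\<close>: the surplus of
      \<open>M_fun p u\<close> over Q absorbs the factor \<open>exp (- z)\<close>, and the gap
      \<open>x - u\<close> absorbs the rounding of \<open>u / \<delta>\<close> to an
      integer.\<close>
    define u where "u = (t + x) / 2"
    have u: "t < u" "u < x" "u > 0" using x t(1) by (auto simp: u_def)
    have gt: "M_fun p u > Q_ratio \<alpha> \<pi>" using M_fun_strict_mono[OF p, of t u] t u by simp
    have "((\<lambda>\<delta>. exp (- ((u / \<delta> + 1 + p) * \<delta>\<^sup>2 / 2))) \<longlongrightarrow> 1) (at_right 0)"
      using u(3) by real_asymp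
    then have "((\<lambda>\<delta>. exp (- ((u / \<delta> + 1 + p) * \<delta>\<^sup>2 / 2)) * M_fun p u) \<longlongrightarrow> 1 * M_fun p u) (at_right 0)"
      by (intro tendsto_intros)
    then have "\<forall>\<^sub>F \<delta> in at_right 0. Q_ratio \<alpha> \<pi> < exp (- ((u / \<delta> + 1 + p) * \<delta>\<^sup>2 / 2)) * M_fun p u"
      using gt by (intro order_tendstoD(1)) auto
    moreover have "\<forall>\<^sub>F \<delta> in at_right 0. \<delta> < x - u"
      using u eventually_at_right_field[of "\<lambda>\<delta>. \<delta> < x - u" 0] by (auto intro!: exI[of _ "x - u"])
    ultimately show ?thesis using pos
    proof eventually_elim
      case (elim \<delta>)
      define m where "m = nat \<lceil>u / \<delta>\<rceil>"
      have "u / \<delta> > 0" using u elim by simp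
      then have m: "real m \<ge> u / \<delta>" "m \<ge> 1" "real m < u / \<delta> + 1" unfolding m_def by linarith+
      have "exp (- ((u / \<delta> + 1 + p) * \<delta>\<^sup>2 / 2)) * M_fun p u \<le>
          exp (- (real (m + p) * \<delta>\<^sup>2 / 2)) * hyp01 (p / 2) ((real (m + p) * \<delta>)\<^sup>2 / 4)"
      proof (rule mult_mono)
        show "exp (- ((u / \<delta> + 1 + p) * \<delta>\<^sup>2 / 2)) \<le> exp (- (real (m + p) * \<delta>\<^sup>2 / 2))"
          using m by (auto intro!: mult_right_mono)
        have "u \<le> real (m + p) * \<delta>"
          using m(1) elim by (simp add: field_simps add_increasing2)
        then have "u\<^sup>2 \<le> (real (m + p) * \<delta>)\<^sup>2" using u by (intro power_mono) auto
        then have "0 \<le> ((real (m + p) * \<delta>)\<^sup>2 / 4 - u\<^sup>2 / 4) / (p / 2)" by simp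
        also have "\<dots> \<le> hyp01 (p / 2) ((real (m + p) * \<delta>)\<^sup>2 / 4) - hyp01 (p / 2) (u\<^sup>2 / 4)"
          using p \<open>u\<^sup>2 \<le> _\<close> by (intro hyp01_diff) auto
        finally show "M_fun p u \<le> hyp01 (p / 2) ((real (m + p) * \<delta>)\<^sup>2 / 4)"
          by (simp add: M_fun_eq_hyp01[OF p])
        show "0 \<le> M_fun p u" using gt Q by simp
      qed simp
      also have "\<dots> \<le> F_max_lr p m \<delta>" by (rule F_max_lr_ge_hyp01[OF p])
      finally have "n_star N \<alpha> \<pi> p \<delta> \<le> m" using elim m p by (intro n_star_le) auto
      then have "?n \<delta> * \<delta> \<le> real m * \<delta>" using elim by (intro mult_right_mono) auto
      also have "\<dots> < (u / \<delta> + 1) * \<delta>" using elim m by (intro mult_strict_right_mono) auto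
      also have "\<dots> = u + \<delta>" using elim by (simp add: field_simps)
      finally show ?case using elim by simp
    qed
  qed
  have "((\<lambda>\<delta>. ?n \<delta> * \<delta>) \<longlongrightarrow> t) (at_right 0)"
  proof (rule order_tendstoI)
    fix x assume "t < x"
    then show "\<forall>\<^sub>F \<delta> in at_right 0. ?n \<delta> * \<delta> < x" by (rule upper)
  next
    fix x assume "x < t"
    have "((\<lambda>\<delta>. t - real p * \<delta>) \<longlongrightarrow> t - real p * 0) (at_right 0)" by (intro tendsto_intros)
    then have "\<forall>\<^sub>F \<delta> in at_right 0. x < t - real p * \<delta>"
      using \<open>x < t\<close> by (intro order_tendstoD(1)) auto
    then show "\<forall>\<^sub>F \<delta> in at_right 0. x < ?n \<delta> * \<delta>"
      using pos by eventually_elim (use lower in force)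
  qed
  then have "((\<lambda>\<delta>. ?n \<delta> * \<delta> / t) \<longlongrightarrow> t / t) (at_right 0)"
    using t by (intro tendsto_intros) auto
  then show "((\<lambda>\<delta>. ?n \<delta> / (1 / \<delta> * M_inv p (Q_ratio \<alpha> \<pi>))) \<longlongrightarrow> 1) (at_right 0)"
    using t by (simp add: t_def)
qed

section \<open>Growing dimension: comparison with the root of the quadratic equation\<close>

text \<open>The positive root \<open>n\<close> of \<open>n * (n + p) * \<delta>\<^sup>2 / (2 * real p) = l\<close>.\<close>

definition critical_n :: "real \<Rightarrow> nat \<Rightarrow> real \<Rightarrow> real" where
  "critical_n l p \<delta> = 4 / \<delta>\<^sup>2 * l / (1 + sqrt (1 + 8 * l / (\<delta>\<^sup>2 * p)))"

lemma critical_n_root: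
  assumes "p \<ge> 1" "\<delta> > 0" "l > 0"
  shows "critical_n l p \<delta> > 0"
    and "critical_n l p \<delta> * (critical_n l p \<delta> + real p) * \<delta>\<^sup>2 = 2 * real p * l"
proof -
  define r where "r = sqrt (1 + 8 * l / (\<delta>\<^sup>2 * p))"
  have r: "r > 0" "r\<^sup>2 = 1 + 8 * l / (\<delta>\<^sup>2 * p)"
    using assms by (auto simp: r_def add_pos_nonneg intro!: add_nonneg_nonneg)
  have c: "critical_n l p \<delta> = 4 / \<delta>\<^sup>2 * l / (1 + r)" by (simp add: critical_n_def r_def)
  show "critical_n l p \<delta> > 0" unfolding c using r assms by (intro divide_pos_pos mult_pos_pos) auto
  have l: "8 * l = (r - 1) * (1 + r) * (\<delta>\<^sup>2 * p)"
    using r(2) assms by (simp add: field_simps power2_eq_square)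
  \<comment> \<open>The usual form of the quadratic root. The definition is the rationalized form,
    which displays the dependence on \<open>\<delta>\<^sup>2 * p\<close>.\<close>
  have c2: "critical_n l p \<delta> = p * (r - 1) / 2"
  proof -
    have "critical_n l p \<delta> = (8 * l) / (2 * (\<delta>\<^sup>2 * (1 + r)))" unfolding c by simp
    also have "\<dots> = p * (r - 1) / 2" unfolding l using r assms by simp
    finally show ?thesis .
  qed
  have "critical_n l p \<delta> * (critical_n l p \<delta> + real p) * \<delta>\<^sup>2 = p * ((r - 1) * (1 + r) * (\<delta>\<^sup>2 * p)) / 4"
    unfolding c2 by (simp add: field_simps)
  then show "critical_n l p \<delta> * (critical_n l p \<delta> + real p) * \<delta>\<^sup>2 = 2 * real p * l"
    unfolding l[symmetric] by simp
qed

text \<open>Below the positive root the exponent of the upper bound for the likelihood ratio is less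
  than ln Q.\<close>

lemma n_star_ge_critical_n:
  assumes "p \<ge> 1" "\<delta> > 0"
  shows "real (n_star N \<alpha> \<pi> p \<delta>) \<ge> critical_n (ln (Q_ratio \<alpha> \<pi>)) p \<delta>"
proof (rule ccontr)
  let ?l = "ln (Q_ratio \<alpha> \<pi>)" and ?n = "n_star N \<alpha> \<pi> p \<delta>"
  let ?c = "critical_n ?l p \<delta>"
  have l: "?l > 0" using Q by simp
  assume "\<not> real ?n \<ge> ?c"
  then have lt: "real ?n < ?c" by simp
  have "real ?n * real (?n + p) * \<delta>\<^sup>2 < ?c * (?c + real p) * \<delta>\<^sup>2"
    using lt assms by (intro mult_strict_right_mono mult_strict_mono) auto
  also have "\<dots> = 2 * real p * ?l" using critical_n_root[OF assms l] by simp
  finally have "real ?n * real (?n + p) * \<delta>\<^sup>2 / (2 * real p) < ?l"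
    using assms by (simp add: divide_less_eq mult_ac)
  then have "exp (real ?n * real (?n + p) * \<delta>\<^sup>2 / (2 * real p)) < exp ?l" by (simp only: exp_less_cancel_iff)
  then show False
    using n_star_props(2)[OF assms] F_max_lr_le_exp[OF assms(1), of ?n \<delta>] Q by simp
qed

text \<open>The test value is \<open>(1 + e) * c\<close> rounded up, whence the final 1. A factor
  \<open>1 + e / 2\<close> pays for \<open>1 + 2 * l / p\<close>, and the remaining
  \<open>c * e / 2\<close> pays for the subtracted \<open>2 * l\<close>; these two needs dictate the
  thresholds \<open>4 * l / e\<close>.\<close>

lemma n_star_le_critical_n:
  assumes p: "p \<ge> 1" and \<delta>: "\<delta> > 0" and e: "e > 0"
    and large: "critical_n (ln (Q_ratio \<alpha> \<pi>)) p \<delta> \<ge> 4 * ln (Q_ratio \<alpha> \<pi>) / e" "p \<ge> 4 * ln (Q_ratio \<alpha> \<pi>) / e"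
  shows "real (n_star N \<alpha> \<pi> p \<delta>) \<le> (1 + e) * critical_n (ln (Q_ratio \<alpha> \<pi>)) p \<delta> + 1"
proof -
  define l c where "l = ln (Q_ratio \<alpha> \<pi>)" and "c = critical_n l p \<delta>"
  have l: "l > 0" using Q by (simp add: l_def)
  have c: "c > 0" "c * (c + real p) * \<delta>\<^sup>2 = 2 * real p * l" using critical_n_root[OF p \<delta> l] by (auto simp: c_def)
  have large: "c * e \<ge> 4 * l" "p * e \<ge> 4 * l"
    using large e by (simp_all add: divide_le_eq l_def c_def)
  define m where "m = nat \<lceil>(1 + e) * c\<rceil>"
  have "(1 + e) * c > 0" using e c by simp
  then have m: "real m \<ge> (1 + e) * c" "m \<ge> 1" "real m < (1 + e) * c + 1" unfolding m_def by linarith+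
  have "exp l \<le> F_max_lr p m \<delta>"
  proof (rule F_max_lr_ge_exp[OF p m(2) \<delta> l])
    have "2 * l / p \<le> e / 2" using large(2) p by (simp add: field_simps)
    then have "l * (1 + 2 * l / real p) \<le> l * (1 + e / 2)" using l by (intro mult_left_mono) auto
    also have "\<dots> = (c + real p) * (c * (1 + e / 2)) * \<delta>\<^sup>2 / (2 * real p)"
    proof -
      have "(c + real p) * (c * (1 + e / 2)) * \<delta>\<^sup>2 = (c * (c + real p) * \<delta>\<^sup>2) * (1 + e / 2)"
        by (simp only: mult_ac)
      then have eq: "(c + real p) * (c * (1 + e / 2)) * \<delta>\<^sup>2 = 2 * real p * l * (1 + e / 2)"
        by (simp only: c(2))
      show ?thesis unfolding eq using p by simp
    qed
    also have "\<dots> \<le> real (m + p) * (real m - 2 * l) * \<delta>\<^sup>2 / (2 * real p)"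
    proof (intro divide_right_mono mult_right_mono mult_mono)
      have "c \<le> (1 + e) * c" using c e by simp
      then show "c + real p \<le> real (m + p)" using m by simp
      show "c * (1 + e / 2) \<le> real m - 2 * l" using m(1) large(1) by (simp add: algebra_simps)
      show "0 \<le> c * (1 + e / 2)" using c e by simp
    qed (use p in auto)
    finally show "l * (1 + 2 * l / real p) \<le> real (m + p) * (real m - 2 * l) * \<delta>\<^sup>2 / (2 * real p)" .
  qed
  then have "n_star N \<alpha> \<pi> p \<delta> \<le> m" using Q m p \<delta> by (intro n_star_le) (auto simp: l_def)
  then show ?thesis using m(3) by (simp add: l_def c_def)
qed

context
  fixes \<delta> :: "nat \<Rightarrow> real" and p :: "nat \<Rightarrow> nat"
  assumes \<delta>: "\<And>j. \<delta> j > 0" "\<delta> \<longlonglongrightarrow> 0" and p: "\<And>j. p j \<ge> 1" "filterlim p at_top sequentially"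
begin

text \<open>Makes the size condition on the root hold eventually and the rounding error 1
  negligible. If the root stayed below \<open>C\<close>, its equation would have a left side of at
  most \<open>p * C * (C + 1) * \<delta>\<^sup>2\<close>, which is too small once \<delta> is
  small.\<close>

lemma critical_n_at_top:
  "filterlim (\<lambda>j. critical_n (ln (Q_ratio \<alpha> \<pi>)) (p j) (\<delta> j)) at_top sequentially"
  unfolding filterlim_at_top_gt[where c=0]
proof (intro allI impI)
  fix C :: real assume C: "C > 0"
  let ?l = "ln (Q_ratio \<alpha> \<pi>)"
  have l: "?l > 0" using Q by simp
  have "(\<lambda>j. C * (C + 1) * (\<delta> j)\<^sup>2) \<longlonglongrightarrow> C * (C + 1) * 0\<^sup>2"
    by (intro tendsto_intros \<delta>)
  then have "\<forall>\<^sub>F j in sequentially. C * (C + 1) * (\<delta> j)\<^sup>2 < 2 * ?l"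
    using l by (intro order_tendstoD(2)) auto
  then show "\<forall>\<^sub>F j in sequentially. C \<le> critical_n ?l (p j) (\<delta> j)"
  proof eventually_elim
    case (elim j)
    let ?c = "critical_n ?l (p j) (\<delta> j)"
    show ?case
    proof (rule ccontr)
      assume "\<not> C \<le> ?c"
      then have lt: "?c < C" by simp
      have c: "?c > 0" "?c * (?c + real (p j)) * (\<delta> j)\<^sup>2 = 2 * real (p j) * ?l"
        using critical_n_root[OF p(1) \<delta>(1) l] by auto
      have "?c * (?c + real (p j)) * (\<delta> j)\<^sup>2 \<le> C * (C + p j) * (\<delta> j)\<^sup>2"
        using lt c C by (intro mult_right_mono mult_mono) auto
      also have "\<dots> \<le> C * ((C + 1) * p j) * (\<delta> j)\<^sup>2"
      proof -
        have "C * 1 \<le> C * real (p j)" using C p(1)[of j] by (intro mult_left_mono) auto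
        then have "C + p j \<le> (C + 1) * p j" by (simp add: algebra_simps)
        then show ?thesis using C by (intro mult_right_mono mult_left_mono) auto
      qed
      also have "\<dots> = p j * (C * (C + 1) * (\<delta> j)\<^sup>2)" by (simp add: mult_ac)
      also have "\<dots> < p j * (2 * ?l)" using elim p(1)[of j] by (intro mult_strict_left_mono) auto
      finally show False using c by simp
    qed
  qed
qed

lemma n_star_asymp_critical_n:
  "(\<lambda>j. real (n_star N \<alpha> \<pi> (p j) (\<delta> j))) \<sim>[sequentially] (\<lambda>j. critical_n (ln (Q_ratio \<alpha> \<pi>)) (p j) (\<delta> j))"
proof (rule asymp_equivI')
  define l where "l = ln (Q_ratio \<alpha> \<pi>)"
  define c where "c j = critical_n l (p j) (\<delta> j)" for j
  have l: "l > 0" using Q by (simp add: l_def)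
  have c: "c j > 0" for j using critical_n_root(1)[OF p(1) \<delta>(1) l] by (simp add: c_def)
  have c_top: "filterlim c at_top sequentially" using critical_n_at_top by (simp add: c_def[abs_def] l_def)
  let ?n = "\<lambda>j. real (n_star N \<alpha> \<pi> (p j) (\<delta> j))"
  have "(\<lambda>j. ?n j / c j) \<longlonglongrightarrow> 1"
  proof (rule order_tendstoI)
    fix x :: real assume "x < 1"
    have "?n j / c j \<ge> 1" for j
      using n_star_ge_critical_n[OF p(1) \<delta>(1)] c[of j] by (simp add: c_def l_def)
    then show "\<forall>\<^sub>F j in sequentially. x < ?n j / c j"
      using \<open>x < 1\<close> by (intro always_eventually allI) (meson less_le_trans)
  next
    fix x :: real assume x: "1 < x"
    \<comment> \<open>Chosen with \<open>1 + 2 * e = x\<close>: one \<open>e\<close> is the loss in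
      the upper bound for \<open>n_star\<close>, the other absorbs the added 1 once
      \<open>c j > 1 / e\<close>.\<close>
    define e where "e = (x - 1) / 2"
    have e: "e > 0" using x by (simp add: e_def)
    have "\<forall>\<^sub>F j in sequentially. c j \<ge> 4 * l / e"
      using c_top by (simp add: filterlim_at_top)
    moreover have "\<forall>\<^sub>F j in sequentially. c j > 1 / e"
      using c_top by (simp add: filterlim_at_top_dense)
    moreover have "\<forall>\<^sub>F j in sequentially. real (p j) \<ge> 4 * l / e"
      using filterlim_compose[OF filterlim_real_sequentially p(2)] by (auto simp: filterlim_at_top)
    ultimately show "\<forall>\<^sub>F j in sequentially. ?n j / c j < x"
    proof eventually_elim
      case (elim j)
      have "?n j \<le> (1 + e) * c j + 1"
        using n_star_le_critical_n[OF p(1) \<delta>(1) e, of j j] elim by (simp add: c_def l_def)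
      also have "\<dots> < (1 + e) * c j + e * c j" using elim e by (simp add: field_simps)
      also have "\<dots> = x * c j" by (simp add: e_def algebra_simps)
      finally show ?case using c[of j] by (simp add: divide_less_eq)
    qed
  qed
  then show "(\<lambda>j. ?n j / critical_n (ln (Q_ratio \<alpha> \<pi>)) (p j) (\<delta> j)) \<longlonglongrightarrow> 1"
    by (simp add: c_def l_def)
qed

lemma n_star_asymp_limit:
  assumes L: "L > 0" "(\<lambda>j. (\<delta> j)\<^sup>2 * real (p j)) \<longlonglongrightarrow> L"
  shows "(\<lambda>j. real (n_star N \<alpha> \<pi> (p j) (\<delta> j))) \<sim>[sequentially]
    (\<lambda>j. 4 / (\<delta> j)\<^sup>2 * ln (Q_ratio \<alpha> \<pi>) / (1 + sqrt (1 + 8 * ln (Q_ratio \<alpha> \<pi>) / L)))"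
proof (rule asymp_equiv_trans[OF n_star_asymp_critical_n asymp_equivI'])
  define l where "l = ln (Q_ratio \<alpha> \<pi>)"
  have l: "l > 0" using Q by (simp add: l_def)
  define s where "s j = (\<delta> j)\<^sup>2 * real (p j)" for j
  have pos: "1 + sqrt (1 + 8 * l / y) > 0" if "y > 0" for y
    using l that by (intro add_pos_nonneg) auto
  have "(\<lambda>j. (1 + sqrt (1 + 8 * l / L)) / (1 + sqrt (1 + 8 * l / s j))) \<longlonglongrightarrow>
      (1 + sqrt (1 + 8 * l / L)) / (1 + sqrt (1 + 8 * l / L))"
    using L pos[OF L(1)] by (intro tendsto_intros) (auto simp: s_def)
  moreover have "critical_n l (p j) (\<delta> j) / (4 / (\<delta> j)\<^sup>2 * l / (1 + sqrt (1 + 8 * l / L))) =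
      (1 + sqrt (1 + 8 * l / L)) / (1 + sqrt (1 + 8 * l / s j))" for j
    using l \<delta>(1)[of j] by (simp add: critical_n_def s_def)
  ultimately show "(\<lambda>j. critical_n (ln (Q_ratio \<alpha> \<pi>)) (p j) (\<delta> j) /
      (4 / (\<delta> j)\<^sup>2 * ln (Q_ratio \<alpha> \<pi>) / (1 + sqrt (1 + 8 * ln (Q_ratio \<alpha> \<pi>) / L)))) \<longlonglongrightarrow> 1"
    using pos[OF L(1)] by (simp add: l_def)
qed

lemma n_star_asymp_infinity:
  assumes "filterlim (\<lambda>j. (\<delta> j)\<^sup>2 * real (p j)) at_top sequentially"
  shows "(\<lambda>j. real (n_star N \<alpha> \<pi> (p j) (\<delta> j))) \<sim>[sequentially] (\<lambda>j. 2 / (\<delta> j)\<^sup>2 * ln (Q_ratio \<alpha> \<pi>))"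
proof (rule asymp_equiv_trans[OF n_star_asymp_critical_n asymp_equivI'])
  define l where "l = ln (Q_ratio \<alpha> \<pi>)"
  have l: "l > 0" using Q by (simp add: l_def)
  define s where "s j = (\<delta> j)\<^sup>2 * real (p j)" for j
  have "(\<lambda>j. 8 * l / s j) \<longlonglongrightarrow> 0"
    unfolding s_def by (intro tendsto_divide_0[OF tendsto_const] filterlim_at_top_imp_at_infinity assms)
  then have "(\<lambda>j. 2 / (1 + sqrt (1 + 8 * l / s j))) \<longlonglongrightarrow> 2 / (1 + sqrt (1 + 0))"
    by (intro tendsto_intros) auto
  moreover have "critical_n l (p j) (\<delta> j) / (2 / (\<delta> j)\<^sup>2 * l) = 2 / (1 + sqrt (1 + 8 * l / s j))" for j
  proof -
    have eq: "(4 / d * l / D) / (2 / d * l) = 2 / D" if "d \<noteq> 0" for d D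
      using that l by (cases "D = 0") (simp_all add: field_simps)
    show ?thesis unfolding critical_n_def s_def by (rule eq) (use \<delta>(1)[of j] in simp)
  qed
  ultimately show "(\<lambda>j. critical_n (ln (Q_ratio \<alpha> \<pi>)) (p j) (\<delta> j) / (2 / (\<delta> j)\<^sup>2 * ln (Q_ratio \<alpha> \<pi>))) \<longlonglongrightarrow> 1"
    by (simp add: l_def)
qed

lemma n_star_asymp_zero:
  assumes "(\<lambda>j. (\<delta> j)\<^sup>2 * real (p j)) \<longlonglongrightarrow> 0"
  shows "(\<lambda>j. real (n_star N \<alpha> \<pi> (p j) (\<delta> j))) \<sim>[sequentially]
    (\<lambda>j. 1 / \<delta> j * sqrt (2 * real (p j) * ln (Q_ratio \<alpha> \<pi>)))"
proof (rule asymp_equiv_trans[OF n_star_asymp_critical_n asymp_equivI'])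
  define l where "l = ln (Q_ratio \<alpha> \<pi>)"
  have l: "l > 0" using Q by (simp add: l_def)
  define s where "s j = (\<delta> j)\<^sup>2 * real (p j)" for j
  have s: "s j > 0" for j using \<delta>(1)[of j] p(1)[of j] by (simp add: s_def)
  have s0: "s \<longlonglongrightarrow> 0" using assms by (simp add: s_def[abs_def])
  \<comment> \<open>Here \<open>8 * l / s j\<close> diverges. Multiplying numerator and denominator
    by suitable roots yields an expression continuous at \<open>s = 0\<close>, where it equals
    1.\<close>
  have "(\<lambda>j. 4 * l / (sqrt (2 * l * s j) + sqrt (2 * l * s j + (4 * l)\<^sup>2))) \<longlonglongrightarrow>
      4 * l / (sqrt (2 * l * 0) + sqrt (2 * l * 0 + (4 * l)\<^sup>2))"
    using l by (intro tendsto_intros s0) auto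
  moreover have "4 * l / (sqrt (2 * l * 0) + sqrt (2 * l * 0 + (4 * l)\<^sup>2)) = 1"
  proof -
    have "sqrt ((4 * l)\<^sup>2) = 4 * l" using l by (intro real_sqrt_unique) auto
    then show ?thesis unfolding mult_zero_right add_0 real_sqrt_zero using l by simp
  qed
  moreover have "critical_n l (p j) (\<delta> j) / (1 / \<delta> j * sqrt (2 * real (p j) * l)) =
      4 * l / (sqrt (2 * l * s j) + sqrt (2 * l * s j + (4 * l)\<^sup>2))" for j
  proof -
    have d: "\<delta> j > 0" by (rule \<delta>)
    have "sqrt (2 * l * s j) = sqrt ((\<delta> j)\<^sup>2 * (2 * real (p j) * l))" by (simp add: s_def mult_ac)
    also have "\<dots> = \<delta> j * sqrt (2 * real (p j) * l)" using d by (subst real_sqrt_mult) simp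
    finally have 1: "sqrt (2 * l * s j) = \<delta> j * sqrt (2 * real (p j) * l)" .
    have "2 * l * s j + (4 * l)\<^sup>2 = 2 * l * s j * (1 + 8 * l / s j)"
      using s[of j] by (simp add: field_simps power2_eq_square)
    then have 2: "sqrt (2 * l * s j + (4 * l)\<^sup>2) = sqrt (2 * l * s j) * sqrt (1 + 8 * l / s j)"
      by (simp only: real_sqrt_mult)
    have "critical_n l (p j) (\<delta> j) / (1 / \<delta> j * sqrt (2 * real (p j) * l)) =
        4 * l / ((\<delta> j * sqrt (2 * real (p j) * l)) * (1 + sqrt (1 + 8 * l / s j)))"
      using d by (simp add: critical_n_def s_def power2_eq_square)
    then show ?thesis unfolding 2 unfolding 1 by (simp add: algebra_simps)
  qed
  ultimately show "(\<lambda>j. critical_n (ln (Q_ratio \<alpha> \<pi>)) (p j) (\<delta> j) /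
      (1 / \<delta> j * sqrt (2 * real (p j) * ln (Q_ratio \<alpha> \<pi>)))) \<longlonglongrightarrow> 1"
    unfolding l_def[symmetric] by (simp only:)
qed

end

end

theorem theorem3p1:
  fixes \<alpha> \<pi> :: real and N :: nat
  assumes "0 < \<alpha>" "\<alpha> < 1" "0 < \<pi>" "\<pi> < 1" "N \<ge> 1"
    and "Q_ratio \<alpha> \<pi> > 1"
  shows
    "(\<forall>p\<ge>1. (\<lambda>\<delta>. real (n_star N \<alpha> \<pi> p \<delta>)) \<sim>[at_right 0] (\<lambda>\<delta>. 1 / \<delta> * M_inv p (Q_ratio \<alpha> \<pi>))) \<and>
     (\<forall>(\<delta> :: nat \<Rightarrow> real) (p :: nat \<Rightarrow> nat).
        (\<forall>j. \<delta> j > 0 \<and> p j \<ge> 1) \<and> \<delta> \<longlonglongrightarrow> 0 \<and> filterlim p at_top sequentially \<longrightarrow>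
          ((\<lambda>j. (\<delta> j)\<^sup>2 * real (p j)) \<longlonglongrightarrow> 0 \<longrightarrow>
             (\<lambda>j. real (n_star N \<alpha> \<pi> (p j) (\<delta> j))) \<sim>[sequentially]
             (\<lambda>j. 1 / \<delta> j * sqrt (2 * real (p j) * ln (Q_ratio \<alpha> \<pi>)))) \<and>
          (filterlim (\<lambda>j. (\<delta> j)\<^sup>2 * real (p j)) at_top sequentially \<longrightarrow>
             (\<lambda>j. real (n_star N \<alpha> \<pi> (p j) (\<delta> j))) \<sim>[sequentially]
             (\<lambda>j. 2 / (\<delta> j)\<^sup>2 * ln (Q_ratio \<alpha> \<pi>))) \<and>
          (\<forall>L>0. (\<lambda>j. (\<delta> j)\<^sup>2 * real (p j)) \<longlonglongrightarrow> L \<longrightarrow>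
             (\<lambda>j. real (n_star N \<alpha> \<pi> (p j) (\<delta> j))) \<sim>[sequentially]
             (\<lambda>j. 4 / (\<delta> j)\<^sup>2 * ln (Q_ratio \<alpha> \<pi>)
                    / (1 + sqrt (1 + 8 * ln (Q_ratio \<alpha> \<pi>) / L))))) \<and>
     (\<forall>\<delta>>0. (\<lambda>p. real (n_star N \<alpha> \<pi> p \<delta>)) \<longlonglongrightarrow>
        real_of_int \<lceil>2 * ln (Q_ratio \<alpha> \<pi>) / ln (1 + \<delta>\<^sup>2)\<rceil>)"
  using n_star_fixed_dimension[OF assms] n_star_fixed_effect[OF assms]
    n_star_asymp_zero[OF assms] n_star_asymp_infinity[OF assms] n_star_asymp_limit[OF assms]
  by blast

end
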